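(* Consider the recurrence $x_{n+1}=ax_n(1-x_n)$ for $a\in(0,1/2)$. Let $\mathcal J$ be the Julia set of the map $x\mapsto ax(1-x)$ and let $S_1$ be the open unit disk. (i) There is an analytic function $G$, satisfying the functional relation $$G(z)^2=a\,G(z^2)\,(1+G(z)),$$ which is a conformal map of $S_1$ onto $\{-x^{-1}:x\in\mathrm{ext}(\mathcal J)\}$. (ii) $G$ is Lipschitz continuous of exponent $\log_2(2-a)$ in $\overline{S_1}$ (the Lipschitz constant can be determined from the proof). (iii) $\partial S_1$ is a barrier of singularities of $G$. Near $1\in\partial S_1$ we have $$G(z)=\Phi\big(\tau\,\Psi(\ln\tau)\big),\qquad \tau=\tau(z)=\big(\ln (z^{-1})\big)^{\log_2(2-a)},$$ where $\Phi$ is analytic at zero, $\Phi(0)=\frac{a}{1-a}$, $\Phi'(0)=1$, and $\Psi$ is real analytic and periodic of period $\ln 2$. With $t=1-z$ we have, for some constants $C_{l;k,m}$, $$G=\frac{a}{1-a}+\sum_{l\in\mathbb Z}\ \sum_{k,m\in\mathbb N}C_{l;k,m}\;t^{\,2\pi i l\log_2(2-a)/\ln 2+k\log_2(2-a)+m},$$ where the series converges (rapidly) if $t$ and $|\arg t|$ are small.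
   Context: The Julia set of a rational map is the complement in the Riemann sphere $\mathbb C_\infty$ of the maximal open set on which the iterates are equicontinuous (in the chordal metric). $\mathrm{ext}(\mathcal J)$ is the exterior of $\mathcal J$, i.e. the component of $\mathbb C_\infty\setminus\mathcal J$ containing $\infty$, with the convention $1/\infty=0$. $\mathbb N$ includes $0$. $G$ is normalized by $G(0)=0$, $G'(0)=a$. "Barrier of singularities" means that $G$ cannot be continued analytically across any point of $\partial S_1$. "Lipschitz continuous of exponent $\beta$" on a set means $|G(z)-G(w)|\le K|z-w|^{\beta}$ there for some constant $K$ (Hölder continuity). In (iii), "near $1$" refers to $z\in S_1$ close to $1$ with $|\arg(1-z)|<\delta$ for some $\delta>0$; $\Psi$ at complex arguments denotes its analytic extension to a neighborhood of $\mathbb R$, and principal branches of logarithms and powers are used.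
   Formalization: In (iii) the period of Ψ is ln(2−a) instead of ln 2, and in the series exponents 2πil·log₂(2−a)/ln 2 is replaced by 2πil·log₂(2−a)/ln(2−a); as printed, (iii) contradicts its own barrier claim when log₂(2−a) is irrational. *)

theory Defs
  imports "HOL-Complex_Analysis.Complex_Analysis"
begin

section \<open>The Riemann sphere\<close>

text \<open>
  The sphere is the one-point compactification of the plane, on \<^typ>\<open>complex option\<close>,
  with \<^const>\<open>None\<close> as the point at infinity.
\<close>

abbreviation riemann_sphere :: "complex option topology" where
  "riemann_sphere \<equiv> Alexandroff_compactification (euclidean :: complex topology)"

fun chordal_dist :: "complex option \<Rightarrow> complex option \<Rightarrow> real" where
  "chordal_dist (Some z) (Some w) =
     2 * norm (z - w) / (sqrt (1 + (norm z)\<^sup>2) * sqrt (1 + (norm w)\<^sup>2))"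
| "chordal_dist (Some z) None = 2 / sqrt (1 + (norm z)\<^sup>2)"
| "chordal_dist None (Some w) = 2 / sqrt (1 + (norm w)\<^sup>2)"
| "chordal_dist None None = 0"

text \<open>The map \<open>x \<mapsto> -1/x\<close> of the sphere, which exchanges 0 and infinity.\<close>

fun sphere_neg_recip :: "complex option \<Rightarrow> complex option" where
  "sphere_neg_recip None = Some 0"
| "sphere_neg_recip (Some x) = (if x = 0 then None else Some (- inverse x))"

fun logistic :: "complex \<Rightarrow> complex option \<Rightarrow> complex option" where
  "logistic a None = None"
| "logistic a (Some x) = Some (a * x * (1 - x))"

section \<open>Julia sets\<close>

definition equicontinuous_at ::
    "(complex option \<Rightarrow> complex option) set \<Rightarrow> complex option \<Rightarrow> bool" where
  "equicontinuous_at \<F> p \<longleftrightarrow>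
     (\<forall>e>0. \<exists>d>0. \<forall>f\<in>\<F>. \<forall>q. chordal_dist p q < d \<longrightarrow> chordal_dist (f p) (f q) < e)"

text \<open>
  Equicontinuity on a set means equicontinuity at each of its points, so the union of all open
  sets of equicontinuity is again one; this is the maximal one.
\<close>

definition fatou_set :: "(complex option \<Rightarrow> complex option) \<Rightarrow> complex option set" where
  "fatou_set R = \<Union>{U. openin riemann_sphere U \<and>
                       (\<forall>p\<in>U. equicontinuous_at (range (\<lambda>n. R ^^ n)) p)}"

definition julia_set :: "(complex option \<Rightarrow> complex option) \<Rightarrow> complex option set" where
  "julia_set R = topspace riemann_sphere - fatou_set R"

definition exterior :: "complex option set \<Rightarrow> complex option set" where
  "exterior J =
     connected_component_of_set (subtopology riemann_sphere (topspace riemann_sphere - J)) None"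

section \<open>Boundary behaviour and real analyticity\<close>

definition hoelder_on :: "real \<Rightarrow> complex set \<Rightarrow> (complex \<Rightarrow> complex) \<Rightarrow> bool" where
  "hoelder_on \<beta> S f \<longleftrightarrow> (\<exists>K. \<forall>z\<in>S. \<forall>w\<in>S. norm (f z - f w) \<le> K * norm (z - w) powr \<beta>)"

definition continues_across :: "(complex \<Rightarrow> complex) \<Rightarrow> complex set \<Rightarrow> complex \<Rightarrow> bool" where
  "continues_across f S \<zeta> \<longleftrightarrow>
     (\<exists>r>0. \<exists>g. g holomorphic_on ball \<zeta> r \<and> (\<forall>z \<in> ball \<zeta> r \<inter> S. g z = f z))"

definition barrier_of_singularities :: "(complex \<Rightarrow> complex) \<Rightarrow> complex set \<Rightarrow> bool" where
  "barrier_of_singularities f S \<longleftrightarrow> (\<forall>\<zeta> \<in> frontier S. \<not> continues_across f S \<zeta>)"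

definition real_analytic :: "(real \<Rightarrow> real) \<Rightarrow> bool" where
  "real_analytic f \<longleftrightarrow>
     (\<forall>x. \<exists>c. \<exists>r>0. \<forall>y. \<bar>y - x\<bar> < r \<longrightarrow> (\<lambda>n. c n * (y - x) ^ n) sums f y)"

text \<open>Connectedness of \<open>N\<close> makes the extension unique on \<open>N\<close>.\<close>

definition analytic_extension ::
    "(real \<Rightarrow> real) \<Rightarrow> complex set \<Rightarrow> (complex \<Rightarrow> complex) \<Rightarrow> bool" where
  "analytic_extension f N F \<longleftrightarrow>
     open N \<and> connected N \<and> \<real> \<subseteq> N \<and> F holomorphic_on N \<and>
     (\<forall>x. F (complex_of_real x) = complex_of_real (f x))"

section \<open>Local coordinates at 1\<close>

definition disc_sector :: "real \<Rightarrow> real \<Rightarrow> complex set" where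
  "disc_sector \<epsilon> \<delta> = {z \<in> ball 0 1. norm (1 - z) < \<epsilon> \<and> \<bar>Arg (1 - z)\<bar> < \<delta>}"

text \<open>
  Near 1, replacing \<open>z\<close> by \<open>z\<^sup>2\<close> doubles \<open>ln (1/z)\<close>, hence multiplies \<open>\<tau>\<close> by
  \<open>2 powr log 2 (2 - a) = 2 - a\<close>, the multiplier of the fixed point \<open>a / (1 - a)\<close> of
  \<open>w \<mapsto> w\<^sup>2 / (a * (1 + w))\<close>, the map that takes \<open>G z\<close> to \<open>G (z\<^sup>2)\<close>. In the variable
  \<open>ln \<tau>\<close> this is translation by \<open>ln (2 - a)\<close> (in \<open>ln (ln (1/z))\<close> it is translation
  by \<open>ln 2\<close>).
\<close>

definition tau :: "real \<Rightarrow> complex \<Rightarrow> complex" where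
  "tau a z = Ln (inverse z) powr complex_of_real (log 2 (2 - a))"

text \<open>
  The frequencies \<open>2 * pi * l / ln (2 - a)\<close> are those of functions of \<open>ln \<tau>\<close> with period
  \<open>ln (2 - a)\<close>, and \<open>\<tau>\<close> behaves like \<open>t powr log 2 (2 - a)\<close>. The imaginary part
  simplifies to \<open>2 * pi * l / ln 2\<close>.
\<close>

definition expansion_exponent :: "real \<Rightarrow> int \<Rightarrow> nat \<Rightarrow> nat \<Rightarrow> complex" where
  "expansion_exponent a l k m =
     2 * complex_of_real pi * \<i> * of_int l * complex_of_real (log 2 (2 - a) / ln (2 - a))
     + complex_of_real (real k * log 2 (2 - a) + real m)"

end

theory Submission
  imports Defs
begin

text \<open>
  In the coordinate \<open>Z = a (1/2 - x)\<close> the map becomes \<open>Z \<mapsto> Z\<^sup>2 + \<kappa>\<close> with repelling fixed point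
  \<open>\<rho> = 1 - a/2\<close> of multiplier \<open>\<mu> = 2 \<rho> = 2 - a = 2\<^sup>\<beta>\<close>, and \<open>G = 2 a / (2 E - a)\<close> for the inverse
  Boettcher map \<open>E\<close>, which satisfies \<open>E(z\<^sup>2) = E(z)\<^sup>2 + \<kappa>\<close>. Writing \<open>E(z) = exp(-q(z)) / z\<close> and
  taking logarithms, \<open>q\<close> is the fixed point of a contraction with constant \<open>1/\<mu>\<close> on functions on the closed disc
  with \<open>Re q \<le> - ln \<rho>\<close>; this yields the continuous extension to the circle and the Hoelder
  exponent. The image of \<open>E\<close> is completely invariant, its points escape, and equicontinuity fails on
  its boundary, so it is the exterior of the Julia set. At the fixed point, the blow-up limit
  \<open>S(y) = lim \<mu>\<^sup>n (E(exp(-y/2\<^sup>n)) - \<rho>)\<close> satisfies \<open>S(2y) = \<mu> S(y)\<close>, and \<open>E(exp(-y)) - \<rho>\<close> is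
  the Poincare function of the fixed point evaluated at \<open>S(y)\<close>. Hence \<open>y\<^sup>-\<^sup>\<beta> S(y)\<close> is periodic in
  \<open>ln y\<close>; its Fourier series in a strip gives the expansion, and because \<open>\<mu> < 2\<close> no analytic
  continuation across the circle is possible.
\<close>

section \<open>Preliminaries from complex analysis\<close>

text \<open>Everything rests on one coincidence of constants. The half-plane
  \<open>Re q \<le> - ln \<rho>\<close> is bounded by the value of \<open>q\<close> at 1, because
  \<open>E 1 = \<rho>\<close>. On it the derivative of the contraction is at most
  \<open>1 / (2 * \<rho>)\<close>, the reciprocal of the multiplier at the fixed point. Squaring at
  most doubles distances in the disc, so a modulus \<open>x powr \<beta>\<close> reproduces itself
  when \<open>2 powr \<beta> = \<mu>\<close>. Contraction constant, Hoelder exponent and scaling of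
  the blow-up are therefore governed by the same number: the Hoelder bound at 1 is what keeps the
  rescaled differences \<open>\<mu> ^ n * (E0 (y / 2 ^ n) - \<rho>)\<close> bounded. Solving for
  \<open>q\<close> instead of \<open>E\<close> splits off the pole at 0 and avoids choosing a square
  root of \<open>E (z\<^sup>2) - \<kappa>\<close>: the only logarithm taken is that of a number
  within \<open>1 - \<rho>\<close> of 1. The three limits \<open>q\<close>, \<open>poincare\<close>
  and \<open>S\<close> all converge geometrically, hence uniformly, and inherit continuity and
  holomorphy from their approximants.\<close>

lemma summable_geometric_uniform_limit:
  fixes f :: "nat \<Rightarrow> 'a \<Rightarrow> 'b :: banach"
  assumes "\<And>n x. x \<in> S \<Longrightarrow> norm (f (Suc n) x - f n x) \<le> C * r ^ n" "0 \<le> r" "r < 1"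
  shows "uniform_limit S f (\<lambda>x. lim (\<lambda>n. f n x)) sequentially"
proof -
  have "summable (\<lambda>n. C * r ^ n)"
    using assms by (intro summable_mult summable_geometric) auto
  then have "uniformly_convergent_on S (\<lambda>n x. \<Sum>i<n. f (Suc i) x - f i x)"
    by (intro Weierstrass_m_test'[of _ _ "\<lambda>n. C * r ^ n"] assms)
  moreover have "(\<Sum>i<n. f (Suc i) x - f i x) = f n x - f 0 x" for n x
    by (rule sum_lessThan_telescope)
  ultimately have "uniformly_convergent_on S (\<lambda>n x. f n x - f 0 x)"
    by (simp only:)
  then obtain l where "uniform_limit S (\<lambda>n x. f n x - f 0 x) l sequentially"
    by (auto simp: uniformly_convergent_on_def)
  then have "uniform_limit S (\<lambda>n x. (f n x - f 0 x) + f 0 x) (\<lambda>x. l x + f 0 x) sequentially"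
    by (intro uniform_limit_add uniform_limit_const)
  then have "uniformly_convergent_on S f"
    by (auto simp: uniformly_convergent_on_def)
  then show ?thesis
    by (simp add: uniformly_convergent_uniform_limit_iff)
qed

lemma Re_divide_power2: "Re (y / 2 ^ n) = Re y / 2 ^ n"
proof -
  have "y / 2 ^ n = y / of_real (2 ^ n)" by simp
  then show ?thesis by (simp only: Re_divide_of_real)
qed

section \<open>Laurent series on an annulus, with bounds on the coefficients\<close>

lemma contour_integral_annulus_eq:
  assumes hol: "f holomorphic_on {z. r < norm z \<and> norm z < R}" and ab: "0 \<le> r" "r < a" "a < R" "r < b" "b < R"
  shows "contour_integral (circlepath 0 a) f = contour_integral (circlepath 0 b) f"
proof (rule Cauchy_theorem_homotopic_loops[OF _ _ hol])
  show "open {z :: complex. r < norm z \<and> norm z < R}"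
    by (intro open_Collect_conj open_Collect_less continuous_intros)
  show "homotopic_loops {z. r < norm z \<and> norm z < R} (circlepath 0 a) (circlepath 0 b)"
  \<comment> \<open>Points of the two circles with the same parameter lie on one ray, so the segment
    between them keeps its modulus between \<open>a\<close> and \<open>b\<close>.\<close>
  proof (rule homotopic_loops_linear)
    fix t :: real assume "t \<in> {0..1}"
    have eq: "circlepath 0 s t = of_real s * exp (2 * of_real pi * \<i> * of_real t)" for s
      by (simp add: circlepath)
    have n: "norm (exp (2 * of_real pi * \<i> * of_real t)) = 1"
      by (simp add: norm_exp_eq_Re)
    show "closed_segment (circlepath 0 a t) (circlepath 0 b t) \<subseteq> {z. r < norm z \<and> norm z < R}"
    proof
      fix z assume "z \<in> closed_segment (circlepath 0 a t) (circlepath 0 b t)"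
      then obtain u where u: "0 \<le> u" "u \<le> 1" "z = (1 - u) *\<^sub>R circlepath 0 a t + u *\<^sub>R circlepath 0 b t"
        by (auto simp: in_segment)
      then have "z = of_real ((1 - u) * a + u * b) * exp (2 * of_real pi * \<i> * of_real t)"
        unfolding eq by (simp add: scaleR_conv_of_real algebra_simps)
      then have "norm z = \<bar>(1 - u) * a + u * b\<bar>" by (simp only: norm_mult n norm_of_real mult_1_right)
      moreover have "(1 - u) * a + u * b \<in> {r<..<R}"
        using u ab convexD_alt[of "{r<..<R}" a b u] by (auto simp: algebra_simps)
      ultimately show "z \<in> {z. r < norm z \<and> norm z < R}" using ab by auto
    qed
  qed (simp_all add: valid_path_imp_path)
qed auto

text \<open>The difference quotient of \<open>f\<close> at \<open>w\<close> has a removable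
  singularity, so its integrals over both circles agree. The part with \<open>f w / (u - w)\<close>
  contributes \<open>2 * pi * \<i> * f w\<close> on the outer circle and 0 on the inner one.\<close>

lemma annulus_Cauchy_formula:
  assumes hol: "f holomorphic_on {z. r < norm z \<and> norm z < R}"
    and ab: "0 \<le> r" "r < a" "b < R" "a < norm w" "norm w < b"
  shows "2 * of_real pi * \<i> * f w =
    contour_integral (circlepath 0 b) (\<lambda>u. f u / (u - w)) - contour_integral (circlepath 0 a) (\<lambda>u. f u / (u - w))"
proof -
  define A where "A = {z :: complex. r < norm z \<and> norm z < R}"
  define g where "g u = (if u = w then deriv f w else (f u - f w) / (u - w))" for u
  have "open A" unfolding A_def by (intro open_Collect_conj open_Collect_less continuous_intros)
  then have "g holomorphic_on A"
    unfolding g_def using hol by (intro pole_lemma_open) (simp_all add: A_def)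
  then have eq: "contour_integral (circlepath 0 a) g = contour_integral (circlepath 0 b) g"
    unfolding A_def by (rule contour_integral_annulus_eq) (use ab in auto)
  have *: "contour_integral (circlepath 0 s) g =
      contour_integral (circlepath 0 s) (\<lambda>u. f u / (u - w)) - contour_integral (circlepath 0 s) (\<lambda>u. f w / (u - w))"
    if s: "r < s" "s < R" "s \<noteq> norm w" for s
  proof -
    have im: "path_image (circlepath 0 s) = sphere 0 s" using s ab by simp
    have cf: "continuous_on (sphere 0 s) f"
      using holomorphic_on_imp_continuous_on[OF hol] by (rule continuous_on_subset) (use s in auto)
    have "contour_integral (circlepath 0 s) g = contour_integral (circlepath 0 s) (\<lambda>u. f u / (u - w) - f w / (u - w))"
      by (rule contour_integral_eq) (use s im in \<open>auto simp: g_def diff_divide_distrib\<close>)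
    also have "\<dots> = contour_integral (circlepath 0 s) (\<lambda>u. f u / (u - w)) - contour_integral (circlepath 0 s) (\<lambda>u. f w / (u - w))"
      by (intro contour_integral_diff contour_integrable_continuous_circlepath continuous_intros)
         (use s im cf in auto)
    finally show ?thesis .
  qed
  have "contour_integral (circlepath 0 b) (\<lambda>u. f w / (u - w)) = 2 * of_real pi * \<i> * f w"
    by (rule contour_integral_unique, rule Cauchy_integral_circlepath_simple) (use ab in auto)
  moreover have "contour_integral (circlepath 0 a) (\<lambda>u. f w / (u - w)) = 0"
    by (rule contour_integral_unique, rule Cauchy_theorem_disc_simple[of _ 0 "norm w"])
       (use ab in \<open>auto intro!: holomorphic_intros\<close>)
  ultimately show ?thesis using eq *[of a] *[of b] ab by (simp add: algebra_simps)
qed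

text \<open>Expands a Cauchy kernel under the integral. It is applied with
  \<open>v u = w / u\<close> on the outer circle and \<open>v u = u / w\<close> on the inner one,
  which give the nonnegative and the negative powers of \<open>w\<close>.\<close>

lemma contour_integral_circlepath_geometric_sums:
  assumes cont: "continuous_on (sphere 0 s) f" and s: "0 < s"
    and v: "continuous_on (sphere 0 s) v" "\<And>u. norm u = s \<Longrightarrow> norm (v u) \<le> \<theta>" "\<theta> < 1"
  shows "(\<lambda>n. contour_integral (circlepath 0 s) (\<lambda>u. f u * v u ^ n)) sums
      contour_integral (circlepath 0 s) (\<lambda>u. f u / (1 - v u))"
proof -
  have im: "path_image (circlepath 0 s) = sphere 0 s" using s by simp
  have "compact (f ` sphere 0 s)" using cont by (intro compact_continuous_image) auto
  then obtain B where B: "\<And>u. norm u = s \<Longrightarrow> norm (f u) \<le> B"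
    using compact_imp_bounded by (fastforce simp: bounded_iff)
  have "norm (of_real s :: complex) = s" using s by simp
  then have B0: "0 \<le> B" and \<theta>0: "0 \<le> \<theta>" using B v(2) norm_ge_zero order_trans by blast+
  have ci: "(\<lambda>u. f u * v u ^ n) contour_integrable_on circlepath 0 s" for n
    by (intro contour_integrable_continuous_circlepath continuous_intros) (use cont v im in auto)
  have "uniform_limit (sphere 0 s) (\<lambda>N u. \<Sum>n<N. f u * v u ^ n) (\<lambda>u. suminf (\<lambda>n. f u * v u ^ n)) sequentially"
  proof (rule Weierstrass_m_test)
    show "norm (f u * v u ^ n) \<le> B * \<theta> ^ n" if "u \<in> sphere 0 s" for n u
      using that B v(2) B0 by (auto simp: norm_mult norm_power intro!: mult_mono power_mono)
    show "summable (\<lambda>n. B * \<theta> ^ n)" using \<theta>0 v(3) by (intro summable_mult summable_geometric) auto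
  qed
  moreover have "suminf (\<lambda>n. f u * v u ^ n) = f u / (1 - v u)" if "u \<in> sphere 0 s" for u
  proof -
    have "norm (v u) < 1" using that v(2)[of u] v(3) by simp
    then have "(\<lambda>n. f u * v u ^ n) sums (f u * (1 / (1 - v u)))"
      by (intro sums_mult geometric_sums)
    then show ?thesis by (simp add: sums_iff)
  qed
  ultimately have "uniform_limit (sphere 0 s) (\<lambda>N u. \<Sum>n<N. f u * v u ^ n) (\<lambda>u. f u / (1 - v u)) sequentially"
    using uniform_limit_cong'[of "sphere 0 s" "\<lambda>N u. \<Sum>n<N. f u * v u ^ n" "\<lambda>N u. \<Sum>n<N. f u * v u ^ n"
        "\<lambda>u. suminf (\<lambda>n. f u * v u ^ n)" "\<lambda>u. f u / (1 - v u)" sequentially] by blast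
  then have "(\<lambda>N. contour_integral (circlepath 0 s) (\<lambda>u. \<Sum>n<N. f u * v u ^ n))
      \<longlonglongrightarrow> contour_integral (circlepath 0 s) (\<lambda>u. f u / (1 - v u))"
    using s by (intro contour_integral_uniform_limit_circlepath) (auto intro!: always_eventually contour_integrable_sum ci)
  then show ?thesis
    unfolding sums_def by (simp add: contour_integral_sum ci)
qed

text \<open>The integers are split into the ranges of \<open>n\<close> and \<open>- n - 1\<close>
  for natural \<open>n\<close>, so that 0 is counted once.\<close>

lemma has_sum_int_halves:
  fixes c :: "int \<Rightarrow> 'a :: banach"
  assumes "summable (\<lambda>n. norm (c (int n)))" "(\<lambda>n. c (int n)) sums s"
    and "summable (\<lambda>n. norm (c (- int n - 1)))" "(\<lambda>n. c (- int n - 1)) sums t"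
  shows "(c has_sum (s + t)) UNIV"
proof -
  have "((\<lambda>n. c (int n)) has_sum s) UNIV" by (rule norm_summable_imp_has_sum[OF assms(1,2)])
  then have s: "(c has_sum s) {0..}"
    by (subst has_sum_reindex_bij_betw[of int UNIV "{0..}" c s, symmetric])
       (rule bij_betwI[of _ _ _ nat], auto)
  have "((\<lambda>n. c (- int n - 1)) has_sum t) UNIV" by (rule norm_summable_imp_has_sum[OF assms(3,4)])
  moreover have "bij_betw (\<lambda>n. - int n - 1) UNIV {..<0}"
    by (rule bij_betwI[of _ _ _ "\<lambda>l. nat (- l - 1)"]) auto
  ultimately have t: "(c has_sum t) {..<0}"
    by (subst has_sum_reindex_bij_betw[of "\<lambda>n. - int n - 1" UNIV "{..<0}" c t, symmetric]) auto
  have "{0..} \<union> {..<0} = (UNIV :: int set)" "{0..} \<inter> {..<0} = ({} :: int set)" by auto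
  then show ?thesis using has_sum_Un_disjoint[OF s t] by metis
qed

text \<open>Integrating over the two extreme circles \<open>R\<close> and \<open>inverse R\<close>
  gives coefficients that decay like \<open>inverse R ^ \<bar>l\<bar>\<close> in both directions.
  The annulus is symmetric because it will be the image of a horizontal strip around the real axis
  under an exponential.\<close>

lemma laurent_annulus:
  assumes hol: "f holomorphic_on {z. inverse R' < norm z \<and> norm z < R'}" and R: "1 < R" "R < R'"
    and B: "\<And>z. norm z = R \<or> norm z = inverse R \<Longrightarrow> norm (f z) \<le> B"
  obtains c :: "int \<Rightarrow> complex" where "\<And>l. norm (c l) \<le> B * inverse R ^ nat \<bar>l\<bar>"
    "\<And>w. inverse R < norm w \<Longrightarrow> norm w < R \<Longrightarrow> ((\<lambda>l. c l * w powi l) has_sum f w) UNIV"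
proof -
  define a where "a = inverse R"
  have a: "0 < a" "a < 1" "inverse R' < a" using R by (auto simp: a_def inverse_less_1_iff)
  have cont: "continuous_on (sphere 0 s) f" if "inverse R' < s" "s < R'" for s
    using holomorphic_on_imp_continuous_on[OF hol] by (rule continuous_on_subset) (use that in auto)
  have cb: "continuous_on (sphere 0 R) f" and ca: "continuous_on (sphere 0 a) f"
    using cont[of R] cont[of a] a R by auto
  have B0: "0 \<le> B" using B[of "of_real R"] R norm_ge_zero order_trans by (metis abs_of_pos norm_of_real less_trans zero_less_one)
  define p n where "p l = contour_integral (circlepath 0 R) (\<lambda>u. f u * inverse u ^ Suc l)"
    and "n l = contour_integral (circlepath 0 a) (\<lambda>u. f u * u ^ l)" for l
  define c where "c l = (if 0 \<le> l then p (nat l) else n (nat (- l - 1))) / (2 * of_real pi * \<i>)" for l :: int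
  have norm_p: "norm (p l) \<le> B * inverse R ^ l * (2 * pi)" for l
  proof -
    have "(\<lambda>u. f u * inverse u ^ Suc l) contour_integrable_on circlepath 0 R"
      by (intro contour_integrable_continuous_circlepath continuous_intros) (use cb R in auto)
    then have "norm (p l) \<le> (B * inverse R ^ Suc l) * (2 * pi * R)"
      unfolding p_def
      by (intro has_contour_integral_bound_circlepath[OF has_contour_integral_integral])
         (use R B B0 in \<open>auto simp: norm_mult norm_power norm_inverse intro!: mult_right_mono\<close>)
    then show ?thesis using R by (simp add: field_simps)
  qed
  \<comment> \<open>The length of the inner circle supplies an extra factor \<open>a\<close>. Since
    \<open>n l\<close> belongs to the index \<open>- l - 1\<close>, of absolute value
    \<open>Suc l\<close>, the exponent is exactly the one required.\<close>
  have norm_n: "norm (n l) \<le> B * a ^ Suc l * (2 * pi)" for l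
  proof -
    have "(\<lambda>u. f u * u ^ l) contour_integrable_on circlepath 0 a"
      by (intro contour_integrable_continuous_circlepath continuous_intros) (use ca a in auto)
    then have "norm (n l) \<le> (B * a ^ l) * (2 * pi * a)"
      unfolding n_def
      by (intro has_contour_integral_bound_circlepath[OF has_contour_integral_integral])
         (use a B B0 in \<open>auto simp: norm_mult norm_power a_def intro!: mult_right_mono\<close>)
    then show ?thesis by (simp add: mult_ac)
  qed
  have norm_c: "norm (c l) \<le> B * inverse R ^ nat \<bar>l\<bar>" for l
  proof (cases "0 \<le> l")
    case True
    then show ?thesis using norm_p[of "nat l"] by (simp add: c_def norm_divide norm_mult field_simps)
  next
    case False
    then have "Suc (nat (- l - 1)) = nat \<bar>l\<bar>" by simp
    then show ?thesis using norm_n[of "nat (- l - 1)"] False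
      by (simp add: c_def norm_divide norm_mult a_def field_simps del: power_Suc)
  qed
  have "((\<lambda>l. c l * w powi l) has_sum f w) UNIV" if w: "inverse R < norm w" "norm w < R" for w
  proof -
    have w0: "w \<noteq> 0" and aw: "a < norm w" using w a by (auto simp: a_def)
    have S1: "(\<lambda>l. p l * w ^ l) sums contour_integral (circlepath 0 R) (\<lambda>u. f u / (u - w))"
    proof -
      have "(\<lambda>l. contour_integral (circlepath 0 R) (\<lambda>u. (f u * inverse u) * (w * inverse u) ^ l)) sums
          contour_integral (circlepath 0 R) (\<lambda>u. (f u * inverse u) / (1 - w * inverse u))"
        by (rule contour_integral_circlepath_geometric_sums[where \<theta> = "norm w / R"])
           (use cb R w in \<open>auto intro!: continuous_intros simp: norm_mult norm_inverse norm_divide divide_simps\<close>)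
      moreover have "contour_integral (circlepath 0 R) (\<lambda>u. (f u * inverse u) / (1 - w * inverse u)) =
          contour_integral (circlepath 0 R) (\<lambda>u. f u / (u - w))"
        by (rule contour_integral_eq) (use R w in \<open>auto simp: field_simps\<close>)
      moreover have "contour_integral (circlepath 0 R) (\<lambda>u. (f u * inverse u) * (w * inverse u) ^ l) = p l * w ^ l" for l
      proof -
        have "(\<lambda>u. f u * inverse u ^ Suc l) contour_integrable_on circlepath 0 R"
          by (intro contour_integrable_continuous_circlepath continuous_intros) (use cb R in auto)
        then have "contour_integral (circlepath 0 R) (\<lambda>u. f u * inverse u ^ Suc l * w ^ l) = p l * w ^ l"
          unfolding p_def by (rule contour_integral_rmul)
        then show ?thesis by (simp add: power_mult_distrib mult_ac)
      qed
      ultimately show ?thesis by simp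
    qed
    have S2: "(\<lambda>l. n l / w ^ Suc l) sums (- contour_integral (circlepath 0 a) (\<lambda>u. f u / (u - w)))"
    proof -
      have "(\<lambda>l. contour_integral (circlepath 0 a) (\<lambda>u. (f u * inverse w) * (u * inverse w) ^ l)) sums
          contour_integral (circlepath 0 a) (\<lambda>u. (f u * inverse w) / (1 - u * inverse w))"
        by (rule contour_integral_circlepath_geometric_sums[where \<theta> = "a / norm w"])
           (use ca a(1) aw w0 in \<open>auto intro!: continuous_intros simp: norm_divide divide_simps\<close>)
      moreover have "contour_integral (circlepath 0 a) (\<lambda>u. (f u * inverse w) / (1 - u * inverse w)) =
          contour_integral (circlepath 0 a) (\<lambda>u. - (f u / (u - w)))"
        by (rule contour_integral_eq) (use a(1) aw w0 in \<open>auto simp: divide_simps algebra_simps\<close>)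
      moreover have "contour_integral (circlepath 0 a) (\<lambda>u. - (f u / (u - w))) = - contour_integral (circlepath 0 a) (\<lambda>u. f u / (u - w))"
        by (intro contour_integral_neg)
      moreover have "contour_integral (circlepath 0 a) (\<lambda>u. (f u * inverse w) * (u * inverse w) ^ l) = n l / w ^ Suc l" for l
      proof -
        have "(\<lambda>u. f u * u ^ l) contour_integrable_on circlepath 0 a"
          by (intro contour_integrable_continuous_circlepath continuous_intros) (use ca a in auto)
        then have "contour_integral (circlepath 0 a) (\<lambda>u. f u * u ^ l * inverse w ^ Suc l) = n l * inverse w ^ Suc l"
          unfolding n_def by (rule contour_integral_rmul)
        then show ?thesis by (simp add: power_mult_distrib mult_ac divide_inverse power_inverse)
      qed
      ultimately show ?thesis by simp
    qed
    let ?K = "2 * of_real pi * \<i> :: complex"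
    have "((\<lambda>l. c l * w powi l) has_sum
        (contour_integral (circlepath 0 R) (\<lambda>u. f u / (u - w)) / ?K +
         (- contour_integral (circlepath 0 a) (\<lambda>u. f u / (u - w))) / ?K)) UNIV"
    proof (rule has_sum_int_halves)
      have c1: "c (int l) * w powi int l = p l * w ^ l / ?K" for l by (simp add: c_def)
      show "(\<lambda>l. c (int l) * w powi int l) sums (contour_integral (circlepath 0 R) (\<lambda>u. f u / (u - w)) / ?K)"
        unfolding c1 by (rule sums_divide[OF S1])
      have pw: "w powi (- int l - 1) = inverse (w ^ Suc l)" for l
      proof -
        have "- int l - 1 = - int (Suc l)" by simp
        then show ?thesis by (simp only: power_int_minus power_int_of_nat)
      qed
      have c2: "c (- int l - 1) * w powi (- int l - 1) = n l / w ^ Suc l / ?K" for l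
      proof -
        have "c (- int l - 1) = n l / ?K" by (simp add: c_def)
        then show ?thesis unfolding pw by (simp only: divide_inverse mult_ac)
      qed
      show "(\<lambda>l. c (- int l - 1) * w powi (- int l - 1)) sums (- contour_integral (circlepath 0 a) (\<lambda>u. f u / (u - w)) / ?K)"
        unfolding c2 by (rule sums_divide[OF S2])
      show "summable (\<lambda>l. norm (c (int l) * w powi int l))"
      proof (rule summable_comparison_test')
        show "summable (\<lambda>l. B * (norm w * inverse R) ^ l)"
          using w R by (intro summable_mult summable_geometric) (auto simp: field_simps)
        fix l show "norm (norm (c (int l) * w powi int l)) \<le> B * (norm w * inverse R) ^ l"
          using mult_right_mono[OF norm_c[of "int l"], of "norm w ^ l"]
          by (simp add: norm_mult norm_power power_mult_distrib mult_ac)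
      qed
      show "summable (\<lambda>l. norm (c (- int l - 1) * w powi (- int l - 1)))"
      proof (rule summable_comparison_test')
        show "summable (\<lambda>l. B * (a / norm w) * (a / norm w) ^ l)"
          using w a w0 by (intro summable_mult summable_geometric) (auto simp: a_def field_simps)
        fix l
        have nl: "nat \<bar>- int l - 1\<bar> = Suc l" by auto
        have "norm (w powi (- int l - 1)) = inverse (norm w) ^ Suc l"
          unfolding pw norm_inverse norm_power by (rule power_inverse[symmetric])
        then have "norm (c (- int l - 1) * w powi (- int l - 1)) \<le> B * a ^ Suc l * inverse (norm w) ^ Suc l"
          using norm_c[of "- int l - 1"] unfolding norm_mult nl a_def by (simp add: mult_right_mono)
        then show "norm (norm (c (- int l - 1) * w powi (- int l - 1))) \<le> B * (a / norm w) * (a / norm w) ^ l"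
          by (simp add: divide_inverse power_mult_distrib mult_ac)
      qed
    qed
    moreover have "?K * f w = contour_integral (circlepath 0 R) (\<lambda>u. f u / (u - w)) - contour_integral (circlepath 0 a) (\<lambda>u. f u / (u - w))"
      by (rule annulus_Cauchy_formula[OF hol]) (use R a w in \<open>auto simp: a_def\<close>)
    then have "f w = contour_integral (circlepath 0 R) (\<lambda>u. f u / (u - w)) / ?K +
         (- contour_integral (circlepath 0 a) (\<lambda>u. f u / (u - w))) / ?K"
      by (simp add: field_simps)
    ultimately show ?thesis by simp
  qed
  with norm_c show ?thesis by (rule that)
qed

text \<open>Iterated sums alone do not determine an unconditional sum over triples. Joint
  summability is assumed separately, and the iterated sums then only identify the value.\<close>

lemma has_sum_triple:
  fixes F :: "'a \<times> 'b \<times> 'c \<Rightarrow> complex"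
  assumes "F summable_on UNIV"
    and "\<And>x y. ((\<lambda>z. F (x, y, z)) has_sum f x y) UNIV" "\<And>x. (f x has_sum g x) UNIV" "(g has_sum s) UNIV"
  shows "(F has_sum s) UNIV"
proof -
  have sm: "(\<lambda>(x, p). F (x, p)) summable_on (UNIV \<times> UNIV)"
    using assms(1) by (simp add: case_prod_unfold)
  have "((\<lambda>p. F (x, p)) has_sum g x) UNIV" for x
  proof -
    have "(\<lambda>p. F (x, p)) summable_on UNIV"
      using summable_on_SigmaD1[OF sm, of x] by simp
    then have "((\<lambda>p. F (x, p)) has_sum g x) (UNIV \<times> UNIV)"
      by (intro has_sum_SigmaI[OF _ assms(3)]) (auto simp: assms(2))
    then show ?thesis by simp
  qed
  then have "(F has_sum s) (UNIV \<times> UNIV)"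
    using assms(1) by (intro has_sum_SigmaI[OF _ assms(4)]) auto
  then show ?thesis by simp
qed

lemma summable_on_geometric_triple:
  "(\<lambda>(k :: nat, l :: int, m :: nat). M * (1 / 2) ^ (nat \<bar>l\<bar> + k + m)) summable_on (UNIV :: _ set)"
  for M :: real
proof -
  have "summable (\<lambda>n. (1/2 :: real) ^ n)" by (rule summable_geometric) auto
  then have n: "((\<lambda>n. (1/2 :: real) ^ n) has_sum suminf (\<lambda>n. (1/2) ^ n)) UNIV"
    by (intro norm_summable_imp_has_sum) (auto simp: norm_power summable_sums)
  have "((\<lambda>l. (1/2 :: real) ^ nat \<bar>l\<bar>) has_sum (2 + 1)) UNIV"
  proof (rule has_sum_int_halves)
    have e: "nat \<bar>- int n - 1\<bar> = Suc n" for n by auto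
    have g: "(\<lambda>n. (1/2 :: real) ^ n) sums 2" using geometric_sums[of "1/2 :: real"] by simp
    show "(\<lambda>n. (1/2 :: real) ^ nat \<bar>int n\<bar>) sums 2" using g by simp
    show "(\<lambda>n. (1/2 :: real) ^ nat \<bar>- int n - 1\<bar>) sums 1"
      unfolding e using sums_mult[OF g, of "1/2"] by simp
    show "summable (\<lambda>n. norm ((1/2 :: real) ^ nat \<bar>int n\<bar>))" using g by (simp add: norm_power sums_iff)
    show "summable (\<lambda>n. norm ((1/2 :: real) ^ nat \<bar>- int n - 1\<bar>))"
      unfolding e using sums_mult[OF g, of "1/2"] by (simp add: norm_power sums_iff)
  qed
  then have l: "(\<lambda>l. (1/2 :: real) ^ nat \<bar>l\<bar>) summable_on UNIV" by (rule has_sum_imp_summable)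
  have "(\<lambda>(l :: int, m :: nat). (1/2 :: real) ^ nat \<bar>l\<bar> * (1/2) ^ m) summable_on (UNIV \<times> UNIV)"
  proof (rule summable_on_SigmaI)
    show "((\<lambda>m. case (x, m) of (l :: int, m) \<Rightarrow> (1/2 :: real) ^ nat \<bar>l\<bar> * (1/2) ^ m) has_sum
        (1/2) ^ nat \<bar>x\<bar> * suminf (\<lambda>n. (1/2) ^ n)) UNIV" for x
      using has_sum_cmult_right[OF n] by simp
  qed (auto intro!: summable_on_cmult_left l)
  then obtain s where s: "((\<lambda>(l :: int, m :: nat). (1/2 :: real) ^ nat \<bar>l\<bar> * (1/2) ^ m) has_sum s) UNIV"
    by (auto simp: summable_on_def)
  have "(\<lambda>(k :: nat, p). (1/2 :: real) ^ k * (case p of (l :: int, m :: nat) \<Rightarrow> (1/2) ^ nat \<bar>l\<bar> * (1/2) ^ m)) summable_on (UNIV \<times> UNIV)"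
  proof (rule summable_on_SigmaI)
    show "((\<lambda>p. case (x, p) of (k :: nat, p) \<Rightarrow> (1/2 :: real) ^ k * (case p of (l :: int, m :: nat) \<Rightarrow> (1/2) ^ nat \<bar>l\<bar> * (1/2) ^ m))
        has_sum (1/2) ^ x * s) UNIV" for x
      using has_sum_cmult_right[OF s] by simp
  qed (auto intro!: summable_on_cmult_left has_sum_imp_summable[OF n])
  then have "(\<lambda>x. M * (case x of (k :: nat, p) \<Rightarrow> (1/2 :: real) ^ k * (case p of (l :: int, m :: nat) \<Rightarrow> (1/2) ^ nat \<bar>l\<bar> * (1/2) ^ m))) summable_on UNIV"
    by (intro summable_on_cmult_right) simp
  then show ?thesis by (simp add: case_prod_unfold power_add mult_ac)
qed

lemma holomorphic_power_series_has_sum: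
  assumes "f holomorphic_on ball 0 r" "norm w < r"
  shows "((\<lambda>n. (deriv ^^ n) f 0 / fact n * w ^ n) has_sum f w) UNIV"
proof (rule norm_summable_imp_has_sum)
  show "(\<lambda>n. (deriv ^^ n) f 0 / fact n * w ^ n) sums f w"
    using holomorphic_power_series[OF assms(1), of w] assms(2) by simp
  have r0: "0 < r" using norm_ge_zero assms(2) by (rule le_less_trans)
  \<comment> \<open>A point of larger modulus still inside the disc: convergence there forces the
    absolute convergence at \<open>w\<close> that \<open>has_sum\<close> demands.\<close>
  define x where "x = complex_of_real ((norm w + r) / 2)"
  have "norm x = (norm w + r) / 2" unfolding x_def norm_of_real
    by (intro abs_of_nonneg divide_nonneg_nonneg add_nonneg_nonneg norm_ge_zero less_imp_le[OF r0]) simp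
  then have x: "norm w < norm x" "norm x < r" using assms(2) by auto
  have "summable (\<lambda>n. (deriv ^^ n) f 0 / fact n * x ^ n)"
    using holomorphic_power_series[OF assms(1), of x] x by (auto simp: sums_iff)
  then show "summable (\<lambda>n. norm ((deriv ^^ n) f 0 / fact n * w ^ n))"
    by (rule powser_insidea) (rule x)
qed

lemma power_series_coeff_bound:
  assumes "f holomorphic_on ball 0 r" "0 < s" "s < r" "\<And>x. norm x = s \<Longrightarrow> norm (f x) \<le> B"
  shows "norm ((deriv ^^ n) f 0 / fact n) \<le> B / s ^ n"
proof -
  have "norm ((deriv ^^ n) f 0) \<le> fact n * B / s ^ n"
  proof (rule Cauchy_inequality)
    show "f holomorphic_on ball 0 s" by (rule holomorphic_on_subset[OF assms(1)]) (use assms(3) in auto)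
    show "continuous_on (cball 0 s) f"
      using holomorphic_on_imp_continuous_on[OF assms(1)] by (rule continuous_on_subset) (use assms(3) in auto)
  qed (use assms in auto)
  then show ?thesis by (simp add: norm_divide field_simps)
qed

section \<open>Logarithmic coordinates at 1\<close>

lemma Ln_inverse_near_1:
  assumes "0 < (\<eta> :: real)"
  obtains \<epsilon> where "0 < \<epsilon>" "\<epsilon> \<le> 1 / 2"
    "\<And>z :: complex. norm z < 1 \<Longrightarrow> norm (1 - z) < \<epsilon> \<Longrightarrow>
      z \<noteq> 0 \<and> 0 < Re (Ln (inverse z)) \<and> norm (Ln (inverse z)) < \<eta> \<and> exp (- Ln (inverse z)) = z"
proof -
  have "isCont (\<lambda>z :: complex. Ln (inverse z)) 1" by (intro continuous_intros) auto
  then obtain d where d: "d > 0" "\<And>z :: complex. dist z 1 < d \<Longrightarrow> dist (Ln (inverse z)) (Ln (inverse 1)) < \<eta>"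
    using assms unfolding continuous_at_eps_delta by (auto simp: dist_norm)
  show ?thesis
  proof (rule that[of "min d (1 / 2)"])
    fix z :: complex assume z: "norm z < 1" "norm (1 - z) < min d (1 / 2)"
    then have z0: "z \<noteq> 0" by auto
    moreover have "exp (- Ln (inverse z)) = z" using z0 by (simp add: exp_minus)
    moreover have "norm (Ln (inverse z)) < \<eta>"
      using d(2)[of z] z by (simp add: dist_norm norm_minus_commute)
    moreover have "0 < Re (Ln (inverse z))" using z z0 by (simp add: norm_inverse one_less_inverse)
    ultimately show "z \<noteq> 0 \<and> 0 < Re (Ln (inverse z)) \<and> norm (Ln (inverse z)) < \<eta> \<and> exp (- Ln (inverse z)) = z"
      by blast
  qed (use d in auto)
qed

text \<open>\<open>Ln (inverse (1 - t))\<close> equals \<open>t * K t\<close> with \<open>K\<close>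
  holomorphic and \<open>K 0 = 1\<close>, so \<open>\<theta> = Ln \<circ> K\<close> is the
  correction to \<open>Ln t\<close>. The imaginary parts of \<open>Ln t\<close> and
  \<open>\<theta> t\<close> are below 1 in absolute value, which keeps their sum on the principal
  branch. The power series in \<open>\<theta>\<close> is the source of the integer powers of
  \<open>t\<close> in the expansion of \<open>G\<close>.\<close>

lemma Ln_Ln_inverse_expansion:
  assumes "0 < (\<eta> :: real)" "\<eta> \<le> 1"
  obtains r \<theta> where "0 < r" "\<theta> holomorphic_on ball 0 r" "\<And>t. norm t < r \<Longrightarrow> norm (\<theta> t) < \<eta>"
    "\<And>t. norm t < r \<Longrightarrow> t \<noteq> 0 \<Longrightarrow> \<bar>Arg t\<bar> < 1 \<Longrightarrow> Ln (Ln (inverse (1 - t))) = Ln t + \<theta> t"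
proof -
  define K where "K t = (if t = 0 then 1 else - Ln (1 - t) / t)" for t :: complex
  have npos: "1 - t \<notin> \<real>\<^sub>\<le>\<^sub>0" if "norm t < 1" for t :: complex
    using that complex_Re_le_cmod[of t] by (auto simp: complex_nonpos_Reals_iff)
  have hol: "(\<lambda>t. - Ln (1 - t)) holomorphic_on ball 0 1"
    using npos by (intro holomorphic_intros) auto
  have "((\<lambda>t. - Ln (1 - t)) has_field_derivative 1) (at (0 :: complex))"
    by (auto intro!: derivative_eq_intros)
  then have "deriv (\<lambda>t. - Ln (1 - t)) 0 = (1 :: complex)" by (rule DERIV_imp_deriv)
  then have K: "K holomorphic_on ball 0 1"
    by (intro pole_theorem_open_0[OF hol, where a = 0 and f = K]) (simp_all add: K_def)
  have "K 0 = 1" by (simp add: K_def)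
  have "isCont K 0"
    using holomorphic_on_imp_continuous_on[OF K] by (simp add: continuous_on_eq_continuous_at)
  then have "isCont (\<lambda>t. Ln (K t)) 0"
    by (intro continuous_intros) (simp_all add: \<open>K 0 = 1\<close>)
  then obtain d where d: "d > 0" "\<And>t. dist t 0 < d \<Longrightarrow> dist (Ln (K t)) (Ln (K 0)) < \<eta>"
    using assms unfolding continuous_at_eps_delta by (auto simp: dist_norm)
  obtain d' where d': "d' > 0" "\<And>t. dist t 0 < d' \<Longrightarrow> dist (K t) (K 0) < 1"
    using \<open>isCont K 0\<close> zero_less_one unfolding continuous_at_eps_delta by (metis dist_norm)
  define r where "r = min (min d d') 1"
  have r: "0 < r" "r \<le> 1" using d d' by (auto simp: r_def)
  have Kn: "K t \<notin> \<real>\<^sub>\<le>\<^sub>0" if "norm t < r" for t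
  proof -
    have "norm (1 - K t) < 1" using d'(2)[of t] that by (simp add: r_def K_def dist_norm norm_minus_commute)
    then show ?thesis
      using complex_Re_le_cmod[of "1 - K t"] by (auto simp: complex_nonpos_Reals_iff)
  qed
  show ?thesis
  proof (rule that[OF r(1)])
    show "(\<lambda>t. Ln (K t)) holomorphic_on ball 0 r"
      using Kn r by (intro holomorphic_intros holomorphic_on_subset[OF K]) auto
    show small: "norm (Ln (K t)) < \<eta>" if "norm t < r" for t
      using d(2)[of t] that by (simp add: r_def K_def)
    fix t :: complex assume t: "norm t < r" "t \<noteq> 0" "\<bar>Arg t\<bar> < 1"
    have "Ln (inverse (1 - t)) = - Ln (1 - t)" using npos[of t] t r by (intro Ln_inverse) auto
    also have "\<dots> = exp (Ln t + Ln (K t))"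
    proof -
      have "K t \<noteq> 0" using Kn[OF t(1)] by auto
      then have "exp (Ln t + Ln (K t)) = t * K t" using t by (simp add: exp_add)
      also have "\<dots> = - Ln (1 - t)" using t by (simp add: K_def)
      finally show ?thesis ..
    qed
    finally have "Ln (Ln (inverse (1 - t))) = Ln (exp (Ln t + Ln (K t)))" by simp
    also have "\<dots> = Ln t + Ln (K t)"
    proof (rule Ln_exp)
      have "\<bar>Im (Ln (K t))\<bar> < 1" using small[OF t(1)] abs_Im_le_cmod[of "Ln (K t)"] assms by linarith
      moreover have "Im (Ln t) = Arg t" using t by (simp add: Arg_def)
      ultimately have "\<bar>Im (Ln t + Ln (K t))\<bar> < 2" using t(3) by simp
      then show "- pi < Im (Ln t + Ln (K t))" "Im (Ln t + Ln (K t)) \<le> pi" using pi_gt3 by linarith+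
    qed
    finally show "Ln (Ln (inverse (1 - t))) = Ln t + Ln (K t)" .
  qed
qed

section \<open>The inverse Boettcher map\<close>

locale small_logistic =
  fixes a :: real
  assumes a_pos: "0 < a" and a_less: "a < 1/2"
begin

definition "\<rho> = 1 - a / 2"
text \<open>The value for which \<open>Z\<^sup>2 + \<kappa>\<close> has the fixed points
  \<open>\<rho>\<close> and \<open>1 - \<rho>\<close>. They correspond to the repelling fixed point
  x = 1 - 1/a and the attracting fixed point x = 0 of the logistic map.\<close>

definition "\<kappa> = \<rho> * (1 - \<rho>)"
definition "\<mu> = 2 - a"
definition "\<beta> = log 2 (2 - a)"

lemma \<rho>_bounds: "3/4 < \<rho>" "\<rho> < 1"
  using a_pos a_less by (auto simp: \<rho>_def)

lemma \<mu>_eq: "\<mu> = 2 * \<rho>"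
  by (simp add: \<mu>_def \<rho>_def)

lemma \<mu>_bounds: "3/2 < \<mu>" "\<mu> < 2"
  using \<rho>_bounds by (auto simp: \<mu>_eq)

lemma \<kappa>_pos: "0 < \<kappa>"
  using \<rho>_bounds by (simp add: \<kappa>_def)

lemma \<beta>_bounds: "1/2 < \<beta>" "\<beta> < 1"
proof -
  have "sqrt 2 < 3/2" by (rule real_less_lsqrt) (auto simp: power2_eq_square)
  then have "2 powr (1/2) < \<mu>" using \<mu>_bounds by (simp add: powr_half_sqrt)
  then show "1/2 < \<beta>"
    unfolding \<beta>_def \<mu>_def[symmetric] using \<mu>_bounds by (subst less_log_iff) auto
  show "\<beta> < 1"
    unfolding \<beta>_def \<mu>_def[symmetric] using \<mu>_bounds by (subst log_less_iff) auto
qed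

lemma two_powr_\<beta>: "2 powr \<beta> = \<mu>"
  unfolding \<beta>_def using \<mu>_bounds by (simp add: \<mu>_def)

text \<open>Inserting \<open>E z = exp (- q z) / z\<close> into
  \<open>E (z\<^sup>2) = (E z)\<^sup>2 + \<kappa>\<close> and taking logarithms turns the equation
  into \<open>q z = step (z\<^sup>2) (q (z\<^sup>2))\<close>.\<close>

definition step :: "complex \<Rightarrow> complex \<Rightarrow> complex" where
  "step w s = (s - Ln (1 - of_real \<kappa> * w * exp s)) / 2"

text \<open>On the half-plane \<open>exp (Re s)\<close> is at most \<open>1 / \<rho>\<close>, and
  \<open>\<kappa> / \<rho> = 1 - \<rho>\<close>. Hence the argument of \<open>Ln\<close> in
  \<open>step\<close> stays in a disc around 1 of radius less than 1, away from the branch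
  cut.\<close>

lemma norm_step_arg:
  assumes "norm w \<le> 1" "Re s \<le> - ln \<rho>"
  shows "norm (of_real \<kappa> * w * exp s) \<le> 1 - \<rho>"
proof -
  have "exp (Re s) \<le> exp (- ln \<rho>)" using assms by simp
  then have e: "exp (Re s) \<le> 1 / \<rho>" using \<rho>_bounds by (simp add: exp_minus inverse_eq_divide)
  have "norm (of_real \<kappa> * w * exp s) = \<kappa> * norm w * exp (Re s)"
    using \<kappa>_pos by (simp add: norm_mult)
  also have "\<dots> \<le> \<kappa> * 1 * (1 / \<rho>)"
    using assms e \<kappa>_pos by (intro mult_mono) auto
  also have "\<dots> = 1 - \<rho>" using \<rho>_bounds by (simp add: \<kappa>_def)
  finally show ?thesis .
qed

lemma step_arg_lower:
  assumes "norm w \<le> 1" "Re s \<le> - ln \<rho>"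
  shows "\<rho> \<le> norm (1 - of_real \<kappa> * w * exp s)" "1 - of_real \<kappa> * w * exp s \<notin> \<real>\<^sub>\<le>\<^sub>0"
proof -
  have n: "norm (of_real \<kappa> * w * exp s) \<le> 1 - \<rho>" by (rule norm_step_arg[OF assms])
  then show "\<rho> \<le> norm (1 - of_real \<kappa> * w * exp s)"
    using norm_triangle_ineq2[of 1 "of_real \<kappa> * w * exp s"] by simp
  have "Re (of_real \<kappa> * w * exp s) < 1"
    using n complex_Re_le_cmod[of "of_real \<kappa> * w * exp s"] \<rho>_bounds by linarith
  then show "1 - of_real \<kappa> * w * exp s \<notin> \<real>\<^sub>\<le>\<^sub>0"
    by (auto simp: complex_nonpos_Reals_iff)
qed

text \<open>The real part of the new value is the average of \<open>Re s\<close> and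
  \<open>- ln (norm (1 - \<kappa> * w * exp s))\<close>, both at most \<open>- ln \<rho>\<close>.
  Equality occurs at \<open>w = 1\<close>, \<open>s = - ln \<rho>\<close>, so the half-plane is the
  tight choice.\<close>

lemma Re_step:
  assumes "norm w \<le> 1" "Re s \<le> - ln \<rho>"
  shows "Re (step w s) \<le> - ln \<rho>"
proof -
  have l: "\<rho> \<le> norm (1 - of_real \<kappa> * w * exp s)" "1 - of_real \<kappa> * w * exp s \<noteq> 0"
    using step_arg_lower[OF assms] by auto
  then have "ln \<rho> \<le> ln (norm (1 - of_real \<kappa> * w * exp s))"
    using \<rho>_bounds by simp
  with l(2) assms(2) show ?thesis
    by (simp add: step_def)
qed

text \<open>With \<open>v = 1 - \<kappa> * w * exp s\<close> the derivative in \<open>s\<close>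
  collapses to \<open>1 / (2 * v)\<close>, and \<open>norm v\<close> is at least
  \<open>\<rho>\<close>. Convexity of the half-plane turns the derivative bound into a Lipschitz
  bound with constant \<open>1 / (2 * \<rho>) = 1 / \<mu>\<close>.\<close>

lemma step_lipschitz_right:
  assumes w: "norm w \<le> 1" and s: "Re s \<le> - ln \<rho>" "Re s' \<le> - ln \<rho>"
  shows "norm (step w s - step w s') \<le> 1 / \<mu> * norm (s - s')"
proof (rule field_differentiable_bound)
  let ?S = "{s. Re s \<le> - ln \<rho>}"
  let ?v = "\<lambda>s. 1 - of_real \<kappa> * w * exp s"
  show "convex ?S" by (rule convex_halfspace_Re_le)
  show "s \<in> ?S" "s' \<in> ?S" using s by auto
  fix s assume sS: "s \<in> ?S"
  then have l: "\<rho> \<le> norm (?v s)" "?v s \<notin> \<real>\<^sub>\<le>\<^sub>0" "?v s \<noteq> 0"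
    using step_arg_lower[OF w, of s] by auto
  show "(step w has_field_derivative (1 / (2 * ?v s))) (at s within ?S)"
    unfolding step_def using l
    by (auto intro!: derivative_eq_intros simp: field_simps)
  have "norm (1 / (2 * ?v s)) = 1 / (2 * norm (?v s))"
    by (simp only: norm_divide norm_mult norm_one norm_numeral)
  also have "\<dots> \<le> 1 / \<mu>"
    unfolding \<mu>_eq using l \<rho>_bounds by (intro divide_left_mono) (auto intro!: mult_pos_pos)
  finally show "norm (1 / (2 * ?v s)) \<le> 1 / \<mu>" .
qed

lemma step_lipschitz_left:
  assumes w: "norm w \<le> 1" "norm w' \<le> 1" and s: "Re s \<le> - ln \<rho>"
  shows "norm (step w s - step w' s) \<le> (1 - \<rho>) / \<mu> * norm (w - w')"
proof (rule field_differentiable_bound)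
  let ?v = "\<lambda>w. 1 - of_real \<kappa> * w * exp s"
  show "convex (cball 0 1 :: complex set)" by simp
  show "w \<in> cball 0 1" "w' \<in> cball 0 1" using w by auto
  fix w :: complex assume wS: "w \<in> cball 0 1"
  then have l: "\<rho> \<le> norm (?v w)" "?v w \<notin> \<real>\<^sub>\<le>\<^sub>0" "?v w \<noteq> 0"
    using step_arg_lower[OF _ s, of w] by auto
  show "((\<lambda>w. step w s) has_field_derivative (of_real \<kappa> * 1 * exp s / (2 * ?v w))) (at w within cball 0 1)"
    unfolding step_def using l
    by (auto intro!: derivative_eq_intros simp: field_simps)
  have "norm (of_real \<kappa> * 1 * exp s / (2 * ?v w)) = norm (of_real \<kappa> * 1 * exp s) / (2 * norm (?v w))"
    by (simp only: norm_divide norm_mult norm_one norm_numeral)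
  also have "\<dots> \<le> (1 - \<rho>) / \<mu>"
    unfolding \<mu>_eq using l \<rho>_bounds norm_step_arg[of 1 s] s
    by (intro frac_le) auto
  finally show "norm (of_real \<kappa> * 1 * exp s / (2 * ?v w)) \<le> (1 - \<rho>) / \<mu>" .
qed

section \<open>The fixed point q, by iteration from the zero function\<close>

primrec qs :: "nat \<Rightarrow> complex \<Rightarrow> complex" where
  "qs 0 z = 0"
| "qs (Suc n) z = step (z\<^sup>2) (qs n (z\<^sup>2))"

lemma norm_square_le: "norm z \<le> 1 \<Longrightarrow> norm (z\<^sup>2 :: complex) \<le> 1"
  by (simp add: norm_power power_le_one)

lemma Re_qs: "norm z \<le> 1 \<Longrightarrow> Re (qs n z) \<le> - ln \<rho>"
  using \<rho>_bounds
  by (induction n arbitrary: z) (auto intro!: Re_step norm_square_le)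

lemma step_0_right: "norm w \<le> 1 \<Longrightarrow> norm (step w 0) \<le> 1"
proof -
  assume w: "norm w \<le> 1"
  have "norm (step w 0 - step 0 0) \<le> (1 - \<rho>) / \<mu> * norm (w - 0)"
    using w \<rho>_bounds by (intro step_lipschitz_left) auto
  also have "\<dots> \<le> 1 * 1"
    using w \<rho>_bounds by (intro mult_mono) (auto simp: \<mu>_eq)
  finally show ?thesis by (simp add: step_def)
qed

lemma qs_diff: "norm z \<le> 1 \<Longrightarrow> norm (qs (Suc n) z - qs n z) \<le> 1 * (1 / \<mu>) ^ n"
proof (induction n arbitrary: z)
  case 0
  then show ?case using step_0_right[of "z\<^sup>2"] norm_square_le by simp
next
  case (Suc n)
  have "norm (qs (Suc (Suc n)) z - qs (Suc n) z)
      \<le> 1 / \<mu> * norm (qs (Suc n) (z\<^sup>2) - qs n (z\<^sup>2))"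
    using Suc.prems unfolding qs.simps(2)[of "Suc n"] qs.simps(2)[of n z]
    by (intro step_lipschitz_right Re_qs norm_square_le)
  also have "\<dots> \<le> 1 / \<mu> * (1 * (1 / \<mu>) ^ n)"
    using \<mu>_bounds Suc.prems by (intro mult_left_mono Suc.IH norm_square_le) auto
  finally show ?case by simp
qed

definition "q z = lim (\<lambda>n. qs n z)"

lemma qs_uniform_limit: "uniform_limit (cball 0 1) qs q sequentially"
  unfolding q_def[abs_def]
  by (rule summable_geometric_uniform_limit[where C=1 and r="1/\<mu>"])
     (use qs_diff \<mu>_bounds in auto)

lemma qs_tendsto: "norm z \<le> 1 \<Longrightarrow> (\<lambda>n. qs n z) \<longlonglongrightarrow> q z"
  using tendsto_uniform_limitI[OF qs_uniform_limit, of z] by simp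

lemma Re_q: "norm z \<le> 1 \<Longrightarrow> Re (q z) \<le> - ln \<rho>"
  by (rule tendsto_upperbound[OF tendsto_Re[OF qs_tendsto]]) (auto simp: Re_qs)

lemma q_eq: assumes "norm z \<le> 1" shows "q z = step (z\<^sup>2) (q (z\<^sup>2))"
proof (rule LIMSEQ_unique)
  have z2: "norm (z\<^sup>2) \<le> 1" by (rule norm_square_le[OF assms])
  have "1 - of_real \<kappa> * z\<^sup>2 * exp (q (z\<^sup>2)) \<notin> \<real>\<^sub>\<le>\<^sub>0" by (rule step_arg_lower[OF z2 Re_q[OF z2]])
  then show "(\<lambda>n. qs (Suc n) z) \<longlonglongrightarrow> step (z\<^sup>2) (q (z\<^sup>2))"
    unfolding qs.simps step_def by (intro tendsto_intros qs_tendsto z2) auto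
  show "(\<lambda>n. qs (Suc n) z) \<longlonglongrightarrow> q z"
    using qs_tendsto[OF assms] by (rule LIMSEQ_Suc)
qed

lemma q_minus: "norm z \<le> 1 \<Longrightarrow> q (- z) = q z"
  by (simp add: q_eq[of z] q_eq[of "-z"])

lemma qs_0: "qs n 0 = 0"
  by (induction n) (auto simp: step_def)

lemma q_0: "q 0 = 0"
  using qs_tendsto[of 0] by (simp add: qs_0 LIMSEQ_const_iff)

text \<open>Reality on the diameter passes to \<open>E0\<close>, to \<open>S\<close> and finally to
  the periodic factor, which has to be a real function.\<close>

lemma qs_real:
  assumes "z \<in> \<real>" "norm z \<le> 1" shows "qs n z \<in> \<real>"
  using assms
proof (induction n arbitrary: z)
  case (Suc n)
  have z2: "z\<^sup>2 \<in> \<real>" "norm (z\<^sup>2) \<le> 1" using Suc.prems norm_square_le by auto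
  then have r: "qs n (z\<^sup>2) \<in> \<real>" by (rule Suc.IH)
  have "1 - of_real \<kappa> * z\<^sup>2 * exp (qs n (z\<^sup>2)) \<notin> \<real>\<^sub>\<le>\<^sub>0" by (rule step_arg_lower[OF z2(2) Re_qs[OF z2(2)]])
  moreover have "1 - of_real \<kappa> * z\<^sup>2 * exp (qs n (z\<^sup>2)) \<in> \<real>"
    using r z2 by (intro Reals_diff Reals_mult) (auto elim!: Reals_cases simp: exp_of_real)
  ultimately have "Ln (1 - of_real \<kappa> * z\<^sup>2 * exp (qs n (z\<^sup>2))) \<in> \<real>"
    by (metis Ln_of_real Reals_cases Reals_of_real nonpos_Reals_of_real_iff not_le)
  then show ?case using r by (auto simp: step_def)
qed auto

lemma q_real: "z \<in> \<real> \<Longrightarrow> norm z \<le> 1 \<Longrightarrow> q z \<in> \<real>"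
  by (rule Lim_in_closed_set[OF closed_complex_Reals _ _ qs_tendsto]) (auto simp: qs_real)

lemma qs_continuous_holomorphic:
  "continuous_on (cball 0 1) (qs n) \<and> qs n holomorphic_on ball 0 1"
proof (induction n)
  case (Suc n)
  have sq: "(\<lambda>z. z\<^sup>2 :: complex) ` cball 0 1 \<subseteq> cball 0 1" "(\<lambda>z. z\<^sup>2 :: complex) ` ball 0 1 \<subseteq> ball 0 1"
    by (auto simp: norm_power power_le_one power_less_one_iff)
  have na: "1 - of_real \<kappa> * z\<^sup>2 * exp (qs n (z\<^sup>2)) \<notin> \<real>\<^sub>\<le>\<^sub>0" if "norm z \<le> 1" for z
    by (rule step_arg_lower[OF norm_square_le Re_qs[OF norm_square_le]]) (use that in auto)
  have c: "continuous_on (cball 0 1) (\<lambda>z. qs n (z\<^sup>2))"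
    by (rule continuous_on_compose2[of "cball 0 1" "qs n"])
       (use Suc sq in \<open>auto intro!: continuous_intros\<close>)
  have h: "(\<lambda>z. qs n (z\<^sup>2)) holomorphic_on ball 0 1"
    by (rule holomorphic_on_compose_gen[of _ _ "qs n" "ball 0 1", unfolded o_def])
       (use Suc sq in \<open>auto intro!: holomorphic_intros\<close>)
  show ?case
    unfolding qs.simps(2)[abs_def] step_def
    by (intro conjI continuous_intros holomorphic_intros c h) (auto simp: na)
qed (auto simp: fun_eq_iff[symmetric])

lemma q_continuous: "continuous_on (cball 0 1) q"
  and q_holomorphic: "q holomorphic_on ball 0 1"
  using holomorphic_uniform_limit[OF _ qs_uniform_limit] qs_continuous_holomorphic by auto

text \<open>The derivative \<open>8 * \<beta> * u powr (\<beta> - 1) - 1\<close> is nonnegative up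
  to 4, because \<open>\<beta>\<close> exceeds 1/2 and \<open>u powr (\<beta> - 1)\<close> is at
  least 1/4; this determines the 8. The range must reach 4 since the recursion evaluates the modulus
  at twice a distance in the disc. The endpoint 0, where the derivative does not exist, is treated
  apart.\<close>

lemma modulus_mono:
  assumes "0 \<le> x" "x \<le> y" "y \<le> 4"
  shows "8 * x powr \<beta> - x \<le> 8 * y powr \<beta> - y"
proof (cases "x = 0")
  case True
  have "y \<le> 8 * y powr \<beta>"
  proof (cases "y = 0")
    case False
    then have y: "y > 0" using assms by auto
    have "y = y powr \<beta> * y powr (1 - \<beta>)" using y by (simp flip: powr_add)
    also have "\<dots> \<le> y powr \<beta> * 4 powr (1 - \<beta>)"
      using y assms \<beta>_bounds by (intro mult_left_mono powr_mono2) auto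
    also have "\<dots> \<le> y powr \<beta> * 4 powr 1"
      using \<beta>_bounds by (intro mult_left_mono powr_mono) auto
    also have "\<dots> \<le> 8 * y powr \<beta>" by simp
    finally show ?thesis .
  qed auto
  then show ?thesis using True by simp
next
  case False
  then have x: "x > 0" using assms by auto
  show ?thesis
  proof (rule DERIV_nonneg_imp_nondecreasing[OF assms(2)])
    fix u assume u: "x \<le> u" "u \<le> y"
    have "4 powr (-1) \<le> 4 powr (\<beta> - 1)" using \<beta>_bounds by (intro powr_mono) auto
    also have "\<dots> \<le> u powr (\<beta> - 1)"
      using u x assms \<beta>_bounds by (intro powr_mono2') auto
    finally have "1/4 \<le> u powr (\<beta> - 1)" by (simp add: powr_minus)
    then have "1/2 * (1/4) \<le> \<beta> * u powr (\<beta> - 1)" using \<beta>_bounds by (intro mult_mono) auto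
    moreover have "((\<lambda>x. 8 * x powr \<beta> - x) has_real_derivative 8 * (\<beta> * u powr (\<beta> - 1)) - 1) (at u)"
      using u x by (auto intro!: derivative_eq_intros)
    ultimately show "\<exists>d. ((\<lambda>x. 8 * x powr \<beta> - x) has_real_derivative d) (at u) \<and> 0 \<le> d"
      by (intro exI[of _ "8 * (\<beta> * u powr (\<beta> - 1)) - 1"]) auto
  qed
qed

text \<open>The modulus \<open>8 x\<^sup>\<beta> - x\<close> is invariant under the recursion; the linear correction absorbs the
  dependence of \<open>step\<close> on its first argument, so the exponent is not diminished.\<close>

lemma qs_modulus:
  assumes "norm z \<le> 1" "norm w \<le> 1"
  shows "norm (qs n z - qs n w) \<le> 8 * norm (z - w) powr \<beta> - norm (z - w)"
  using assms
proof (induction n arbitrary: z w)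
  case 0
  have "norm (z - w) \<le> 4" using norm_triangle_ineq4[of z w] 0 by linarith
  then show ?case using modulus_mono[of 0 "norm (z - w)"] by simp
next
  case (Suc n)
  define x where "x = norm (z - w)"
  have z2: "norm (z\<^sup>2) \<le> 1" "norm (w\<^sup>2) \<le> 1" using Suc.prems norm_square_le by auto
  have x2: "norm (z\<^sup>2 - w\<^sup>2) \<le> 2 * x" "2 * x \<le> 4"
  proof -
    have "z\<^sup>2 - w\<^sup>2 = (z - w) * (z + w)" by (simp add: power2_eq_square algebra_simps)
    then have "norm (z\<^sup>2 - w\<^sup>2) = x * norm (z + w)" by (simp add: x_def norm_mult)
    also have "\<dots> \<le> x * 2"
      using norm_triangle_ineq[of z w] Suc.prems by (intro mult_left_mono) (auto simp: x_def)
    finally show "norm (z\<^sup>2 - w\<^sup>2) \<le> 2 * x" by simp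
    show "2 * x \<le> 4" using norm_triangle_ineq4[of z w] Suc.prems unfolding x_def by linarith
  qed
  have "norm (qs n (z\<^sup>2) - qs n (w\<^sup>2)) \<le> 8 * norm (z\<^sup>2 - w\<^sup>2) powr \<beta> - norm (z\<^sup>2 - w\<^sup>2)"
    by (rule Suc.IH[OF z2])
  also have "\<dots> \<le> 8 * (2 * x) powr \<beta> - 2 * x" using x2 by (intro modulus_mono) auto
  also have "\<dots> = 8 * (\<mu> * x powr \<beta>) - 2 * x"
    by (simp add: powr_mult two_powr_\<beta> x_def)
  finally have A: "norm (qs n (z\<^sup>2) - qs n (w\<^sup>2)) \<le> 8 * (\<mu> * x powr \<beta>) - 2 * x" .
  have "qs (Suc n) z - qs (Suc n) w = (step (z\<^sup>2) (qs n (z\<^sup>2)) - step (z\<^sup>2) (qs n (w\<^sup>2)))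
       + (step (z\<^sup>2) (qs n (w\<^sup>2)) - step (w\<^sup>2) (qs n (w\<^sup>2)))" by simp
  then have "norm (qs (Suc n) z - qs (Suc n) w) \<le> norm (step (z\<^sup>2) (qs n (z\<^sup>2)) - step (z\<^sup>2) (qs n (w\<^sup>2)))
       + norm (step (z\<^sup>2) (qs n (w\<^sup>2)) - step (w\<^sup>2) (qs n (w\<^sup>2)))"
    by (metis norm_triangle_ineq)
  also have "\<dots> \<le> 1 / \<mu> * norm (qs n (z\<^sup>2) - qs n (w\<^sup>2)) + (1 - \<rho>) / \<mu> * norm (z\<^sup>2 - w\<^sup>2)"
    by (intro add_mono step_lipschitz_right step_lipschitz_left z2 Re_qs)
  also have "\<dots> \<le> 1 / \<mu> * (8 * (\<mu> * x powr \<beta>) - 2 * x) + (1 - \<rho>) / \<mu> * (2 * x)"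
    using A x2 \<mu>_bounds \<rho>_bounds by (intro add_mono mult_left_mono) auto
  \<comment> \<open>An exact identity: the linear terms add up to
    \<open>- 2 * \<rho> * x / \<mu>\<close>, which is \<open>- x\<close> because
    \<open>\<mu> = 2 * \<rho>\<close>.\<close>
  also have "\<dots> = 8 * x powr \<beta> - x" using \<mu>_bounds by (simp add: \<mu>_eq field_simps)
  finally show ?case by (simp add: x_def)
qed

lemma q_hoelder:
  assumes "norm z \<le> 1" "norm w \<le> 1"
  shows "norm (q z - q w) \<le> 8 * norm (z - w) powr \<beta>"
proof -
  have "norm (q z - q w) \<le> 8 * norm (z - w) powr \<beta> - norm (z - w)"
    by (rule tendsto_upperbound[OF tendsto_norm[OF tendsto_diff[OF qs_tendsto qs_tendsto]]])
       (use assms qs_modulus in auto)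
  then show ?thesis using norm_ge_zero[of "z - w"] by linarith
qed

section \<open>The inverse Boettcher map E and its reciprocal h\<close>

definition h :: "complex \<Rightarrow> complex" where "h z = z * exp (q z)"

definition E :: "complex \<Rightarrow> complex" where "E z = inverse (h z)"

definition quad :: "complex \<Rightarrow> complex" where "quad Z = Z\<^sup>2 + of_real \<kappa>"

lemma h_0 [simp]: "h 0 = 0"
  by (simp add: h_def)

lemma h_eq_0_iff [simp]: "h z = 0 \<longleftrightarrow> z = 0"
  by (simp add: h_def)

lemma h_minus: "norm z \<le> 1 \<Longrightarrow> h (- z) = - h z"
  by (simp add: h_def q_minus)

lemma E_minus: "norm z \<le> 1 \<Longrightarrow> E (- z) = - E z"
  by (simp add: E_def h_minus)

lemma norm_exp_q: "norm z \<le> 1 \<Longrightarrow> norm (exp (q z)) \<le> 1 / \<rho>"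
proof -
  assume "norm z \<le> 1"
  then have "exp (Re (q z)) \<le> exp (- ln \<rho>)" using Re_q by simp
  then show ?thesis using \<rho>_bounds by (simp add: exp_minus inverse_eq_divide)
qed

lemma norm_h: "norm z \<le> 1 \<Longrightarrow> norm (h z) \<le> 1 / \<rho>"
proof -
  assume z: "norm z \<le> 1"
  have "norm (h z) \<le> 1 * (1 / \<rho>)"
    unfolding h_def norm_mult using z \<rho>_bounds norm_exp_q[OF z] by (intro mult_mono) auto
  then show ?thesis by simp
qed

lemma norm_E:
  assumes "norm z \<le> 1" "z \<noteq> 0"
  shows "\<rho> \<le> norm (E z)"
proof -
  have "inverse (1 / \<rho>) \<le> inverse (norm (h z))"
    using norm_h[OF assms(1)] assms(2) \<rho>_bounds by (intro le_imp_inverse_le) auto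
  then show ?thesis by (simp add: E_def norm_inverse)
qed

text \<open>The equation for \<open>E\<close> rewritten for \<open>h = 1 / E\<close> and cleared of
  denominators, so that it also holds at 0.\<close>

lemma h_power2:
  assumes "norm z \<le> 1"
  shows "(h z)\<^sup>2 * (1 - of_real \<kappa> * h (z\<^sup>2)) = h (z\<^sup>2)"
proof -
  let ?v = "1 - of_real \<kappa> * z\<^sup>2 * exp (q (z\<^sup>2))"
  have z2: "norm (z\<^sup>2) \<le> 1" by (rule norm_square_le[OF assms])
  have v: "?v \<noteq> 0" using step_arg_lower[OF z2 Re_q[OF z2]] by auto
  have "2 * q z = q (z\<^sup>2) - Ln ?v" by (simp add: q_eq[OF assms] step_def)
  then have "exp (q z) ^ 2 = exp (q (z\<^sup>2)) / ?v"
    using v by (simp add: exp_diff flip: exp_double)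
  then have "exp (q z) ^ 2 * ?v = exp (q (z\<^sup>2))" using v by simp
  then have "z\<^sup>2 * (exp (q z) ^ 2 * ?v) = z\<^sup>2 * exp (q (z\<^sup>2))" by simp
  then show ?thesis by (simp add: h_def power_mult_distrib mult.assoc)
qed

lemma E_power2:
  assumes "norm z \<le> 1" "z \<noteq> 0"
  shows "E (z\<^sup>2) = quad (E z)"
proof -
  have "h z \<noteq> 0" "h (z\<^sup>2) \<noteq> 0" using assms by auto
  then show ?thesis
    using h_power2[OF assms(1)] by (simp add: E_def quad_def field_simps)
qed

lemma quad_iterate_E:
  assumes "norm z \<le> 1" "z \<noteq> 0"
  shows "(quad ^^ n) (E z) = E (z ^ (2 ^ n))"
proof (induction n)
  case (Suc n)
  have "norm (z ^ 2 ^ n) \<le> 1" using assms by (simp add: norm_power power_le_one)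
  then show ?case using Suc assms E_power2[of "z ^ (2 ^ n)"]
    by (simp add: power_mult[symmetric] mult.commute)
qed simp

text \<open>At 1 the functional equation says that \<open>E 1\<close> is a fixed point of
  \<open>quad\<close>. The lower bound \<open>\<rho>\<close> for \<open>norm (E z)\<close> excludes
  the attracting one, which is below 1/4.\<close>

lemma E_1: "E 1 = of_real \<rho>"
proof -
  have "E 1 = (E 1)\<^sup>2 + of_real \<kappa>" using E_power2[of 1] by (simp add: quad_def)
  then have "(E 1 - of_real \<rho>) * (E 1 - of_real (1 - \<rho>)) = 0"
    by (simp add: \<kappa>_def algebra_simps power2_eq_square)
  moreover have "E 1 \<noteq> of_real (1 - \<rho>)"
  proof
    assume "E 1 = of_real (1 - \<rho>)"
    then have "norm (E 1) = 1 - \<rho>" using \<rho>_bounds by (metis abs_of_nonneg diff_ge_0_iff_ge less_imp_le norm_of_real)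
    then show False using norm_E[of 1] \<rho>_bounds by simp
  qed
  ultimately show ?thesis by simp
qed

lemma h_holomorphic: "h holomorphic_on ball 0 1"
  unfolding h_def[abs_def] by (intro holomorphic_intros q_holomorphic)

lemma h_deriv_0: "(h has_field_derivative 1) (at 0)"
proof -
  have "(q has_field_derivative deriv q 0) (at 0)"
    by (rule holomorphic_derivI[OF q_holomorphic]) auto
  then show ?thesis
    unfolding h_def[abs_def] by (auto intro!: derivative_eq_intros simp: q_0)
qed

lemma E_holomorphic: "E holomorphic_on ball 0 1 - {0}"
proof -
  have "h holomorphic_on ball 0 1 - {0}" by (rule holomorphic_on_subset[OF h_holomorphic]) auto
  then show ?thesis unfolding E_def[abs_def] by (rule holomorphic_on_inverse) auto
qed

text \<open>Each extraction of a square root leaves a sign open. Oddness decides it: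
  \<open>z = - w\<close> would give \<open>E w = - E w\<close>, but \<open>E\<close> has no zero
  outside 0.\<close>

lemma E_eq_descend:
  assumes "norm z \<le> 1" "norm w \<le> 1" "z \<noteq> 0" "w \<noteq> 0" "E z = E w" "z ^ (2 ^ n) = w ^ (2 ^ n)"
  shows "z = w"
  using assms
proof (induction n arbitrary: z w)
  case (Suc n)
  have "z\<^sup>2 = w\<^sup>2"
  proof (rule Suc.IH)
    show "norm (z\<^sup>2) \<le> 1" "norm (w\<^sup>2) \<le> 1" using Suc.prems norm_square_le by blast+
    show "z\<^sup>2 \<noteq> 0" "w\<^sup>2 \<noteq> 0" using Suc.prems by simp_all
    show "E (z\<^sup>2) = E (w\<^sup>2)" using Suc.prems E_power2 by metis
    show "(z\<^sup>2) ^ 2 ^ n = (w\<^sup>2) ^ 2 ^ n" using Suc.prems(6) by (simp flip: power_mult)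
  qed
  then consider "z = w" | "z = - w" by (auto simp: power2_eq_iff)
  then show ?case
  proof cases
    case 2
    then have "E w = - E w" using Suc.prems E_minus by metis
    then have "E w = 0" by simp
    then show ?thesis using Suc.prems by (simp add: E_def)
  qed
qed auto

text \<open>Injectivity near 0 propagates: two points with the same image stay in step under squaring
  until they reach the neighbourhood of 0, and \<open>E\<close> is odd, so no sign is lost on the way back.\<close>

lemma inj_on_E: "inj_on E (ball 0 1 - {0})"
proof (rule inj_onI)
  fix z w assume zw: "z \<in> ball 0 1 - {0}" "w \<in> ball 0 1 - {0}" and eq: "E z = E w"
  obtain r where r: "r > 0" "inj_on h (ball 0 r)"
    by (rule has_complex_derivative_locally_injective[OF h_holomorphic, of 0])
       (auto simp: DERIV_imp_deriv[OF h_deriv_0])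
  have "(\<lambda>n. norm u ^ (2 ^ n)) \<longlonglongrightarrow> 0" if "u \<in> ball 0 1" for u :: complex
  proof -
    have "filterlim (\<lambda>n. 2 ^ n :: nat) at_top sequentially"
      by (rule filterlim_subseq) (auto intro!: strict_monoI)
    then show ?thesis
      using that by (intro filterlim_compose[OF LIMSEQ_power_zero, of "norm u"]) auto
  qed
  then have ev: "\<forall>\<^sub>F n in sequentially. norm u ^ (2 ^ n) < r" if "u \<in> ball 0 1" for u :: complex
    using that r(1) order_tendstoD(2) by blast
  have "\<forall>\<^sub>F n in sequentially. norm z ^ (2 ^ n) < r \<and> norm w ^ (2 ^ n) < r"
    using zw by (intro eventually_conj ev) auto
  then obtain n where n: "norm z ^ (2 ^ n) < r" "norm w ^ (2 ^ n) < r"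
    by (metis (no_types, lifting) eventually_sequentially order_refl)
  have "E (z ^ (2 ^ n)) = E (w ^ (2 ^ n))"
    using quad_iterate_E[of z n] quad_iterate_E[of w n] zw eq by auto
  then have "h (z ^ (2 ^ n)) = h (w ^ (2 ^ n))" by (simp add: E_def)
  then have "z ^ (2 ^ n) = w ^ (2 ^ n)"
    by (rule inj_onD[OF r(2)]) (use n in \<open>simp_all add: norm_power\<close>)
  then show "z = w" using zw eq by (intro E_eq_descend[of z w n]) auto
qed

lemma inj_on_h: "inj_on h (ball 0 1)"
proof (rule inj_onI)
  fix z w assume zw: "z \<in> ball 0 1" "w \<in> ball 0 1" and eq: "h z = h w"
  show "z = w"
  proof (cases "z = 0 \<or> w = 0")
    case True
    then show ?thesis using eq by (metis h_eq_0_iff)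
  next
    case False
    then show ?thesis by (intro inj_onD[OF inj_on_E, of z w]) (use zw eq in \<open>auto simp: E_def\<close>)
  qed
qed

section \<open>The image of E and its complete invariance\<close>

definition "escaping = E ` (ball 0 1 - {0})"

lemma escaping_open: "open escaping"
  unfolding escaping_def by (rule open_mapping_thm3[OF E_holomorphic _ inj_on_E]) auto

lemma escaping_connected: "connected escaping"
  unfolding escaping_def
  by (intro connected_continuous_image holomorphic_on_imp_continuous_on E_holomorphic
        connected_punctured_ball) auto

lemma escaping_quad: "Z \<in> escaping \<Longrightarrow> quad Z \<in> escaping"
proof -
  assume "Z \<in> escaping"
  then obtain z where z: "norm z < 1" "z \<noteq> 0" "Z = E z" unfolding escaping_def by force
  then have "quad Z = E (z\<^sup>2)" "norm (z\<^sup>2) < 1" by (auto simp: E_power2 norm_power power_less_one_iff)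
  then show ?thesis using z by (auto simp: escaping_def)
qed

text \<open>If \<open>quad Z = E \<zeta>\<close> and \<open>w\<close> is a square root of
  \<open>\<zeta>\<close>, then \<open>w\<close> is again in the punctured disc and both solutions
  \<open>E w\<close> and \<open>- E w = E (- w)\<close> are values of \<open>E\<close>.\<close>

lemma quad_escaping: "quad Z \<in> escaping \<Longrightarrow> Z \<in> escaping"
proof -
  assume "quad Z \<in> escaping"
  then obtain \<zeta> where z: "norm \<zeta> < 1" "\<zeta> \<noteq> 0" "quad Z = E \<zeta>" unfolding escaping_def by force
  define w where "w = csqrt \<zeta>"
  have w: "w\<^sup>2 = \<zeta>" by (simp add: w_def)
  then have w1: "norm w < 1" "w \<noteq> 0" using z by (auto simp: norm_power power_less_one_iff)
  then have "quad Z = quad (E w)" using z w E_power2[of w] by simp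
  then have "Z = E w \<or> Z = - E w" by (simp add: quad_def power2_eq_iff)
  then have "Z = E w \<or> Z = E (- w)" using w1 by (simp add: E_minus)
  then show ?thesis using w1 by (auto simp: escaping_def)
qed

text \<open>By the open mapping theorem \<open>h\<close> covers a neighbourhood of 0; taking
  reciprocals, \<open>E\<close> covers a neighbourhood of infinity.\<close>

lemma escaping_outside: obtains B where "0 < B" "\<And>Z. B < norm Z \<Longrightarrow> Z \<in> escaping"
proof -
  have "open (h ` ball 0 1)" by (rule open_mapping_thm3[OF h_holomorphic _ inj_on_h]) auto
  moreover have "0 \<in> h ` ball 0 1" by (auto intro!: image_eqI[of _ _ 0])
  ultimately obtain e where e: "e > 0" "ball 0 e \<subseteq> h ` ball 0 1"
    by (meson open_contains_ball)
  show ?thesis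
  proof (rule that[of "1 / e"])
    fix Z :: complex assume Z: "1 / e < norm Z"
    then have Z0: "Z \<noteq> 0" using e by auto
    have "inverse Z \<in> ball 0 e"
      using Z Z0 e by (simp add: norm_inverse norm_divide field_simps)
    then obtain z where z: "z \<in> ball 0 1" "inverse Z = h z" using e by blast
    have "z \<noteq> 0" using Z0 z(2) by auto
    moreover have "Z = E z" using Z0 by (simp add: E_def flip: z(2))
    ultimately show "Z \<in> escaping" using z by (auto simp: escaping_def)
  qed (use e in auto)
qed

text \<open>Undoing the change of coordinates, x = 1/2 - E/a and -1/x = 2a / (2E - a). Multiplying
  numerator and denominator by \<open>h\<close> makes the formula regular at 0.\<close>

definition G :: "complex \<Rightarrow> complex" where
  "G z = 2 * of_real a * h z / (2 - of_real a * h z)"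

text \<open>A zero of the denominator of \<open>G\<close> would mean
  \<open>E z = a / 2 = 1 - \<rho>\<close>, the attracting fixed point; the bound
  \<open>1 / \<rho>\<close> on \<open>h\<close> keeps \<open>E\<close> away from it.\<close>

lemma norm_a_h: "norm z \<le> 1 \<Longrightarrow> norm (of_real a * h z) < 1"
proof -
  assume z: "norm z \<le> 1"
  have "norm (of_real a * h z) \<le> a * (1 / \<rho>)"
    unfolding norm_mult using a_pos norm_h[OF z] by (intro mult_mono) auto
  also have "\<dots> < 1" using a_pos a_less \<rho>_bounds by (simp add: field_simps)
  finally show ?thesis .
qed

lemma G_denominator:
  assumes "norm z \<le> 1"
  shows "1 \<le> norm (2 - of_real a * h z)" "2 - of_real a * h z \<noteq> 0"
proof -
  show "1 \<le> norm (2 - of_real a * h z)"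
    using norm_triangle_ineq2[of 2 "of_real a * h z"] norm_a_h[OF assms] by simp
  then show "2 - of_real a * h z \<noteq> 0" by auto
qed

lemma G_0 [simp]: "G 0 = 0"
  by (simp add: G_def)

lemma G_holomorphic: "G holomorphic_on ball 0 1"
  unfolding G_def[abs_def] using G_denominator by (intro holomorphic_intros h_holomorphic) auto

lemma deriv_G_0: "deriv G 0 = of_real a"
  by (rule DERIV_imp_deriv) (auto simp: G_def[abs_def] intro!: derivative_eq_intros h_deriv_0)

lemma G_functional_equation:
  assumes "norm z \<le> 1"
  shows "(G z)\<^sup>2 = of_real a * G (z\<^sup>2) * (1 + G z)"
proof -
  define u v A where "u = h z" "v = h (z\<^sup>2)" "A = complex_of_real a"
  have uv: "u\<^sup>2 * (1 - of_real \<kappa> * v) = v" using h_power2[OF assms] by (simp add: u_v_A_def)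
  have k: "of_real \<kappa> = A / 2 - A\<^sup>2 / 4"
    by (simp add: u_v_A_def \<kappa>_def \<rho>_def power2_eq_square field_simps)
  have d: "2 - A * u \<noteq> 0" "2 - A * v \<noteq> 0"
    using G_denominator(2)[OF assms] G_denominator(2)[OF norm_square_le[OF assms]] by (auto simp: u_v_A_def)
  have "u\<^sup>2 * (4 - 2 * A * v + A\<^sup>2 * v) = 4 * (u\<^sup>2 * (1 - (A / 2 - A\<^sup>2 / 4) * v))"
    by (simp add: algebra_simps)
  then have "u\<^sup>2 * (4 - 2 * A * v + A\<^sup>2 * v) = 4 * v" using uv unfolding k by simp
  \<comment> \<open>The right-hand side factors into \<open>(2 - A * u) * (2 + A * u)\<close>, and
    \<open>(2 + A * u) / (2 - A * u)\<close> is \<open>1 + G z\<close>.\<close>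
  then have "u\<^sup>2 * (2 - A * v) * 2 = v * (4 - A\<^sup>2 * u\<^sup>2)" by algebra
  then have *: "(2 * A * u)\<^sup>2 * (2 - A * v) = A * (2 * A * v) * (2 - A * u) * (2 + A * u)" by algebra
  have "(2 * A * u / (2 - A * u))\<^sup>2 = A * (2 * A * v / (2 - A * v)) * ((2 + A * u) / (2 - A * u))"
  proof -
    have "(2 * A * u)\<^sup>2 / (2 - A * u)\<^sup>2 = A * (2 * A * v) * (2 + A * u) / ((2 - A * v) * (2 - A * u))"
    proof (subst frac_eq_eq)
      show "(2 * A * u)\<^sup>2 * ((2 - A * v) * (2 - A * u)) = A * (2 * A * v) * (2 + A * u) * (2 - A * u)\<^sup>2"
        using * by algebra
    qed (use d in auto)
    then show ?thesis by (simp add: power_divide)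
  qed
  also have "(2 + A * u) / (2 - A * u) = 1 + 2 * A * u / (2 - A * u)" using d by (simp add: field_simps)
  finally show ?thesis by (simp add: G_def u_v_A_def)
qed

lemma inj_on_G: "inj_on G (ball 0 1)"
proof (rule inj_onI)
  fix z w assume zw: "z \<in> ball 0 1" "w \<in> ball 0 1" and eq: "G z = G w"
  have d: "2 - of_real a * h z \<noteq> 0" "2 - of_real a * h w \<noteq> 0" using G_denominator zw by auto
  from eq d have "h z = h w" using a_pos by (simp add: G_def field_simps)
  then show "z = w" using inj_onD[OF inj_on_h] zw by blast
qed

lemma G_eq_E:
  assumes "norm z \<le> 1" "z \<noteq> 0"
  shows "G z = 2 * of_real a / (2 * E z - of_real a)" "2 * E z - of_real a \<noteq> 0"
    and "E z = of_real a / G z + of_real a / 2" "G z \<noteq> 0"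
proof -
  have d: "2 - of_real a * h z \<noteq> 0" using G_denominator assms by auto
  have h0: "h z \<noteq> 0" using assms by simp
  have "2 * E z - of_real a = (2 - of_real a * h z) / h z" using h0 by (simp add: E_def field_simps)
  then show n: "2 * E z - of_real a \<noteq> 0" and "G z = 2 * of_real a / (2 * E z - of_real a)"
    using d h0 by (auto simp: G_def)
  then have "of_real a / G z = (2 * E z - of_real a) / 2" using a_pos by simp
  then show "E z = of_real a / G z + of_real a / 2" by (simp add: field_simps)
  show "G z \<noteq> 0" using d h0 a_pos by (simp add: G_def)
qed

text \<open>The constant is 16 + 16. Nonnegativity of the modulus bounds \<open>x\<close> by
  \<open>8 * x powr \<beta>\<close>, and on the half-plane \<open>exp\<close> is bounded by 2 and
  2-Lipschitz.\<close>

lemma h_hoelder: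
  assumes z: "norm z \<le> 1" and w: "norm w \<le> 1"
  shows "norm (h z - h w) \<le> 32 * norm (z - w) powr \<beta>"
proof -
  define x where "x = norm (z - w)"
  have x4: "x \<le> 4" "0 \<le> x" using norm_triangle_ineq4[of z w] assms unfolding x_def by (linarith, simp)
  then have x8: "x \<le> 8 * x powr \<beta>" using modulus_mono[of 0 x] by simp
  have r2: "1 / \<rho> \<le> 2" using \<rho>_bounds by (simp add: field_simps)
  have e: "norm (exp (q z) - exp (q w)) \<le> 2 * norm (q z - q w)"
  proof (rule field_differentiable_bound)
    let ?S = "{s. Re s \<le> - ln \<rho>}"
    show "convex ?S" by (rule convex_halfspace_Re_le)
    show "q z \<in> ?S" "q w \<in> ?S" using assms Re_q by auto
    fix s assume "s \<in> ?S"
    then have "exp (Re s) \<le> exp (- ln \<rho>)" by simp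
    also have "\<dots> = 1 / \<rho>" using \<rho>_bounds by (simp add: exp_minus inverse_eq_divide)
    finally show "norm (exp s) \<le> 2" using r2 by simp
    show "(exp has_field_derivative exp s) (at s within ?S)"
      by (auto intro!: derivative_eq_intros)
  qed
  have "h z - h w = (z - w) * exp (q z) + w * (exp (q z) - exp (q w))"
    by (simp add: h_def algebra_simps)
  then have "norm (h z - h w) \<le> x * norm (exp (q z)) + norm w * norm (exp (q z) - exp (q w))"
    unfolding x_def by (metis norm_mult norm_triangle_ineq)
  also have "\<dots> \<le> (8 * x powr \<beta>) * 2 + 1 * (2 * (8 * x powr \<beta>))"
    using x8 x4 r2 norm_exp_q[OF z] w e q_hoelder[OF assms]
    by (intro add_mono mult_mono) (auto simp: x_def)
  finally show ?thesis by (simp add: x_def)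
qed

lemma G_hoelder: "hoelder_on \<beta> (cball 0 1) G"
  unfolding hoelder_on_def
proof (intro exI ballI)
  fix z w :: complex assume "z \<in> cball 0 1" "w \<in> cball 0 1"
  then have zw: "norm z \<le> 1" "norm w \<le> 1" by auto
  note dz = G_denominator[OF zw(1)] and dw = G_denominator[OF zw(2)]
  have "G z - G w = 4 * of_real a * (h z - h w) / ((2 - of_real a * h z) * (2 - of_real a * h w))"
    using dz dw by (simp add: G_def field_simps)
  then have "norm (G z - G w) = 4 * a * norm (h z - h w) / (norm (2 - of_real a * h z) * norm (2 - of_real a * h w))"
    using a_pos by (simp only: norm_divide norm_mult norm_of_real norm_numeral)
  also have "\<dots> \<le> 4 * a * norm (h z - h w) / (1 * 1)"
    using a_pos dz dw by (intro divide_left_mono mult_mono mult_nonneg_nonneg mult_pos_pos) auto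
  also have "\<dots> \<le> 2 * norm (h z - h w)" using a_less by (simp add: mult_right_mono)
  also have "\<dots> \<le> 2 * (32 * norm (z - w) powr \<beta>)" by (intro mult_left_mono h_hoelder zw) auto
  finally show "norm (G z - G w) \<le> 64 * norm (z - w) powr \<beta>" by simp
qed

end

section \<open>The exterior of the Julia set\<close>

lemma sphere_neg_recip_involution [simp]: "sphere_neg_recip (sphere_neg_recip p) = p"
  by (cases p) auto

lemma sqrt_1_square_bounds: "1 \<le> sqrt (1 + (norm z)\<^sup>2)" "sqrt (1 + (norm z)\<^sup>2) \<le> 1 + norm z"
  by (auto intro!: real_le_lsqrt simp: power2_sum)

lemma chordal_dist_le_2_dist: "chordal_dist (Some z) (Some w) \<le> 2 * norm (z - w)"
proof -
  have "1 * 1 \<le> sqrt (1 + (norm z)\<^sup>2) * sqrt (1 + (norm w)\<^sup>2)"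
    by (intro mult_mono sqrt_1_square_bounds) auto
  then have "2 * norm (z - w) / (sqrt (1 + (norm z)\<^sup>2) * sqrt (1 + (norm w)\<^sup>2)) \<le> 2 * norm (z - w) / 1"
    by (intro divide_left_mono) auto
  then show ?thesis by simp
qed

text \<open>The triangle inequality through the point at infinity: two points far out are chordally
  close whatever their directions.\<close>

lemma chordal_dist_le_infinity:
  "chordal_dist (Some z) (Some w) \<le> 2 / sqrt (1 + (norm z)\<^sup>2) + 2 / sqrt (1 + (norm w)\<^sup>2)"
proof -
  define A B where "A = sqrt (1 + (norm z)\<^sup>2)" and "B = sqrt (1 + (norm w)\<^sup>2)"
  have AB: "1 \<le> A" "1 \<le> B" using sqrt_1_square_bounds by (auto simp: A_def B_def)
  have "norm z \<le> A" "norm w \<le> B" by (auto simp: A_def B_def intro!: real_le_rsqrt)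
  then have "norm (z - w) \<le> A + B"
    by (rule order_trans[OF norm_triangle_ineq4 add_mono])
  then have "2 * norm (z - w) / (A * B) \<le> 2 * (A + B) / (A * B)"
    using AB by (intro divide_right_mono) auto
  also have "\<dots> = 2 / A + 2 / B" using AB by (simp add: field_simps)
  finally show ?thesis by (simp add: A_def B_def)
qed

lemma chordal_ball_subset:
  assumes "0 < d"
  obtains d' where "0 < d'"
    "\<And>q. chordal_dist (Some z) q < d' \<Longrightarrow> \<exists>w. q = Some w \<and> norm (w - z) < d"
proof -
  define A where "A = sqrt (1 + (norm z)\<^sup>2)"
  have A: "1 \<le> A" using sqrt_1_square_bounds by (simp add: A_def)
  \<comment> \<open>A point at Euclidean distance \<open>D\<close> from \<open>z\<close> has chordal
    distance at least \<open>2 * D / (A * (1 + norm z + D))\<close>, which increases in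
    \<open>D\<close> towards \<open>2 / A\<close>, the distance to infinity. Its value at
    \<open>d\<close> therefore excludes infinity as well.\<close>
  define d' where "d' = 2 * d / (A * (1 + norm z + d))"
  have pos: "0 < 1 + norm z + d" using assms by (simp add: add_pos_nonneg add.commute)
  have "0 < d'" using A assms pos by (simp add: d'_def)
  moreover have "\<exists>w. q = Some w \<and> norm (w - z) < d" if q: "chordal_dist (Some z) q < d'" for q
  proof (cases q)
    case None
    have "d' = 2 / A * (d / (1 + norm z + d))" using A pos by (simp add: d'_def)
    also have "\<dots> \<le> 2 / A * 1" using A assms pos by (intro mult_left_mono) (auto simp: field_simps)
    finally show ?thesis using q None by (simp add: A_def)
  next
    case (Some w)
    define D where "D = norm (w - z)"
    have "norm (w - z) < d"
    proof (rule ccontr)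
      assume "\<not> norm (w - z) < d"
      then have D: "d \<le> D" by (simp add: D_def)
      have "norm w \<le> norm z + D" using norm_triangle_ineq[of z "w - z"] by (simp add: D_def)
      then have B: "sqrt (1 + (norm w)\<^sup>2) \<le> 1 + norm z + D" using sqrt_1_square_bounds(2)[of w] by linarith
      have posD: "0 < 1 + norm z + D" using pos D by linarith
      have "d / (1 + norm z + d) \<le> D / (1 + norm z + D)"
        using D pos posD assms by (simp add: divide_simps) (auto simp: algebra_simps intro!: add_mono mult_right_mono)
      then have "2 / A * (d / (1 + norm z + d)) \<le> 2 / A * (D / (1 + norm z + D))"
        using A by (intro mult_left_mono) auto
      then have "d' \<le> 2 * D / (A * (1 + norm z + D))" by (simp add: d'_def)
      also have "\<dots> \<le> 2 * D / (A * sqrt (1 + (norm w)\<^sup>2))"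
        by (intro divide_left_mono mult_left_mono mult_pos_pos B)
           (use A D assms posD sqrt_1_square_bounds(1)[of w] in linarith)+
      also have "\<dots> < d'" using q Some by (simp add: A_def D_def norm_minus_commute)
      finally show False by simp
    qed
    then show ?thesis using Some by auto
  qed
  ultimately show ?thesis by (rule that)
qed

text \<open>The lower bound 3 on \<open>R\<close> is the threshold beyond which \<open>quad\<close>
  does not decrease the modulus, so the neighbourhood of infinity obtained here is never left
  again.\<close>

lemma chordal_infinity_small:
  assumes "0 < (e :: real)"
  obtains R where "3 \<le> R" "\<And>x :: complex. R \<le> norm x \<Longrightarrow> 2 / sqrt (1 + (norm x)\<^sup>2) < e"
proof (rule that[of "max 3 (2 / e)"])
  fix x :: complex assume x: "max 3 (2 / e) \<le> norm x"
  have "2 / e \<le> norm x" using x by simp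
  also have "norm x = sqrt ((norm x)\<^sup>2)" by simp
  also have "\<dots> < sqrt (1 + (norm x)\<^sup>2)" by (rule real_sqrt_less_mono) simp
  finally have "2 / e < sqrt (1 + (norm x)\<^sup>2)" .
  moreover have "0 < sqrt (1 + (norm x)\<^sup>2)" using sqrt_1_square_bounds(1)[of x] by linarith
  ultimately show "2 / sqrt (1 + (norm x)\<^sup>2) < e" using assms by (simp add: field_simps)
qed simp

text \<open>Here \<open>norm w\<close> is at most \<open>2 * norm (y - w)\<close>, and the weight of
  \<open>w\<close> is at most \<open>2 * norm w\<close>, so \<open>w\<close> cancels. The resulting
  gap depends on \<open>R\<close> only and is what defeats equicontinuity on the boundary.\<close>

lemma chordal_dist_far:
  assumes "norm y \<le> R" "2 * R + 1 \<le> norm w" "0 \<le> R"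
  shows "1 / (2 * sqrt (1 + R\<^sup>2)) \<le> chordal_dist (Some y) (Some w)"
proof -
  define A B C where "A = sqrt (1 + (norm y)\<^sup>2)" and "B = sqrt (1 + (norm w)\<^sup>2)" and "C = sqrt (1 + R\<^sup>2)"
  have A: "1 \<le> A" "A \<le> C"
    using sqrt_1_square_bounds(1)[of y] assms by (auto simp: A_def C_def intro!: power_mono)
  have B: "1 \<le> B" "B \<le> 2 * norm w"
    using sqrt_1_square_bounds[of w] assms by (auto simp: B_def)
  have "norm w \<le> 2 * norm (y - w)"
    using norm_triangle_ineq2[of w y] assms by (simp add: norm_minus_commute)
  moreover have "0 < norm w" using assms by linarith
  ultimately have "norm w / (C * (2 * norm w)) \<le> 2 * norm (y - w) / (A * B)"
    using A B by (intro frac_le mult_mono mult_pos_pos) auto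
  moreover have "norm w / (C * (2 * norm w)) = 1 / (2 * C)" using \<open>0 < norm w\<close> by simp
  ultimately show ?thesis by (simp add: A_def B_def C_def)
qed

context small_logistic
begin

section \<open>Conjugacy to the quadratic map, and escape to infinity\<close>

abbreviation "logi \<equiv> logistic (complex_of_real a)"

definition "conj_quad x = of_real a * (1 / 2 - x :: complex)"

lemma norm_conj_quad: "norm (conj_quad x) = a * norm (1 / 2 - x)"
  unfolding conj_quad_def norm_mult using a_pos by simp

lemma conj_quad_logistic: "conj_quad (of_real a * x * (1 - x)) = quad (conj_quad x)"
  by (simp add: conj_quad_def quad_def \<kappa>_def \<rho>_def power2_eq_square field_simps)

definition "orbit n x = 1 / 2 - (quad ^^ n) (conj_quad x) / of_real a"

lemma conj_quad_orbit: "conj_quad (orbit n x) = (quad ^^ n) (conj_quad x)"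
  using a_pos by (simp add: conj_quad_def orbit_def)

lemma conj_quad_inject: "conj_quad x = conj_quad y \<longleftrightarrow> x = y"
  using a_pos by (simp add: conj_quad_def)

lemma logi_iterate: "(logi ^^ n) (Some x) = Some (orbit n x)"
proof (induction n)
  case 0
  then show ?case using a_pos by (simp add: orbit_def conj_quad_def)
next
  case (Suc n)
  have "of_real a * orbit n x * (1 - orbit n x) = orbit (Suc n) x"
    by (subst conj_quad_inject[symmetric]) (simp add: conj_quad_logistic conj_quad_orbit)
  then show ?case using Suc by simp
qed

lemma logi_iterate_None: "(logi ^^ n) None = None"
  by (induction n) auto

text \<open>Dividing by \<open>a < 1/2\<close> at least doubles the modulus, which outweighs the
  shift by 1/2; growth of \<open>quad\<close> thus transfers to the logistic orbit.\<close>

lemma norm_orbit_ge: "1 \<le> norm ((quad ^^ n) (conj_quad x)) \<Longrightarrow> norm ((quad ^^ n) (conj_quad x)) \<le> norm (orbit n x)"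
proof -
  define Z where "Z = (quad ^^ n) (conj_quad x)"
  assume "1 \<le> norm ((quad ^^ n) (conj_quad x))"
  then have Z: "1 \<le> norm Z" by (simp add: Z_def)
  have "norm Z = norm (Z / of_real a) * a" using a_pos by (simp add: norm_divide)
  also have "\<dots> \<le> norm (Z / of_real a) * (1/2)" using a_less by (intro mult_left_mono) auto
  finally have "2 * norm Z \<le> norm (Z / of_real a)" by simp
  also have "\<dots> \<le> norm (1/2 - Z / of_real a) + 1/2"
    using norm_triangle_ineq2[of "Z / of_real a" "1/2"] by (simp add: norm_minus_commute)
  finally show ?thesis using Z by (simp add: orbit_def Z_def)
qed

lemma norm_quad_ge: "3 \<le> norm Z \<Longrightarrow> norm Z \<le> norm (quad Z)"
proof -
  assume Z: "3 \<le> norm Z"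
  have "\<kappa> \<le> 1 * 1" unfolding \<kappa>_def using \<rho>_bounds by (intro mult_mono) auto
  moreover have "3 * norm Z \<le> norm (Z\<^sup>2)" using mult_right_mono[OF Z, of "norm Z"] by (simp add: norm_mult power2_eq_square)
  moreover have "norm (Z\<^sup>2) \<le> norm (quad Z) + \<kappa>"
    using norm_triangle_ineq4[of "quad Z" "of_real \<kappa>"] \<kappa>_pos by (simp add: quad_def)
  ultimately show ?thesis using Z by linarith
qed

lemma norm_quad_iterate_ge: "3 \<le> norm Z \<Longrightarrow> norm Z \<le> norm ((quad ^^ n) Z)"
proof (induction n)
  case (Suc n)
  then show ?case using norm_quad_ge[of "(quad ^^ n) Z"] by simp
qed simp

lemma quad_iterate_later:
  assumes "3 \<le> R" "R \<le> norm ((quad ^^ m) Z)" "m \<le> n"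
  shows "R \<le> norm ((quad ^^ n) Z)"
proof -
  have "(quad ^^ n) Z = (quad ^^ (n - m)) ((quad ^^ m) Z)"
    by (metis assms(3) funpow_add le_add_diff_inverse2 o_apply)
  then show ?thesis using norm_quad_iterate_ge[of "(quad ^^ m) Z" "n - m"] assms by simp
qed

text \<open>The iterates of \<open>E z\<close> are \<open>E (z ^ (2 ^ n))\<close> with arguments
  tending to 0, the pole of \<open>E\<close>. One large iterate suffices, since moduli beyond 3
  never decrease afterwards.\<close>

lemma escaping_iterates_unbounded:
  assumes "Z \<in> escaping"
  obtains n where "R < norm ((quad ^^ n) Z)"
proof -
  obtain z where z: "norm z < 1" "z \<noteq> 0" "Z = E z" using assms unfolding escaping_def by force
  have "filterlim (\<lambda>n. 2 ^ n :: nat) at_top sequentially"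
    by (rule filterlim_subseq) (auto intro!: strict_monoI)
  then have "(\<lambda>n. z ^ (2 ^ n)) \<longlonglongrightarrow> 0"
    using z by (intro filterlim_compose[OF LIMSEQ_power_zero, of z]) auto
  moreover have "continuous (at 0) h"
    using h_deriv_0 DERIV_continuous by blast
  ultimately have "(\<lambda>n. h (z ^ (2 ^ n))) \<longlonglongrightarrow> h 0"
    using continuous_at_imp_continuous_within[of 0 h] by (metis isCont_tendsto_compose)
  then have "(\<lambda>n. norm (h (z ^ (2 ^ n)))) \<longlonglongrightarrow> 0" using tendsto_norm_zero by simp
  moreover have "0 < 1 / (\<bar>R\<bar> + 1)" by simp
  ultimately have "\<forall>\<^sub>F n in sequentially. norm (h (z ^ (2 ^ n))) < 1 / (\<bar>R\<bar> + 1)"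
    by (rule order_tendstoD)
  then obtain n where n: "norm (h (z ^ (2 ^ n))) < 1 / (\<bar>R\<bar> + 1)"
    by (metis (no_types, lifting) eventually_sequentially order_refl)
  have "0 < norm (h (z ^ (2 ^ n)))" using z by simp
  with n have "\<bar>R\<bar> + 1 < norm (E (z ^ (2 ^ n)))" by (simp add: E_def norm_inverse norm_divide field_simps)
  then have "R < norm ((quad ^^ n) Z)" using z quad_iterate_E[of z n] by simp
  then show ?thesis by (rule that)
qed

lemma escaping_quad_iterate_iff: "(quad ^^ n) Z \<in> escaping \<longleftrightarrow> Z \<in> escaping"
  by (induction n) (auto dest: escaping_quad quad_escaping)

definition "basin_plane = {x. conj_quad x \<in> escaping}"
definition "basin = insert None (Some ` basin_plane)"

lemma basin_plane_eq: "basin_plane = (\<lambda>Z. 1 / 2 - Z / of_real a) ` escaping"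
proof -
  have "x = 1 / 2 - conj_quad x / of_real a" for x
    using a_pos by (simp add: conj_quad_def)
  moreover have "conj_quad (1 / 2 - Z / of_real a) = Z" for Z
    using a_pos by (simp add: conj_quad_def)
  ultimately show ?thesis unfolding basin_plane_def by (auto intro!: image_eqI)
qed

lemma basin_eq: "sphere_neg_recip ` Some ` G ` ball 0 1 = basin"
proof -
  have *: "sphere_neg_recip (Some (G z)) = Some (1 / 2 - E z / of_real a)" if "norm z < 1" "z \<noteq> 0" for z
  proof -
    have "G z \<noteq> 0" "E z = of_real a / G z + of_real a / 2" using G_eq_E[of z] that by auto
    then show ?thesis using a_pos by (simp add: field_simps)
  qed
  have "sphere_neg_recip ` Some ` G ` ball 0 1 = (\<lambda>z. sphere_neg_recip (Some (G z))) ` insert 0 (ball 0 1 - {0})"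
  proof -
    have "insert 0 (ball 0 1 - {0}) = (ball 0 1 :: complex set)" by auto
    then show ?thesis by (simp only: image_image)
  qed
  also have "\<dots> = insert None ((\<lambda>z. Some (1 / 2 - E z / of_real a)) ` (ball 0 1 - {0}))"
    unfolding image_insert using * by (auto intro!: image_cong)
  also have "\<dots> = basin" by (simp add: basin_def basin_plane_eq escaping_def image_image)
  finally show ?thesis .
qed

lemma basin_plane_open: "open basin_plane"
proof -
  have "basin_plane = conj_quad -` escaping" by (auto simp: basin_plane_def)
  moreover have "continuous_on UNIV conj_quad"
    unfolding conj_quad_def[abs_def] by (intro continuous_intros)
  ultimately show ?thesis using escaping_open by (simp add: open_vimage)
qed

lemma basin_plane_connected: "connected basin_plane"
proof -
  have "continuous_on escaping (\<lambda>Z. 1 / 2 - Z / complex_of_real a)"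
    using a_pos by (intro continuous_intros) auto
  then show ?thesis
    unfolding basin_plane_eq using escaping_connected connected_continuous_image by metis
qed

lemma non_basin_bounded:
  obtains B where "0 < B" "\<And>x. B < norm x \<Longrightarrow> x \<in> basin_plane"
proof -
  obtain B where B: "0 < B" "\<And>Z. B < norm Z \<Longrightarrow> Z \<in> escaping" using escaping_outside by blast
  show ?thesis
  proof (rule that[of "B / a + 1 / 2"])
    fix x :: complex assume "B / a + 1 / 2 < norm x"
    moreover have "norm x \<le> norm (1 / 2 - x) + 1 / 2"
      using norm_triangle_ineq2[of x "1/2"] by (simp add: norm_minus_commute)
    ultimately have "B / a < norm (1 / 2 - x)" by linarith
    then have "B < norm (conj_quad x)"
      using a_pos unfolding norm_conj_quad by (simp add: pos_divide_less_eq mult.commute)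
    then show "x \<in> basin_plane" using B by (simp add: basin_plane_def)
  qed (use B a_pos in \<open>auto simp: add_pos_pos\<close>)
qed

lemma basin_openin: "openin riemann_sphere basin"
  unfolding openin_Alexandroff_compactification
proof (intro disjI2 exI[of _ "- basin_plane"] conjI)
  obtain B where B: "0 < B" "\<And>x. B < norm x \<Longrightarrow> x \<in> basin_plane" using non_basin_bounded by blast
  then have "- basin_plane \<subseteq> cball 0 B" by (force simp: not_less)
  then have "bounded (- basin_plane)" using bounded_cball bounded_subset by blast
  then show "compactin euclidean (- basin_plane)"
    using basin_plane_open by (simp add: compact_eq_bounded_closed closed_Compl)
  show "closedin euclidean (- basin_plane)" using basin_plane_open by (simp add: closed_Compl)
qed (auto simp: basin_def)

text \<open>The plane part is connected, and infinity lies in its closure because the complement of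
  the basin is bounded; adding closure points preserves connectedness.\<close>

lemma basin_connectedin: "connectedin riemann_sphere basin"
proof (rule connectedin_intermediate_closure_of[of _ "Some ` basin_plane"])
  show "connectedin riemann_sphere (Some ` basin_plane)"
    by (rule connectedin_continuous_map_image[OF continuous_map_Some])
       (simp add: basin_plane_connected)
  have "None \<in> riemann_sphere closure_of (Some ` basin_plane)"
    unfolding in_closure_of
  proof (intro conjI allI impI)
    fix T assume T: "None \<in> T \<and> openin riemann_sphere T"
    then obtain C where C: "compact C" "T = insert None (Some ` (UNIV - C))"
      by (auto simp: openin_Alexandroff_compactification)
    obtain B where B: "0 < B" "\<And>x. B < norm x \<Longrightarrow> x \<in> basin_plane" using non_basin_bounded by blast
    obtain D where D: "\<And>x. x \<in> C \<Longrightarrow> norm x \<le> D"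
      using compact_imp_bounded[OF C(1)] by (auto simp: bounded_iff)
    define x where "x = complex_of_real (max B \<bar>D\<bar> + 1)"
    have "norm x = max B \<bar>D\<bar> + 1" unfolding x_def norm_of_real using B by simp
    then have "x \<in> basin_plane" "x \<notin> C" using B D[of x] by (auto simp: max_def split: if_splits)
    then show "\<exists>y. y \<in> Some ` basin_plane \<and> y \<in> T" using C by auto
  qed simp
  moreover have "Some ` basin_plane \<subseteq> riemann_sphere closure_of (Some ` basin_plane)"
    by (rule closure_of_subset) auto
  ultimately show "basin \<subseteq> riemann_sphere closure_of (Some ` basin_plane)" by (simp add: basin_def)
qed (auto simp: basin_def)

section \<open>Equicontinuity of the iterates, and its failure on the boundary\<close>

lemma orbit_isCont: "isCont (orbit n) x"
proof -
  have "continuous_on UNIV (\<lambda>x. (quad ^^ n) (conj_quad x))"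
  proof (induction n)
    case 0
    then show ?case unfolding conj_quad_def by (auto intro!: continuous_intros)
  next
    case (Suc n)
    then show ?case by (auto simp: quad_def intro!: continuous_intros)
  qed
  then have "continuous_on UNIV (orbit n)"
    unfolding orbit_def[abs_def] using a_pos by (intro continuous_intros) auto
  then show ?thesis by (simp add: continuous_on_eq_continuous_at)
qed

lemma equicontinuous_at_None: "equicontinuous_at (range (\<lambda>n. logi ^^ n)) None"
  unfolding equicontinuous_at_def
proof (intro allI impI)
  fix e :: real assume "0 < e"
  then obtain R where R: "3 \<le> R" "\<And>x :: complex. R \<le> norm x \<Longrightarrow> 2 / sqrt (1 + (norm x)\<^sup>2) < e"
    by (rule chordal_infinity_small) blast
  \<comment> \<open>Chosen so that \<open>norm x > R1\<close> forces
    \<open>norm (conj_quad x) > R\<close>.\<close>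
  define R1 where "R1 = R / a + 1 / 2"
  define d where "d = 2 / sqrt (1 + R1\<^sup>2)"
  have R1: "0 \<le> R1" using R a_pos by (simp add: R1_def)
  have s0: "0 < sqrt (1 + t\<^sup>2)" for t :: real by (simp add: add_pos_nonneg)
  have "0 < d" using s0 by (simp add: d_def)
  moreover have "chordal_dist (f None) (f q) < e"
    if f: "f \<in> range (\<lambda>n. logi ^^ n)" and q: "chordal_dist None q < d" for f q
  proof -
    obtain n where n: "f = logi ^^ n" using f by auto
    show ?thesis
    proof (cases q)
      case None
      then show ?thesis using n \<open>0 < e\<close> by (simp add: logi_iterate_None)
    next
      case (Some x)
      have "2 / sqrt (1 + (norm x)\<^sup>2) < 2 / sqrt (1 + R1\<^sup>2)" using q Some by (simp add: d_def)
      then have "sqrt (1 + R1\<^sup>2) < sqrt (1 + (norm x)\<^sup>2)"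
        using s0[of R1] s0[of "norm x"] by (simp add: field_simps)
      then have "R1 < norm x" using power_less_imp_less_base[of R1 2 "norm x"] by simp
      moreover have "norm x \<le> norm (1 / 2 - x) + 1 / 2"
        using norm_triangle_ineq2[of x "1/2"] by (simp add: norm_minus_commute)
      ultimately have "R / a < norm (1 / 2 - x)" by (simp add: R1_def)
      then have "R < norm (conj_quad x)"
        using a_pos unfolding norm_conj_quad by (simp add: pos_divide_less_eq mult.commute)
      then have Rn: "R \<le> norm ((quad ^^ n) (conj_quad x))"
        using norm_quad_iterate_ge[of "conj_quad x" n] R by simp
      then have "R \<le> norm (orbit n x)" using norm_orbit_ge[of n x] R by linarith
      then show ?thesis using R(2) Some n by (simp add: logi_iterate logi_iterate_None)
    qed
  qed
  ultimately show "\<exists>d>0. \<forall>f\<in>range (\<lambda>n. logi ^^ n). \<forall>q. chordal_dist None q < d \<longrightarrow> chordal_dist (f None) (f q) < e"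
    by blast
qed

text \<open>Once some iterate \<open>N\<close> has passed \<open>R\<close>, the same holds for
  nearby points. Iterates from \<open>N\<close> on keep both orbits near infinity and hence
  chordally close; the finitely many earlier ones are handled by continuity.\<close>

lemma equicontinuous_at_basin_plane:
  assumes x0: "x0 \<in> basin_plane"
  shows "equicontinuous_at (range (\<lambda>n. logi ^^ n)) (Some x0)"
  unfolding equicontinuous_at_def
proof (intro allI impI)
  fix e :: real assume e: "0 < e"
  then have "0 < e / 2" by simp
  then obtain R where R: "3 \<le> R" "\<And>x :: complex. R \<le> norm x \<Longrightarrow> 2 / sqrt (1 + (norm x)\<^sup>2) < e / 2"
    by (rule chordal_infinity_small) blast
  obtain N where N: "R < norm ((quad ^^ N) (conj_quad x0))"
    using x0 escaping_iterates_unbounded[of "conj_quad x0" R] by (auto simp: basin_plane_def)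
  have far: "R \<le> norm (orbit n x)" if "R \<le> norm ((quad ^^ N) (conj_quad x))" "N \<le> n" for n x
    using norm_orbit_ge[of n x] quad_iterate_later[OF R(1) that] R(1) by linarith
  have "isCont (\<lambda>x. norm (conj_quad (orbit N x))) x0"
    unfolding conj_quad_def by (intro continuous_intros orbit_isCont)
  then have "((\<lambda>x. norm ((quad ^^ N) (conj_quad x))) \<longlongrightarrow> norm ((quad ^^ N) (conj_quad x0))) (nhds x0)"
    unfolding conj_quad_orbit isCont_def
    by (simp add: tendsto_at_iff_tendsto_nhds[of "\<lambda>x. norm ((quad ^^ N) (conj_quad x))"])
  then have "\<forall>\<^sub>F x in nhds x0. R < norm ((quad ^^ N) (conj_quad x))"
    using N by (rule order_tendstoD(1))
  moreover have "\<forall>\<^sub>F x in nhds x0. \<forall>n\<in>{..<N}. dist (orbit n x) (orbit n x0) < e / 2"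
  proof (intro eventually_ball_finite ballI)
    fix n
    show "\<forall>\<^sub>F x in nhds x0. dist (orbit n x) (orbit n x0) < e / 2"
      using orbit_isCont[where n=n and x=x0] e unfolding isCont_def tendsto_at_iff_tendsto_nhds
      by (intro tendstoD) auto
  qed simp
  ultimately have "\<forall>\<^sub>F x in nhds x0. R < norm ((quad ^^ N) (conj_quad x)) \<and>
      (\<forall>n\<in>{..<N}. dist (orbit n x) (orbit n x0) < e / 2)"
    by (rule eventually_conj)
  then obtain d where d: "0 < d" "\<And>x. dist x x0 < d \<Longrightarrow> R < norm ((quad ^^ N) (conj_quad x)) \<and>
      (\<forall>n\<in>{..<N}. dist (orbit n x) (orbit n x0) < e / 2)"
    unfolding eventually_nhds_metric by blast
  obtain d' where d': "0 < d'"
      "\<And>q. chordal_dist (Some x0) q < d' \<Longrightarrow> \<exists>w. q = Some w \<and> norm (w - x0) < d"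
    using chordal_ball_subset[OF d(1)] by blast
  have "chordal_dist (f (Some x0)) (f q) < e"
    if f: "f \<in> range (\<lambda>n. logi ^^ n)" and q: "chordal_dist (Some x0) q < d'" for f q
  proof -
    obtain n where n: "f = logi ^^ n" using f by auto
    obtain x where x: "q = Some x" "norm (x - x0) < d" using d'(2)[OF q] by auto
    then have dx: "R < norm ((quad ^^ N) (conj_quad x))" "\<And>n. n < N \<Longrightarrow> dist (orbit n x) (orbit n x0) < e / 2"
      using d(2)[of x] by (auto simp: dist_norm)
    have "chordal_dist (Some (orbit n x0)) (Some (orbit n x)) < e"
    proof (cases "n < N")
      case True
      then show ?thesis
        using dx(2)[of n] chordal_dist_le_2_dist[of "orbit n x0" "orbit n x"]
        by (simp add: dist_norm norm_minus_commute del: chordal_dist.simps)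
    next
      case False
      then have "R \<le> norm (orbit n x0)" "R \<le> norm (orbit n x)" using far N dx(1) by auto
      then show ?thesis
        using R(2)[of "orbit n x0"] R(2)[of "orbit n x"]
          chordal_dist_le_infinity[of "orbit n x0" "orbit n x"] by linarith
    qed
    then show ?thesis by (simp add: n x logi_iterate del: chordal_dist.simps)
  qed
  then show "\<exists>d>0. \<forall>f\<in>range (\<lambda>n. logi ^^ n). \<forall>q. chordal_dist (Some x0) q < d \<longrightarrow> chordal_dist (f (Some x0)) (f q) < e"
    using d'(1) by blast
qed

text \<open>By complete invariance the orbit of \<open>x0\<close> stays in the bounded complement of
  the basin, while arbitrarily close points escape. At some time the two orbits are separated by a
  fixed chordal distance.\<close>

lemma not_equicontinuous_at_boundary:
  assumes x0: "x0 \<notin> basin_plane" "x0 \<in> closure basin_plane"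
  shows "\<not> equicontinuous_at (range (\<lambda>n. logi ^^ n)) (Some x0)"
proof
  assume eq: "equicontinuous_at (range (\<lambda>n. logi ^^ n)) (Some x0)"
  obtain B where B: "0 < B" "\<And>x. B < norm x \<Longrightarrow> x \<in> basin_plane" using non_basin_bounded by blast
  have orb: "norm (orbit n x0) \<le> B" for n
  proof -
    have "conj_quad (orbit n x0) \<notin> escaping"
      using x0(1) by (simp add: conj_quad_orbit escaping_quad_iterate_iff basin_plane_def)
    then have "orbit n x0 \<notin> basin_plane" by (simp add: basin_plane_def)
    then show ?thesis using B(2) not_le by blast
  qed
  define e where "e = 1 / (2 * sqrt (1 + B\<^sup>2))"
  have "0 < e" by (simp add: e_def add_pos_nonneg)
  then obtain d where d: "0 < d" and *: "\<forall>f\<in>range (\<lambda>n. logi ^^ n).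
      \<forall>q. chordal_dist (Some x0) q < d \<longrightarrow> chordal_dist (f (Some x0)) (f q) < e"
    using eq[unfolded equicontinuous_at_def, rule_format] by metis
  obtain x where x: "x \<in> basin_plane" "dist x x0 < d / 2"
    using x0(2) d unfolding closure_approachable using half_gt_zero by blast
  have xd: "chordal_dist (Some x0) (Some x) < d"
    using chordal_dist_le_2_dist[of x0 x] x(2) by (simp add: dist_norm norm_minus_commute del: chordal_dist.simps)
  obtain n where n: "2 * B + 1 < norm ((quad ^^ n) (conj_quad x))"
    using x(1) escaping_iterates_unbounded[of "conj_quad x" "2 * B + 1"] by (auto simp: basin_plane_def)
  then have "2 * B + 1 \<le> norm (orbit n x)" using norm_orbit_ge[of n x] B(1) by linarith
  then have "e \<le> chordal_dist (Some (orbit n x0)) (Some (orbit n x))"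
    unfolding e_def using orb B by (intro chordal_dist_far) auto
  moreover have "chordal_dist (Some (orbit n x0)) (Some (orbit n x)) < e"
    using bspec[OF * rangeI[of _ n], rule_format, OF xd] by (simp add: logi_iterate del: chordal_dist.simps)
  ultimately show False by simp
qed

lemma topspace_riemann_sphere: "topspace riemann_sphere = UNIV"
  by (auto simp: UNIV_option_conv)

lemma basin_subset_fatou: "basin \<subseteq> fatou_set logi"
proof -
  have "equicontinuous_at (range (\<lambda>n. logi ^^ n)) p" if "p \<in> basin" for p
    using that equicontinuous_at_None equicontinuous_at_basin_plane by (auto simp: basin_def)
  then show ?thesis unfolding fatou_set_def using basin_openin by blast
qed

lemma fatou_closure_basin: "fatou_set logi \<inter> riemann_sphere closure_of basin \<subseteq> basin"
proof
  fix p assume p: "p \<in> fatou_set logi \<inter> riemann_sphere closure_of basin"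
  show "p \<in> basin"
  proof (cases p)
    case None
    then show ?thesis by (simp add: basin_def)
  next
    case (Some x0)
    have eq: "equicontinuous_at (range (\<lambda>n. logi ^^ n)) (Some x0)"
      using p Some by (auto simp: fatou_set_def)
    have cl: "p \<in> riemann_sphere closure_of basin" using p by blast
    have "x0 \<in> closure basin_plane"
      unfolding closure_approachable
    proof (intro allI impI)
      fix d :: real assume "0 < d"
      then have "openin riemann_sphere (Some ` ball x0 d)" "p \<in> Some ` ball x0 d"
        using Some by auto
      then obtain y where "y \<in> basin" "y \<in> Some ` ball x0 d"
        using cl unfolding in_closure_of by blast
      then show "\<exists>y\<in>basin_plane. dist y x0 < d" by (auto simp: basin_def dist_commute)
    qed
    then show ?thesis using not_equicontinuous_at_boundary[of x0] eq Some by (auto simp: basin_def)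
  qed
qed

text \<open>Within the Fatou set the basin is open and, by \<open>fatou_closure_basin\<close>,
  relatively closed. A connected subset containing infinity cannot leave it, as the basin and the
  complement of its closure would separate that subset.\<close>

lemma exterior_eq_basin: "exterior (julia_set logi) = basin"
proof -
  let ?F = "fatou_set logi"
  define C where "C = connected_component_of_set (subtopology riemann_sphere ?F) None"
  have ext: "exterior (julia_set logi) = C"
    unfolding exterior_def julia_set_def topspace_riemann_sphere C_def by (simp add: double_diff)
  have "connectedin (subtopology riemann_sphere ?F) basin"
    using basin_connectedin basin_subset_fatou by (simp add: connectedin_subtopology)
  then have "basin \<subseteq> C"
    unfolding C_def by (rule connected_component_of_maximal) (simp add: basin_def)
  moreover have "C \<subseteq> basin"
  proof (rule ccontr)
    assume nsub: "\<not> C \<subseteq> basin"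
    have conn: "connectedin riemann_sphere C" "C \<subseteq> ?F"
      using connectedin_connected_component_of[of "subtopology riemann_sphere ?F" None]
      unfolding C_def connectedin_subtopology by auto
    let ?W = "topspace riemann_sphere - riemann_sphere closure_of basin"
    have "openin riemann_sphere ?W" by (intro openin_diff openin_topspace closedin_closure_of)
    moreover have sub: "basin \<subseteq> riemann_sphere closure_of basin"
      by (rule closure_of_subset) (simp only: topspace_riemann_sphere subset_UNIV)
    moreover have "C \<subseteq> basin \<union> ?W" using conn(2) fatou_closure_basin by (auto simp: topspace_riemann_sphere)
    moreover have "basin \<inter> C \<noteq> {}" using \<open>basin \<subseteq> C\<close> by (auto simp: basin_def)
    moreover have "?W \<inter> C \<noteq> {}" using nsub calculation by blast
    moreover have "basin \<inter> ?W \<inter> C = {}" using sub by blast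
    ultimately show False using conn(1) basin_openin unfolding connectedin by blast
  qed
  ultimately show ?thesis using ext by simp
qed

lemma G_image: "Some ` G ` ball 0 1 = sphere_neg_recip ` exterior (julia_set logi)"
proof -
  have "sphere_neg_recip ` basin = Some ` G ` ball 0 1"
    unfolding basin_eq[symmetric] by (simp only: image_image sphere_neg_recip_involution)
  then show ?thesis by (simp add: exterior_eq_basin)
qed

section \<open>Linearization at the repelling fixed point\<close>

definition shifted_quad :: "complex \<Rightarrow> complex" where "shifted_quad y = of_real \<mu> * y + y\<^sup>2"

lemma quad_shift: "quad (of_real \<rho> + y) = of_real \<rho> + shifted_quad y"
  by (simp add: quad_def shifted_quad_def \<kappa>_def \<mu>_eq power2_eq_square algebra_simps)

text \<open>The n-th approximant is the n-fold iterate of \<open>shifted_quad\<close> at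
  \<open>s / \<mu> ^ n\<close>, the classical construction of the Poincare function of a repelling
  fixed point.\<close>

primrec poincare_iter :: "nat \<Rightarrow> complex \<Rightarrow> complex" where
  "poincare_iter 0 s = s"
| "poincare_iter (Suc n) s = shifted_quad (poincare_iter n (s / of_real \<mu>))"

text \<open>The largest radius for which the induction in \<open>poincare_iter_tangent\<close>
  closes: that step needs \<open>\<mu> / R0 + 4 \<le> \<mu>\<^sup>2 / R0\<close>, here an
  equality.\<close>

definition "R0 = \<mu> * (\<mu> - 1) / 4"

lemma R0_pos: "0 < R0"
  using \<mu>_bounds by (simp add: R0_def)

lemma norm_div_\<mu>: "norm (s / of_real \<mu> :: complex) = norm s / \<mu>"
  using \<mu>_bounds by (simp add: norm_divide)

lemma norm_div_\<mu>_le: "norm s \<le> R0 \<Longrightarrow> norm (s / of_real \<mu> :: complex) \<le> R0"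
proof -
  assume s: "norm s \<le> R0"
  have "norm s / \<mu> \<le> norm s / 1" using \<mu>_bounds by (intro divide_left_mono) auto
  then show ?thesis using s by (simp add: norm_div_\<mu>)
qed

lemma poincare_iter_tangent:
  assumes "norm s \<le> R0"
  shows "norm (poincare_iter n s - s) \<le> (norm s)\<^sup>2 / R0" "norm (poincare_iter n s) \<le> 2 * norm s"
proof -
  have two: "norm u \<le> 2 * norm s" if "norm (u - s) \<le> (norm s)\<^sup>2 / R0" "norm s \<le> R0" for u s :: complex
  proof -
    have "(norm s)\<^sup>2 / R0 \<le> norm s * R0 / R0"
      unfolding power2_eq_square using that R0_pos by (intro divide_right_mono mult_left_mono) auto
    then have "norm (u - s) \<le> norm s" using that R0_pos by simp
    then show ?thesis using norm_triangle_ineq[of "u - s" s] by simp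
  qed
  show main: "norm (poincare_iter n s - s) \<le> (norm s)\<^sup>2 / R0"
    using assms
  proof (induction n arbitrary: s)
    case 0
    then show ?case using R0_pos by simp
  next
    case (Suc n)
    define t where "t = s / of_real \<mu>"
    have t: "norm t \<le> R0" "norm t = norm s / \<mu>" "s = of_real \<mu> * t"
      using Suc.prems norm_div_\<mu>_le \<mu>_bounds by (auto simp: t_def norm_div_\<mu>)
    define u where "u = poincare_iter n t"
    have u: "norm (u - t) \<le> (norm t)\<^sup>2 / R0" unfolding u_def by (rule Suc.IH[OF t(1)])
    then have u2: "norm u \<le> 2 * norm t" using two t(1) by blast
    have "poincare_iter (Suc n) s - s = of_real \<mu> * (u - t) + u\<^sup>2"
      by (simp add: t(3) u_def shifted_quad_def algebra_simps) (use \<mu>_bounds in simp)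
    then have "norm (poincare_iter (Suc n) s - s) \<le> norm (of_real \<mu> * (u - t)) + norm (u\<^sup>2)"
      by (metis norm_triangle_ineq)
    also have "\<dots> = \<mu> * norm (u - t) + (norm u)\<^sup>2"
      using \<mu>_bounds by (simp add: norm_mult norm_power)
    also have "\<dots> \<le> \<mu> * ((norm t)\<^sup>2 / R0) + (2 * norm t)\<^sup>2"
      using u u2 \<mu>_bounds by (intro add_mono mult_left_mono power_mono) auto
    also have "\<dots> = (\<mu> / R0 + 4) * (norm t)\<^sup>2" by (simp add: power2_eq_square field_simps)
    also have "\<mu> / R0 + 4 = \<mu>\<^sup>2 / R0"
    proof -
      have "4 * R0 = \<mu>\<^sup>2 - \<mu>" by (simp add: R0_def power2_eq_square right_diff_distrib)
      moreover have "\<mu> / R0 + 4 = (\<mu> + 4 * R0) / R0" using R0_pos by (simp add: add_divide_distrib)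
      ultimately show ?thesis by simp
    qed
    also have "\<mu>\<^sup>2 / R0 * (norm t)\<^sup>2 = (norm s)\<^sup>2 / R0" using \<mu>_bounds by (simp add: t(2) power_divide)
    finally show ?case .
  qed
  show "norm (poincare_iter n s) \<le> 2 * norm s" by (rule two[OF main assms])
qed

text \<open>Rescaling by \<open>1 / \<mu>\<close> shrinks the quadratic error by
  \<open>1 / \<mu>\<^sup>2\<close>, and one application of \<open>shifted_quad\<close> expands by at
  most \<open>2 * \<mu> - 1\<close> on the values that occur. The ratio is below 1 because
  \<open>(\<mu> - 1)\<^sup>2\<close> is positive.\<close>

lemma poincare_iter_diff:
  "norm s \<le> R0 \<Longrightarrow> norm (poincare_iter (Suc n) s - poincare_iter n s) \<le> ((2 * \<mu> - 1) / \<mu>\<^sup>2) ^ n * (norm s)\<^sup>2"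
proof (induction n arbitrary: s)
  case 0
  have "poincare_iter 1 s - poincare_iter 0 s = (s / of_real \<mu>)\<^sup>2"
    using \<mu>_bounds by (simp add: shifted_quad_def)
  then have "norm (poincare_iter 1 s - poincare_iter 0 s) = (norm s)\<^sup>2 / \<mu>\<^sup>2"
    by (simp only: norm_power norm_divide norm_of_real power_divide power2_abs)
  also have "\<dots> \<le> (norm s)\<^sup>2 / 1" using \<mu>_bounds by (intro divide_left_mono) (auto intro: one_le_power)
  finally show ?case by simp
next
  case (Suc n)
  define t where "t = s / of_real \<mu>"
  have t: "norm t \<le> R0" "norm t = norm s / \<mu>"
    using Suc.prems norm_div_\<mu>_le by (auto simp: t_def norm_div_\<mu>)
  define u v where "u = poincare_iter (Suc n) t" and "v = poincare_iter n t"
  have "norm u \<le> 2 * norm t" "norm v \<le> 2 * norm t"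
    unfolding u_def v_def by (intro poincare_iter_tangent t)+
  moreover have "2 * norm t \<le> (\<mu> - 1) / 2"
    using Suc.prems \<mu>_bounds by (simp add: t(2) R0_def field_simps)
  ultimately have uv: "norm u \<le> (\<mu> - 1) / 2" "norm v \<le> (\<mu> - 1) / 2" by auto
  have "norm (of_real \<mu> + (u + v)) \<le> \<mu> + (norm u + norm v)"
    using \<mu>_bounds by (intro order_trans[OF norm_triangle_ineq] add_mono norm_triangle_ineq) auto
  also have "\<dots> \<le> \<mu> + ((\<mu> - 1) / 2 + (\<mu> - 1) / 2)" by (intro add_mono order_refl uv)
  also have "\<dots> = 2 * \<mu> - 1" by (simp add: field_simps)
  finally have c: "norm (of_real \<mu> + (u + v)) \<le> 2 * \<mu> - 1" .
  have "poincare_iter (Suc (Suc n)) s - poincare_iter (Suc n) s = (of_real \<mu> + (u + v)) * (u - v)"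
    unfolding poincare_iter.simps(2)[of "Suc n" s] poincare_iter.simps(2)[of n s] t_def[symmetric]
      u_def[symmetric] v_def[symmetric]
    by (simp add: shifted_quad_def power2_eq_square algebra_simps)
  then have "norm (poincare_iter (Suc (Suc n)) s - poincare_iter (Suc n) s)
      = norm (of_real \<mu> + (u + v)) * norm (u - v)"
    by (simp only: norm_mult)
  also have "\<dots> \<le> (2 * \<mu> - 1) * (((2 * \<mu> - 1) / \<mu>\<^sup>2) ^ n * (norm t)\<^sup>2)"
    using c \<mu>_bounds Suc.IH[OF t(1)] unfolding u_def v_def by (intro mult_mono) auto
  also have "\<dots> = ((2 * \<mu> - 1) / \<mu>\<^sup>2) ^ Suc n * (norm s)\<^sup>2"
    by (simp add: t(2) power_divide mult_ac)
  finally show ?case .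
qed

definition "poincare s = lim (\<lambda>n. poincare_iter n s)"

lemma poincare_uniform_limit: "uniform_limit (cball 0 R0) poincare_iter poincare sequentially"
  unfolding poincare_def[abs_def]
proof (rule summable_geometric_uniform_limit)
  fix n and s :: complex assume "s \<in> cball 0 R0"
  then have s: "norm s \<le> R0" by simp
  have "norm (poincare_iter (Suc n) s - poincare_iter n s) \<le> ((2 * \<mu> - 1) / \<mu>\<^sup>2) ^ n * (norm s)\<^sup>2"
    by (rule poincare_iter_diff[OF s])
  also have "\<dots> \<le> ((2 * \<mu> - 1) / \<mu>\<^sup>2) ^ n * R0\<^sup>2"
    using s \<mu>_bounds by (intro mult_left_mono power_mono zero_le_power divide_nonneg_nonneg) auto
  finally show "norm (poincare_iter (Suc n) s - poincare_iter n s) \<le> R0\<^sup>2 * ((2 * \<mu> - 1) / \<mu>\<^sup>2) ^ n"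
    by (simp add: mult.commute)
next
  have "0 < (\<mu> - 1)\<^sup>2" using \<mu>_bounds by simp
  then have "2 * \<mu> - 1 < \<mu>\<^sup>2" by (simp add: power2_eq_square algebra_simps)
  then show "(2 * \<mu> - 1) / \<mu>\<^sup>2 < 1" using \<mu>_bounds by simp
qed (use \<mu>_bounds in simp)

lemma poincare_iter_holomorphic: "poincare_iter n holomorphic_on UNIV"
proof (induction n)
  case (Suc n)
  have "(\<lambda>s. poincare_iter n (s / of_real \<mu>)) holomorphic_on UNIV"
    by (rule holomorphic_on_compose_gen[OF _ Suc, unfolded o_def])
       (use \<mu>_bounds in \<open>auto intro!: holomorphic_intros\<close>)
  then show ?case by (auto simp: shifted_quad_def intro!: holomorphic_intros)
qed (simp add: holomorphic_on_id[unfolded id_def])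

lemma poincare_holomorphic: "poincare holomorphic_on ball 0 R0"
  and poincare_continuous: "continuous_on (cball 0 R0) poincare"
proof -
  have "continuous_on (cball 0 R0) (poincare_iter n) \<and> poincare_iter n holomorphic_on ball 0 R0" for n
    using holomorphic_on_subset[OF poincare_iter_holomorphic] holomorphic_on_imp_continuous_on by blast
  then show "poincare holomorphic_on ball 0 R0" "continuous_on (cball 0 R0) poincare"
    using holomorphic_uniform_limit[OF _ poincare_uniform_limit] by auto
qed

lemma poincare_tangent:
  assumes "norm s \<le> R0"
  shows "norm (poincare s - s) \<le> (norm s)\<^sup>2 / R0" "norm (poincare s) \<le> 2 * norm s"
proof -
  have lim: "(\<lambda>n. poincare_iter n s) \<longlonglongrightarrow> poincare s"
    using tendsto_uniform_limitI[OF poincare_uniform_limit] assms by simp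
  show "norm (poincare s - s) \<le> (norm s)\<^sup>2 / R0"
    by (rule tendsto_upperbound[OF tendsto_norm[OF tendsto_diff[OF lim tendsto_const]]])
       (intro sequentially_bot always_eventually allI poincare_iter_tangent assms)+
  show "norm (poincare s) \<le> 2 * norm s"
    by (rule tendsto_upperbound[OF tendsto_norm[OF lim]])
       (intro sequentially_bot always_eventually allI poincare_iter_tangent assms)+
qed

lemma poincare_0: "poincare 0 = 0"
  using poincare_tangent(2)[of 0] R0_pos by simp

lemma poincare_deriv_0: "(poincare has_field_derivative 1) (at 0)"
  unfolding DERIV_def
proof (rule LIM_zero_cancel, rule Lim_null_comparison)
  show "\<forall>\<^sub>F s in at 0. norm ((poincare (0 + s) - poincare 0) / s - 1) \<le> norm s / R0"
    unfolding eventually_at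
  proof (intro exI[of _ R0] conjI ballI impI R0_pos)
    fix s :: complex assume s: "s \<noteq> 0 \<and> dist s 0 < R0"
    have "norm ((poincare (0 + s) - poincare 0) / s - 1) = norm (poincare s - s) / norm s"
      using s by (simp add: poincare_0 diff_divide_distrib norm_divide[symmetric])
    also have "\<dots> \<le> (norm s)\<^sup>2 / R0 / norm s"
      using s by (intro divide_right_mono poincare_tangent) auto
    also have "\<dots> = norm s / R0" using s by (simp add: power2_eq_square)
    finally show "norm ((poincare (0 + s) - poincare 0) / s - 1) \<le> norm s / R0" .
  qed
  have "((\<lambda>s :: complex. norm s / R0) \<longlongrightarrow> norm (0 :: complex) / R0) (at 0)"
    by (intro tendsto_intros) (use R0_pos in auto)
  then show "((\<lambda>s :: complex. norm s / R0) \<longlongrightarrow> 0) (at 0)" by simp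
qed

section \<open>The blow-up limit at 1, in the half-plane coordinate\<close>

definition "E0 y = E (exp (- y))"

lemma E0_double: "0 \<le> Re y \<Longrightarrow> E0 (2 * y) = quad (E0 y)"
  using E_power2[of "exp (- y)"] by (simp add: E0_def exp_double[symmetric])

lemma E0_double_shift: "0 \<le> Re y \<Longrightarrow> E0 (2 * y) - of_real \<rho> = shifted_quad (E0 y - of_real \<rho>)"
  using quad_shift[of "E0 y - of_real \<rho>"] E0_double[of y] by simp

text \<open>\<open>E z - E 1 = E z * E 1 * (h 1 - h z)\<close> transfers the Hoelder bound from
  \<open>h\<close>. In the exponential, 8 bounds \<open>norm (q z)\<close> through
  \<open>q 0 = 0\<close>, and \<open>Y\<close> comes from the factor \<open>1 / z\<close>.\<close>

lemma E0_hoelder: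
  assumes "0 \<le> Re y" "norm y \<le> Y"
  shows "norm (E0 y - of_real \<rho>) \<le> 32 * exp (8 + Y) * norm y powr \<beta>"
proof -
  define z where "z = exp (- y)"
  have z: "norm z \<le> 1" "z \<noteq> 0" using assms by (auto simp: z_def)
  have "norm (q z) \<le> 8 * norm (z - 0) powr \<beta>"
    using q_hoelder[OF z(1), of 0] by (simp add: q_0)
  also have "\<dots> \<le> 8 * 1 powr \<beta>" using z \<beta>_bounds by (intro mult_left_mono powr_mono2) auto
  finally have "Re (- q z) \<le> 8" using complex_Re_le_cmod[of "- q z"] by simp
  moreover have "Re y \<le> Y" using assms complex_Re_le_cmod[of y] by linarith
  ultimately have Ez: "norm (E z) \<le> exp (8 + Y)"
    by (simp add: E_def h_def norm_inverse norm_mult z_def exp_minus[symmetric] exp_add[symmetric])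
  have "norm (1 - z) \<le> 1 * norm (0 - y)"
  proof -
    have "norm (exp (- 0) - exp (- y)) \<le> 1 * norm (0 - y)"
    proof (rule field_differentiable_bound)
      show "convex {y. 0 \<le> Re y}" by (rule convex_halfspace_Re_ge)
      show "((\<lambda>y. exp (- y)) has_field_derivative - exp (- y)) (at y within {y. 0 \<le> Re y})" for y
        by (auto intro!: derivative_eq_intros)
    qed (use assms in auto)
    then show ?thesis by (simp add: z_def)
  qed
  then have "norm (1 - z) powr \<beta> \<le> norm y powr \<beta>" using \<beta>_bounds by (intro powr_mono2) auto
  then have hz: "norm (h 1 - h z) \<le> 32 * norm y powr \<beta>"
    using h_hoelder[OF _ z(1), of 1] by simp
  have "E z - E 1 = E z * E 1 * (h 1 - h z)" using z by (simp add: E_def field_simps)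
  then have "norm (E0 y - of_real \<rho>) = norm (E z) * norm (E 1) * norm (h 1 - h z)"
    by (simp only: E0_def z_def[symmetric] E_1[symmetric] norm_mult)
  also have "\<dots> \<le> exp (8 + Y) * 1 * (32 * norm y powr \<beta>)"
    using Ez hz \<rho>_bounds by (intro mult_mono) (auto simp: E_1)
  finally show ?thesis by simp
qed

definition "blowup n y = of_real (\<mu> ^ n) * (E0 (y / 2 ^ n) - of_real \<rho>)"

lemma blowup_double: "blowup (Suc n) (2 * y) = of_real \<mu> * blowup n y"
  by (simp add: blowup_def)

text \<open>The bound is uniform in \<open>n\<close>: the Hoelder estimate at
  \<open>y / 2 ^ n\<close> gains \<open>(2 ^ n) powr \<beta> = \<mu> ^ n\<close>, which cancels the
  rescaling.\<close>

lemma blowup_bound: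
  assumes "0 \<le> Re y" "norm y \<le> Y"
  shows "norm (blowup n y) \<le> 32 * exp (8 + Y) * norm y powr \<beta>"
proof -
  have Re: "0 \<le> Re (y / 2 ^ n)"
    using assms by (simp add: Re_divide_power2)
  have n: "norm (y / 2 ^ n) = norm y / 2 ^ n" by (simp add: norm_divide norm_power)
  have "norm y / 2 ^ n \<le> norm y / 1" by (intro divide_left_mono) auto
  then have Y: "norm (y / 2 ^ n) \<le> Y" using assms n by simp
  have "(2 ^ n) powr \<beta> = (2 powr \<beta>) ^ n"
    by (simp add: powr_powr mult.commute flip: powr_realpow)
  then have "norm (y / 2 ^ n) powr \<beta> = norm y powr \<beta> / \<mu> ^ n"
    by (simp add: n powr_divide two_powr_\<beta>)
  moreover have "norm (E0 (y / 2 ^ n) - of_real \<rho>) \<le> 32 * exp (8 + Y) * norm (y / 2 ^ n) powr \<beta>"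
    by (rule E0_hoelder[OF Re Y])
  moreover have "norm (blowup n y) = \<mu> ^ n * norm (E0 (y / 2 ^ n) - of_real \<rho>)"
    using \<mu>_bounds by (simp add: blowup_def norm_mult norm_power)
  moreover have "0 < \<mu> ^ n" using \<mu>_bounds by simp
  ultimately show ?thesis by (simp add: field_simps)
qed

text \<open>The linear part of \<open>shifted_quad\<close> cancels in the difference, leaving
  \<open>\<mu> ^ n\<close> times the square of an error of order
  \<open>1 / \<mu> ^ n\<close>.\<close>

lemma blowup_diff:
  assumes "0 \<le> Re y" "norm y \<le> Y"
  shows "norm (blowup (Suc n) y - blowup n y) \<le> (32 * exp (8 + Y) * Y powr \<beta>)\<^sup>2 * (1 / \<mu>) ^ n"
proof -
  define e where "e = E0 (y / 2 ^ Suc n) - of_real \<rho>"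
  have Re: "0 \<le> Re (y / 2 ^ Suc n)"
    using assms unfolding Re_divide_power2 by simp
  have "2 * (y / 2 ^ Suc n) = y / 2 ^ n" by simp
  then have "E0 (y / 2 ^ n) - of_real \<rho> = shifted_quad e"
    using E0_double_shift[OF Re] by (simp add: e_def)
  then have "blowup n y = of_real (\<mu> ^ n) * shifted_quad e" by (simp add: blowup_def)
  moreover have b: "blowup (Suc n) y = of_real (\<mu> ^ n) * (of_real \<mu> * e)" by (simp add: blowup_def e_def)
  ultimately have "blowup (Suc n) y - blowup n y = - (of_real (\<mu> ^ n) * e\<^sup>2)"
    by (simp add: shifted_quad_def algebra_simps)
  then have "norm (blowup (Suc n) y - blowup n y) = \<mu> ^ n * (norm e)\<^sup>2"
    using \<mu>_bounds by (simp add: norm_mult norm_power)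
  also have "\<dots> = (norm (blowup (Suc n) y))\<^sup>2 / \<mu> ^ n / \<mu>\<^sup>2"
  proof -
    have "norm (blowup (Suc n) y) = \<mu> ^ n * (\<mu> * norm e)"
      using \<mu>_bounds by (simp add: b norm_mult norm_power)
    then show ?thesis using \<mu>_bounds by (simp add: power2_eq_square)
  qed
  also have "\<dots> \<le> (norm (blowup (Suc n) y))\<^sup>2 / \<mu> ^ n / 1"
    using \<mu>_bounds by (intro divide_left_mono) (auto intro!: one_le_power)
  also have "\<dots> \<le> (32 * exp (8 + Y) * Y powr \<beta>)\<^sup>2 / \<mu> ^ n"
  proof -
    have "norm (blowup (Suc n) y) \<le> 32 * exp (8 + Y) * norm y powr \<beta>" by (rule blowup_bound[OF assms])
    also have "\<dots> \<le> 32 * exp (8 + Y) * Y powr \<beta>"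
      using assms \<beta>_bounds by (intro mult_left_mono powr_mono2) auto
    finally show ?thesis using \<mu>_bounds by (simp add: divide_right_mono power_mono)
  qed
  finally show ?thesis by (simp add: power_divide)
qed

definition "S y = lim (\<lambda>n. blowup n y)"

lemma blowup_uniform_limit: "uniform_limit {y. 0 \<le> Re y \<and> norm y \<le> Y} blowup S sequentially"
  unfolding S_def[abs_def]
  by (rule summable_geometric_uniform_limit) (use blowup_diff \<mu>_bounds in auto)

lemma blowup_tendsto: "0 \<le> Re y \<Longrightarrow> (\<lambda>n. blowup n y) \<longlonglongrightarrow> S y"
  using tendsto_uniform_limitI[OF blowup_uniform_limit[of "norm y"]] by simp

lemma norm_S:
  assumes "0 \<le> Re y" "norm y \<le> Y"
  shows "norm (S y) \<le> 32 * exp (8 + Y) * norm y powr \<beta>"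
  by (rule tendsto_upperbound[OF tendsto_norm[OF blowup_tendsto[OF assms(1)]]])
     (use blowup_bound[OF assms] in auto)

lemma S_double: assumes "0 \<le> Re y" shows "S (2 * y) = of_real \<mu> * S y"
proof (rule LIMSEQ_unique)
  show "(\<lambda>n. blowup (Suc n) (2 * y)) \<longlonglongrightarrow> S (2 * y)"
    using assms by (intro LIMSEQ_Suc blowup_tendsto) simp
  show "(\<lambda>n. blowup (Suc n) (2 * y)) \<longlonglongrightarrow> of_real \<mu> * S y"
    unfolding blowup_double using assms by (intro tendsto_intros blowup_tendsto)
qed

lemma E0_holomorphic: "E0 holomorphic_on {y. 0 < Re y}"
  unfolding E0_def[abs_def]
  by (rule holomorphic_on_compose_gen[OF _ E_holomorphic, unfolded o_def])
     (auto intro!: holomorphic_intros)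

lemma blowup_holomorphic: "blowup n holomorphic_on {y. 0 < Re y}"
proof -
  have "(\<lambda>y. E0 (y / 2 ^ n)) holomorphic_on {y. 0 < Re y}"
    by (rule holomorphic_on_compose_gen[OF _ E0_holomorphic, unfolded o_def])
       (auto intro!: holomorphic_intros simp: Re_divide_power2)
  then show ?thesis unfolding blowup_def[abs_def] by (intro holomorphic_intros)
qed

lemma S_holomorphic: "S holomorphic_on {y. 0 < Re y}"
proof (rule holomorphic_uniform_sequence[OF _ blowup_holomorphic])
  show op: "open {y. 0 < Re y}" by (rule open_halfspace_Re_gt)
  fix x assume "x \<in> {y. 0 < Re y}"
  then obtain d where d: "d > 0" "cball x d \<subseteq> {y. 0 < Re y}"
    using op open_contains_cball by blast
  have "cball x d \<subseteq> {y. 0 \<le> Re y \<and> norm y \<le> norm x + d}"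
  proof
    fix y assume y: "y \<in> cball x d"
    have "norm y \<le> norm x + norm (y - x)" using norm_triangle_ineq[of x "y - x"] by simp
    then show "y \<in> {y. 0 \<le> Re y \<and> norm y \<le> norm x + d}"
      using y d by (auto simp: dist_norm norm_minus_commute less_imp_le)
  qed
  then have "uniform_limit (cball x d) blowup S sequentially"
    by (rule uniform_limit_on_subset[OF blowup_uniform_limit])
  then show "\<exists>d>0. cball x d \<subseteq> {y. 0 < Re y} \<and> uniform_limit (cball x d) blowup S sequentially"
    using d by blast
qed

lemma E0_real: "0 \<le> x \<Longrightarrow> E0 (of_real x) \<in> \<real>"
proof -
  assume x: "0 \<le> x"
  define r where "r = exp (- x)"
  have r: "exp (- complex_of_real x) = of_real r" by (simp add: r_def flip: exp_of_real)
  have "q (of_real r) \<in> \<real>" by (rule q_real) (use x in \<open>auto simp: r_def\<close>)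
  then have "exp (q (of_real r)) \<in> \<real>" by (metis Reals_cases Reals_of_real exp_of_real)
  then show ?thesis by (simp add: E0_def E_def h_def r)
qed

lemma S_real: "0 \<le> x \<Longrightarrow> S (of_real x) \<in> \<real>"
proof -
  assume x: "0 \<le> x"
  have "blowup n (of_real x) \<in> \<real>" for n
  proof -
    have "complex_of_real x / 2 ^ n = of_real (x / 2 ^ n)" by simp
    then show ?thesis unfolding blowup_def using x by (auto intro!: E0_real Reals_mult Reals_diff simp del: of_real_divide)
  qed
  then show ?thesis
    by (intro Lim_in_closed_set[OF closed_complex_Reals _ _ blowup_tendsto]) (use x in auto)
qed

text \<open>Exact for every \<open>n\<close>: iterating \<open>shifted_quad\<close> reverses the n
  halvings of the argument, and the rescalings cancel.\<close>

lemma poincare_iter_blowup: "0 \<le> Re y \<Longrightarrow> poincare_iter n (blowup n y) = E0 y - of_real \<rho>"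
proof (induction n arbitrary: y)
  case 0
  then show ?case by (simp add: blowup_def)
next
  case (Suc n)
  have "blowup (Suc n) y / of_real \<mu> = blowup n (y / 2)"
    using blowup_double[of n "y / 2"] \<mu>_bounds by simp
  moreover have "0 \<le> Re (y / 2)" using Suc.prems by simp
  ultimately show ?case using Suc.IH[of "y / 2"] E0_double_shift[of "y / 2"] by simp
qed

text \<open>In the identity at level \<open>n\<close> both the function and its argument depend on
  \<open>n\<close>. Uniform convergence of the approximants handles the function, continuity of
  \<open>poincare\<close> the argument. The exponent 9 is \<open>8 + Y\<close> with
  \<open>Y = 1\<close>.\<close>

lemma E0_poincare:
  assumes "0 \<le> Re y" "norm y \<le> 1" "32 * exp 9 * norm y powr \<beta> < R0"
  shows "E0 y - of_real \<rho> = poincare (S y)" "norm (S y) < R0"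
proof -
  have b: "norm (blowup n y) < R0" for n
    using blowup_bound[OF assms(1,2), of n] assms(3) by simp
  show Sy: "norm (S y) < R0" using norm_S[OF assms(1,2)] assms(3) by simp
  have "isCont poincare (S y)"
    using Sy by (intro continuous_on_interior[OF poincare_continuous]) auto
  then have "(\<lambda>n. poincare (blowup n y)) \<longlonglongrightarrow> poincare (S y)"
    using blowup_tendsto[OF assms(1)] isCont_tendsto_compose by blast
  moreover have "(\<lambda>n. (E0 y - of_real \<rho>) - poincare (blowup n y)) \<longlonglongrightarrow> 0"
  proof (rule tendstoI)
    fix e :: real assume "0 < e"
    then have "\<forall>\<^sub>F n in sequentially. \<forall>s\<in>cball 0 R0. dist (poincare_iter n s) (poincare s) < e"
      using poincare_uniform_limit uniform_limitD by blast
    then show "\<forall>\<^sub>F n in sequentially. dist ((E0 y - of_real \<rho>) - poincare (blowup n y)) 0 < e"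
    proof eventually_elim
      case (elim n)
      then have "dist (poincare_iter n (blowup n y)) (poincare (blowup n y)) < e"
        using b[of n] by (auto simp: less_imp_le)
      then show ?case by (simp add: poincare_iter_blowup[OF assms(1)] dist_norm)
    qed
  qed
  ultimately have "(\<lambda>n. poincare (blowup n y) + ((E0 y - of_real \<rho>) - poincare (blowup n y)))
      \<longlonglongrightarrow> poincare (S y) + 0"
    by (rule tendsto_add)
  then show "E0 y - of_real \<rho> = poincare (S y)" by (simp add: LIMSEQ_const_iff)
qed

lemma E0_poincare_near_0:
  assumes "0 < e" "e \<le> R0"
  obtains \<epsilon> where "0 < \<epsilon>" "\<epsilon> \<le> 1"
    "\<And>y. 0 \<le> Re y \<Longrightarrow> norm y < \<epsilon> \<Longrightarrow> E0 y - of_real \<rho> = poincare (S y) \<and> norm (S y) < e"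
proof -
  have "((\<lambda>x :: real. 32 * exp 9 * x powr \<beta>) \<longlongrightarrow> 32 * exp 9 * 0 powr \<beta>) (at_right 0)"
    using \<beta>_bounds by (intro tendsto_intros tendsto_powr') (auto simp: eventually_at_right_less intro!: eventually_at_rightI[of 0 1])
  then have "\<forall>\<^sub>F x in at_right 0. 32 * exp 9 * x powr \<beta> < e"
    using assms by (intro order_tendstoD(2)) auto
  then obtain b where b: "b > 0" "\<And>x. 0 < x \<Longrightarrow> x < b \<Longrightarrow> 32 * exp 9 * x powr \<beta> < e"
    unfolding eventually_at_right_field by auto
  show ?thesis
  proof (rule that[of "min b 1"])
    fix y :: complex assume y: "0 \<le> Re y" "norm y < min b 1"
    have "32 * exp 9 * norm y powr \<beta> < e"
      using b(2)[of "norm y"] y assms by (cases "y = 0") auto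
    then show "E0 y - of_real \<rho> = poincare (S y) \<and> norm (S y) < e"
      using E0_poincare[of y] norm_S[of y 1] y assms by auto
  qed (use b in auto)
qed

section \<open>Dyadic roots of unity and the natural boundary\<close>

lemma dyadic_root_near:
  fixes \<zeta> :: complex
  assumes "norm \<zeta> = 1" "0 < r"
  obtains \<omega> n where "\<omega> ^ (2 ^ n) = 1" "norm \<omega> = 1" "norm (\<omega> - \<zeta>) < r"
proof -
  define \<theta> where "\<theta> = Arg \<zeta>"
  have \<zeta>: "\<zeta> = exp (\<i> * of_real \<theta>)"
  proof -
    have "\<zeta> \<noteq> 0" using assms(1) by auto
    then show ?thesis using assms(1) Arg_eq[of \<zeta>] by (simp add: \<theta>_def)
  qed
  obtain n where n: "2 * pi / r < 2 ^ n" using real_arch_pow[of 2 "2 * pi / r"] by auto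
  define j where "j = \<lfloor>\<theta> * 2 ^ n / (2 * pi)\<rfloor>"
  define \<alpha> where "\<alpha> = 2 * pi * of_int j / 2 ^ n"
  have "of_int j \<le> \<theta> * 2 ^ n / (2 * pi)" "\<theta> * 2 ^ n / (2 * pi) < of_int j + 1"
    unfolding j_def by linarith+
  then have j: "\<bar>of_int j - \<theta> * 2 ^ n / (2 * pi)\<bar> \<le> 1" by linarith
  have \<alpha>\<theta>: "\<alpha> - \<theta> = 2 * pi / 2 ^ n * (of_int j - \<theta> * 2 ^ n / (2 * pi))"
    by (simp add: \<alpha>_def field_simps)
  have "\<bar>\<alpha> - \<theta>\<bar> = \<bar>2 * pi / 2 ^ n\<bar> * \<bar>of_int j - \<theta> * 2 ^ n / (2 * pi)\<bar>"
    unfolding \<alpha>\<theta> abs_mult ..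
  also have "\<dots> \<le> \<bar>2 * pi / 2 ^ n\<bar> * 1" by (intro mult_left_mono j) auto
  finally have "\<bar>\<alpha> - \<theta>\<bar> \<le> 2 * pi / 2 ^ n" by simp
  also have "\<dots> < r" using n assms(2) by (simp add: field_simps)
  finally have d: "\<bar>\<alpha> - \<theta>\<bar> < r" .
  have "norm (exp (\<i> * of_real \<alpha>) - exp (\<i> * of_real \<theta>)) \<le> \<bar>\<alpha> - \<theta>\<bar>"
  proof -
    have "exp (\<i> * of_real \<alpha>) - exp (\<i> * of_real \<theta>)
        = exp (\<i> * of_real \<theta>) * (exp (\<i> * of_real (\<alpha> - \<theta>)) - 1)"
      by (simp add: algebra_simps flip: exp_add)
    then show ?thesis
      using norm_exp_i_times[of \<theta>] dist_exp_i_1[of "\<alpha> - \<theta>"] abs_sin_x_le_abs_x[of "(\<alpha> - \<theta>) / 2"]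
      by (simp add: norm_mult)
  qed
  moreover have "exp (\<i> * of_real \<alpha>) ^ (2 ^ n) = 1"
  proof -
    have "exp (\<i> * of_real \<alpha>) ^ (2 ^ n) = exp (of_nat (2 ^ n) * (\<i> * of_real \<alpha>))"
      by (rule exp_of_nat_mult[symmetric])
    also have "of_nat (2 ^ n) * (\<i> * of_real \<alpha>) = of_int (2 * j) * (of_real pi * \<i>)"
      by (simp add: \<alpha>_def)
    finally show ?thesis by (simp add: exp_eq_1) 
  qed
  ultimately show ?thesis using d that[of "exp (\<i> * of_real \<alpha>)" n] \<zeta> by auto
qed

lemma G_continuous: "continuous_on (cball 0 1) G"
proof -
  have "continuous_on (cball 0 1) h"
    unfolding h_def[abs_def] by (intro continuous_intros q_continuous)
  then show ?thesis
    unfolding G_def[abs_def] using G_denominator by (intro continuous_intros) auto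
qed

lemma quad_iterate_holomorphic: "(quad ^^ n) holomorphic_on UNIV"
proof (induction n)
  case (Suc n)
  then show ?case by (simp add: o_def quad_def) (intro holomorphic_intros)
qed (simp add: holomorphic_on_id)

text \<open>A continuation across a boundary point gives one across a dyadic root of unity, which the
  functional equation moves to 1. There \<open>E0\<close> would be Lipschitz, while the renormalisation factor
  is less than 2, so the blow-up limit \<open>S\<close> would vanish and \<open>E0\<close> would be constant.\<close>

lemma G_barrier: "barrier_of_singularities G (ball 0 1)"
  unfolding barrier_of_singularities_def
proof (intro ballI notI)
  fix \<zeta> :: complex assume "\<zeta> \<in> frontier (ball 0 1)" "continues_across G (ball 0 1) \<zeta>"
  then obtain r g where \<zeta>: "norm \<zeta> = 1" and r: "0 < r" "g holomorphic_on ball \<zeta> r"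
      "\<And>z. z \<in> ball \<zeta> r \<Longrightarrow> norm z < 1 \<Longrightarrow> g z = G z"
    unfolding continues_across_def by (auto simp: dist_norm)
  obtain \<omega> n where \<omega>: "\<omega> ^ (2 ^ n) = 1" "norm \<omega> = 1" "norm (\<omega> - \<zeta>) < r"
    using dyadic_root_near[OF \<zeta> r(1)] by blast
  have \<omega>r: "\<omega> \<in> ball \<zeta> r" using \<omega> by (simp add: dist_norm norm_minus_commute)
  define w where "w y = \<omega> * exp (- (y / 2 ^ n))" for y :: complex
  have w0: "w 0 = \<omega>" by (simp add: w_def)
  have w_norm: "norm (w y) < 1" if "0 < Re y" for y
    using that \<omega> by (simp add: w_def norm_mult Re_divide_power2)
  have w_deriv: "(w has_field_derivative - \<omega> / 2 ^ n) (at 0)"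
    unfolding w_def[abs_def] by (auto intro!: derivative_eq_intros)
  have w_nz: "w y \<noteq> 0" for y using \<omega> by (auto simp: w_def)
  have w_pow: "w y ^ (2 ^ n) = exp (- y)" for y
  proof -
    have "w y ^ (2 ^ n) = exp (- (y / 2 ^ n)) ^ (2 ^ n)" by (simp add: w_def power_mult_distrib \<omega>)
    also have "\<dots> = exp (of_nat (2 ^ n) * (- (y / 2 ^ n)))" by (rule exp_of_nat_mult[symmetric])
    finally show ?thesis by simp
  qed
  define x where "x m = complex_of_real (1 / 2 ^ m)" for m :: nat
  have x0: "x \<longlonglongrightarrow> 0"
    unfolding x_def[abs_def]
    using tendsto_of_real[OF LIMSEQ_divide_realpow_zero[of 2 1], where 'a = complex] by simp
  have xpos: "0 < Re (x m)" "x m \<noteq> 0" for m by (auto simp: x_def)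
  have wx: "(\<lambda>m. w (x m)) \<longlonglongrightarrow> \<omega>"
    using isCont_tendsto_compose[OF DERIV_isCont[OF w_deriv] x0] w0 by simp
  have evx: "\<forall>\<^sub>F m in sequentially. w (x m) \<in> ball \<zeta> r"
    using wx \<omega>r by (intro topological_tendstoD) auto
  have t1: "(\<lambda>m. g (w (x m))) \<longlonglongrightarrow> g \<omega>"
    using holomorphic_on_imp_continuous_on[OF r(2)] \<omega>r wx
    by (intro isCont_tendsto_compose[of \<omega> g]) (simp_all add: continuous_on_eq_continuous_at)
  have t2: "(\<lambda>m. G (w (x m))) \<longlonglongrightarrow> G \<omega>"
    by (rule continuous_on_tendsto_compose[OF G_continuous wx])
       (use \<omega> w_norm xpos in \<open>auto intro!: always_eventually simp: less_imp_le\<close>)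
  have "\<forall>\<^sub>F m in sequentially. g (w (x m)) = G (w (x m))"
    using evx by eventually_elim (use r(3) w_norm xpos in auto)
  from Lim_transform_eventually[OF t1 this] have g\<omega>: "g \<omega> = G \<omega>"
    by (rule LIMSEQ_unique[OF _ t2])
  have \<omega>0: "\<omega> \<noteq> 0" using \<omega> by auto
  have G\<omega>: "G \<omega> \<noteq> 0" "E \<omega> = of_real a / G \<omega> + of_real a / 2" using G_eq_E[of \<omega>] \<omega> \<omega>0 by auto
  \<comment> \<open>The formula that recovers \<open>E\<close> from \<open>G\<close>, followed by
    \<open>n\<close> applications of \<open>quad\<close>, which carry \<open>\<omega>\<close> to 1.
    It makes \<open>e\<close> differentiable at 0 and equal to \<open>E0\<close> near 0 in the right
    half-plane.\<close>
  define e where "e y = (quad ^^ n) (of_real a / g (w y) + of_real a / 2)" for y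
  obtain g' where "(g has_field_derivative g') (at \<omega>)"
    using holomorphic_derivI[OF r(2) _ \<omega>r] by auto
  then have "((\<lambda>y. g (w y)) has_field_derivative g' * (- \<omega> / 2 ^ n)) (at 0)"
    using w_deriv w0 by (intro DERIV_chain2) auto
  then have inner: "((\<lambda>y. of_real a / g (w y) + of_real a / 2) has_field_derivative
       - (of_real a * (g' * (- \<omega> / 2 ^ n))) / (G \<omega> * G \<omega>)) (at 0)"
    using G\<omega> g\<omega> w0 by (auto intro!: derivative_eq_intros)
  obtain D where "((quad ^^ n) has_field_derivative D) (at (of_real a / g (w 0) + of_real a / 2))"
    using holomorphic_derivI[OF quad_iterate_holomorphic] by (metis UNIV_I open_UNIV)
  from DERIV_chain2[OF this inner] have "\<exists>D. (e has_field_derivative D) (at 0)"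
    unfolding e_def[abs_def] by (rule exI)
  then obtain D where "(e has_field_derivative D) (at 0)" by blast
  then have quot: "((\<lambda>y. (e y - e 0) / y) \<longlongrightarrow> D) (at 0)"
    by (simp add: DERIV_def)
  have e0: "e 0 = of_real \<rho>"
    using quad_iterate_E[of \<omega> n] \<omega> \<omega>0 G\<omega> g\<omega> by (simp add: e_def w0 E_1)
  have ee: "e y = E0 y" if "0 < Re y" "w y \<in> ball \<zeta> r" for y
  proof -
    have "g (w y) = G (w y)" using r(3) that w_norm by auto
    moreover have "E (w y) = of_real a / G (w y) + of_real a / 2"
      using G_eq_E[of "w y"] w_norm[of y] w_nz that by auto
    ultimately show ?thesis
      using quad_iterate_E[of "w y" n] w_norm[of y] w_nz that by (simp add: e_def w_pow E0_def)
  qed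
  \<comment> \<open>The blow-up at level \<open>m\<close> is \<open>(\<mu> / 2) ^ m * t\<close>
    times a difference quotient of \<open>e\<close>, which converges; since \<open>\<mu> < 2\<close>
    the product tends to 0.\<close>
  have S0: "S (of_real t) = 0" if t: "0 < t" for t
  proof -
    define y where "y m = of_real t * x m" for m
    have y: "y m = of_real t / 2 ^ m" "0 < Re (y m)" "y m \<noteq> 0" for m
      using t by (auto simp: y_def x_def)
    have ylim: "y \<longlonglongrightarrow> 0" unfolding y_def[abs_def] using tendsto_mult[OF tendsto_const x0] by simp
    then have "filterlim y (at 0) sequentially"
      using y(3) by (simp add: filterlim_at)
    then have q: "(\<lambda>m. (e (y m) - e 0) / y m) \<longlonglongrightarrow> D"
      using filterlim_compose[OF quot] by blast
    have "(\<lambda>m. w (y m)) \<longlonglongrightarrow> \<omega>"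
      using isCont_tendsto_compose[OF DERIV_isCont[OF w_deriv] ylim] w0 by simp
    then have "\<forall>\<^sub>F m in sequentially. w (y m) \<in> ball \<zeta> r"
      using \<omega>r by (intro topological_tendstoD) auto
    then have ev: "\<forall>\<^sub>F m in sequentially. of_real ((\<mu> / 2) ^ m) * of_real t * ((e (y m) - e 0) / y m) = blowup m (of_real t)"
    proof eventually_elim
      case (elim m)
      then have "e (y m) = E0 (of_real t / 2 ^ m)" using ee y by metis
      then show ?case
        using t y(3)[of m] by (simp add: blowup_def e0 y(1) power_divide)
    qed
    have "(\<lambda>m. (\<mu> / 2) ^ m) \<longlonglongrightarrow> 0" by (rule LIMSEQ_power_zero) (use \<mu>_bounds in auto)
    then have "(\<lambda>m. complex_of_real ((\<mu> / 2) ^ m)) \<longlonglongrightarrow> of_real 0" by (rule tendsto_of_real)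
    then have "(\<lambda>m. of_real ((\<mu> / 2) ^ m) * of_real t * ((e (y m) - e 0) / y m)) \<longlonglongrightarrow> of_real 0 * of_real t * D"
      by (intro tendsto_mult q tendsto_const)
    then have "(\<lambda>m. blowup m (of_real t)) \<longlonglongrightarrow> 0"
      using tendsto_cong[OF ev] by simp
    then show ?thesis using blowup_tendsto[of "of_real t"] t LIMSEQ_unique by auto
  qed
  obtain \<epsilon> where \<epsilon>: "0 < \<epsilon>" "\<epsilon> \<le> 1"
    "\<And>y. 0 \<le> Re y \<Longrightarrow> norm y < \<epsilon> \<Longrightarrow> E0 y - of_real \<rho> = poincare (S y) \<and> norm (S y) < R0"
    using E0_poincare_near_0[OF R0_pos] by blast
  have const: "E0 (of_real t) = of_real \<rho>" if "0 < t" "t < \<epsilon>" for t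
    using \<epsilon>(3)[of "of_real t"] that by (simp add: S0 poincare_0)
  \<comment> \<open>Two different points with the same value \<open>\<rho>\<close> contradict
    injectivity of \<open>E\<close>.\<close>
  have "E (exp (- of_real (\<epsilon> / 2))) = E (exp (- of_real (\<epsilon> / 3)))"
    using const[of "\<epsilon> / 2"] const[of "\<epsilon> / 3"] \<epsilon>(1) by (simp add: E0_def)
  then have "exp (- complex_of_real (\<epsilon> / 2)) = exp (- complex_of_real (\<epsilon> / 3))"
    by (rule inj_onD[OF inj_on_E]) (use \<epsilon>(1) in auto)
  then have "complex_of_real (exp (- (\<epsilon> / 2))) = complex_of_real (exp (- (\<epsilon> / 3)))"
    by (simp add: exp_of_real[symmetric])
  then show False using \<epsilon>(1) by simp
qed

section \<open>Expansion near 1\<close>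

text \<open>The reciprocal of the derivative at 0 of \<open>a / (1 - a + Y)\<close> with respect to
  \<open>Y\<close>. Rescaling by it normalizes the derivative of \<open>\<Phi>\<close> at 0 to
  1.\<close>

definition "slope = - (1 - a)\<^sup>2 / a"

lemma slope_nz: "slope \<noteq> 0"
  using a_pos a_less by (simp add: slope_def)

definition "\<Phi> s = of_real a / (of_real (1 - a) + poincare (of_real slope * s))"

text \<open>\<open>R0\<close> is the radius available for \<open>poincare\<close>. The bound 1/4
  gives \<open>norm (poincare s) \<le> 1/2 < 1 - a\<close>, so the denominator of
  \<open>\<Phi>\<close> does not vanish.\<close>

definition "r\<Phi> = min R0 (1 / 4) / \<bar>slope\<bar>"

lemma r\<Phi>_pos: "0 < r\<Phi>"
  using R0_pos slope_nz by (simp add: r\<Phi>_def)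

lemma \<Phi>_denominator:
  assumes "norm s < r\<Phi>"
  shows "norm (of_real slope * s) < R0" "of_real (1 - a) + poincare (of_real slope * s) \<noteq> 0"
proof -
  have n: "norm (of_real slope * s) < min R0 (1 / 4)"
    using assms slope_nz unfolding r\<Phi>_def by (simp add: norm_mult field_simps)
  then show "norm (of_real slope * s) < R0" by simp
  then have "norm (poincare (of_real slope * s)) \<le> 2 * norm (of_real slope * s)"
    by (intro poincare_tangent) auto
  also have "\<dots> < 1 - a" using n a_less by simp
  also have "1 - a = norm (complex_of_real (1 - a))" unfolding norm_of_real using a_less by simp
  finally show "of_real (1 - a) + poincare (of_real slope * s) \<noteq> 0"
    by (metis add_eq_0_iff less_irrefl norm_minus_cancel)
qed

lemma \<Phi>_holomorphic: "\<Phi> holomorphic_on ball 0 r\<Phi>"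
proof -
  have "(\<lambda>s. poincare (of_real slope * s)) holomorphic_on ball 0 r\<Phi>"
    by (rule holomorphic_on_compose_gen[OF _ poincare_holomorphic, unfolded o_def])
       (use \<Phi>_denominator in \<open>auto intro!: holomorphic_intros\<close>)
  then show ?thesis
    unfolding \<Phi>_def[abs_def] using \<Phi>_denominator by (intro holomorphic_intros) auto
qed

lemma \<Phi>_0: "\<Phi> 0 = of_real (a / (1 - a))"
  by (simp add: \<Phi>_def poincare_0)

lemma deriv_\<Phi>_0: "deriv \<Phi> 0 = 1"
proof (rule DERIV_imp_deriv)
  define D where "D s = of_real (1 - a) + poincare (of_real slope * s)" for s
  have "((\<lambda>s. poincare (of_real slope * s)) has_field_derivative 1 * of_real slope) (at 0)"
    by (rule DERIV_chain2[of poincare]) (auto simp: poincare_deriv_0 intro!: derivative_eq_intros)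
  from DERIV_add[OF DERIV_const this] have D: "(D has_field_derivative of_real slope) (at 0)"
    unfolding D_def[abs_def] by simp
  have D0: "D 0 = of_real (1 - a)" by (simp add: D_def poincare_0)
  have "D 0 \<noteq> 0" unfolding D0 of_real_eq_0_iff using a_less by simp
  from DERIV_divide[OF DERIV_const D this]
  have "(\<Phi> has_field_derivative (0 * D 0 - of_real a * of_real slope) / (D 0 * D 0)) (at 0)"
    unfolding \<Phi>_def[abs_def] D_def[symmetric] by simp
  moreover have "(0 * D 0 - of_real a * of_real slope) / (D 0 * D 0) = complex_of_real (- (a * slope) / ((1 - a) * (1 - a)))"
    unfolding D0 by simp
  moreover have "- (a * slope) / ((1 - a) * (1 - a)) = 1"
    using a_pos a_less by (simp add: slope_def power2_eq_square)
  ultimately show "(\<Phi> has_field_derivative 1) (at 0)" by (simp only: of_real_1)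
qed

lemma G_eq_\<Phi>:
  assumes "z \<noteq> 0" "norm z < 1" "exp (- y) = z" "E0 y - of_real \<rho> = poincare (S y)"
  shows "G z = \<Phi> (S y / of_real slope)"
proof -
  have "G z = 2 * of_real a / (2 * E z - of_real a)" using G_eq_E[of z] assms by auto
  also have "E z = of_real \<rho> + poincare (S y)" using assms(3,4) by (simp add: E0_def algebra_simps)
  also have "2 * (of_real \<rho> + poincare (S y)) - of_real a = 2 * (of_real (1 - a) + poincare (S y))"
    by (simp add: \<rho>_def algebra_simps)
  also have "2 * of_real a / (2 * (of_real (1 - a) + poincare (S y))) = of_real a / (of_real (1 - a) + poincare (S y))"
    by (rule mult_divide_mult_cancel_left) simp
  finally show ?thesis using slope_nz by (simp add: \<Phi>_def)
qed

text \<open>With y = e^v this is y^(-\<beta>) S(y), up to the normalizing \<open>slope\<close>. The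
  right half-plane in y is the strip of half width \<open>pi / 2\<close> in v, and doubling y is
  translation of v by \<open>ln 2\<close>.\<close>

definition "per v = S (exp v) * exp (- of_real \<beta> * v) / of_real slope"

lemma Re_exp_strip: "\<bar>Im v\<bar> < pi / 2 \<Longrightarrow> 0 < Re (exp v)"
  by (auto simp: Re_exp intro!: mult_pos_pos cos_gt_zero_pi)

lemma per_holomorphic: "per holomorphic_on {v. \<bar>Im v\<bar> < pi / 2}"
proof -
  have "(\<lambda>v. S (exp v)) holomorphic_on {v. \<bar>Im v\<bar> < pi / 2}"
    by (rule holomorphic_on_compose_gen[OF _ S_holomorphic, unfolded o_def])
       (auto intro!: holomorphic_intros Re_exp_strip)
  then show ?thesis unfolding per_def[abs_def] using slope_nz by (intro holomorphic_intros) auto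
qed

lemma S_eq_per: "S (exp v) / of_real slope = exp (of_real \<beta> * v) * per v"
  by (simp add: per_def exp_minus)

lemma per_periodic: "\<bar>Im v\<bar> < pi / 2 \<Longrightarrow> per (v + of_real (ln 2)) = per v"
proof -
  assume v: "\<bar>Im v\<bar> < pi / 2"
  have "exp (v + of_real (ln 2)) = 2 * exp v"
    by (simp add: exp_add exp_of_real)
  then have "S (exp (v + of_real (ln 2))) = of_real \<mu> * S (exp v)"
    using S_double[of "exp v"] Re_exp_strip[OF v] by simp
  moreover have "exp (- of_real \<beta> * (v + of_real (ln 2))) = exp (- of_real \<beta> * v) / of_real \<mu>"
  proof -
    have "exp (of_real (\<beta> * ln 2)) = complex_of_real (2 powr \<beta>)"
      unfolding exp_of_real by (simp add: powr_def)
    then have "exp (of_real \<beta> * of_real (ln 2)) = complex_of_real \<mu>"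
      by (simp add: two_powr_\<beta>)
    then show ?thesis by (simp add: algebra_simps exp_diff exp_minus divide_inverse)
  qed
  ultimately show ?thesis using \<mu>_bounds by (simp add: per_def)
qed

lemma per_periodic_int: "\<bar>Im v\<bar> < pi / 2 \<Longrightarrow> per (v + of_int n * of_real (ln 2)) = per v"
proof -
  assume v: "\<bar>Im v\<bar> < pi / 2"
  have nat: "per (w + of_nat k * of_real (ln 2)) = per w" if "\<bar>Im w\<bar> < pi / 2" for w k
  proof (induction k)
    case (Suc k)
    have "per ((w + of_nat k * of_real (ln 2)) + of_real (ln 2)) = per (w + of_nat k * of_real (ln 2))"
      using that by (intro per_periodic) simp
    then show ?case using Suc by (simp add: algebra_simps)
  qed simp
  show ?thesis
  proof (cases "0 \<le> n")
    case True
    then show ?thesis using nat[OF v, of "nat n"] by simp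
  next
    case False
    have "\<bar>Im (v + of_int n * of_real (ln 2))\<bar> < pi / 2" using v by simp
    from nat[OF this, of "nat (- n)"] show ?thesis using False by simp
  qed
qed

lemma per_real: "per (of_real x) \<in> \<real>"
proof -
  have "S (exp (of_real x)) \<in> \<real>" unfolding exp_of_real by (rule S_real) simp
  moreover have "exp (- of_real \<beta> * of_real x) = complex_of_real (exp (- \<beta> * x))"
    by (simp flip: exp_of_real)
  ultimately show ?thesis unfolding per_def by (intro Reals_divide Reals_mult) auto
qed

lemma tau_eq:
  assumes "y = Ln (inverse z)" "y \<noteq> 0"
  shows "tau a z = exp (of_real \<beta> * Ln y)"
  using assms by (simp add: tau_def powr_def \<beta>_def)

text \<open>The imaginary part of \<open>Ln y\<close> is below \<open>pi / 2\<close>, and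
  multiplication by \<open>\<beta> < 1\<close> does not enlarge it, so the principal logarithm
  undoes the power.\<close>

lemma Ln_tau:
  assumes "y = Ln (inverse z)" "0 < Re y"
  shows "Ln (tau a z) = of_real \<beta> * Ln y" "\<bar>Im (Ln y)\<bar> < pi / 2"
proof -
  have y0: "y \<noteq> 0" using assms(2) by auto
  show im: "\<bar>Im (Ln y)\<bar> < pi / 2"
    using assms(2) Re_Ln_pos_lt[OF y0] by simp
  have "\<bar>\<beta> * Im (Ln y)\<bar> \<le> 1 * \<bar>Im (Ln y)\<bar>"
    unfolding abs_mult using \<beta>_bounds by (intro mult_right_mono) auto
  then have "\<bar>\<beta> * Im (Ln y)\<bar> < pi" using im pi_gt_zero by linarith
  then show "Ln (tau a z) = of_real \<beta> * Ln y"
    unfolding tau_eq[OF assms(1) y0] by (intro Ln_exp) auto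
qed

text \<open>Since ln \<tau> = \<beta> ln y, the argument is rescaled by \<open>\<beta>\<close>, and
  the period \<open>ln 2\<close> becomes \<open>\<beta> * ln 2 = ln (2 - a)\<close>.\<close>

definition "\<Psi> w = per (w / of_real \<beta>)"

definition "\<Psi>_strip = {w :: complex. \<bar>Im w\<bar> < \<beta> * (pi / 2)}"

lemma \<Psi>_holomorphic: "\<Psi> holomorphic_on \<Psi>_strip"
  unfolding \<Psi>_def[abs_def]
  by (rule holomorphic_on_compose_gen[OF _ per_holomorphic, unfolded o_def])
     (use \<beta>_bounds in \<open>auto intro!: holomorphic_intros simp: \<Psi>_strip_def Im_divide_of_real field_simps\<close>)

lemma \<Psi>_analytic_extension: "analytic_extension (\<lambda>x. Re (\<Psi> (of_real x))) \<Psi>_strip \<Psi>"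
  unfolding analytic_extension_def
proof (intro conjI allI)
  have eq: "\<Psi>_strip = {w. Im w < \<beta> * (pi / 2)} \<inter> {w. Im w > - (\<beta> * (pi / 2))}"
    by (auto simp: \<Psi>_strip_def)
  show "open \<Psi>_strip" unfolding eq by (intro open_Int open_halfspace_Im_lt open_halfspace_Im_gt)
  show "connected \<Psi>_strip"
    unfolding eq by (intro convex_connected convex_Int convex_halfspace_Im_lt convex_halfspace_Im_gt)
  show "\<real> \<subseteq> \<Psi>_strip" using \<beta>_bounds by (auto simp: \<Psi>_strip_def complex_is_Real_iff)
  show "\<Psi> (of_real x) = of_real (Re (\<Psi> (of_real x)))" for x
    using per_real[of "x / \<beta>"] by (simp add: \<Psi>_def complex_is_Real_iff complex_eq_iff)
qed (rule \<Psi>_holomorphic)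

lemma \<Psi>_real_analytic: "real_analytic (\<lambda>x. Re (\<Psi> (of_real x)))"
  unfolding real_analytic_def
proof (intro allI exI conjI impI)
  fix x y :: real
  let ?r = "\<beta> * (pi / 2)"
  show "0 < ?r" using \<beta>_bounds by simp
  assume y: "\<bar>y - x\<bar> < ?r"
  have "ball (complex_of_real x) ?r \<subseteq> \<Psi>_strip"
  proof
    fix w assume "w \<in> ball (complex_of_real x) ?r"
    then show "w \<in> \<Psi>_strip"
      using abs_Im_le_cmod[of "w - of_real x"] by (auto simp: \<Psi>_strip_def dist_norm norm_minus_commute)
  qed
  then have "\<Psi> holomorphic_on ball (of_real x) ?r" by (rule holomorphic_on_subset[OF \<Psi>_holomorphic])
  moreover have "complex_of_real y \<in> ball (of_real x) ?r"
    using y by (simp add: dist_norm abs_minus_commute flip: of_real_diff)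
  ultimately have "(\<lambda>n. (deriv ^^ n) \<Psi> (of_real x) / fact n * (of_real y - of_real x) ^ n) sums \<Psi> (of_real y)"
    by (rule holomorphic_power_series)
  then have "(\<lambda>n. Re ((deriv ^^ n) \<Psi> (of_real x) / fact n * (of_real y - of_real x) ^ n)) sums Re (\<Psi> (of_real y))"
    by (rule sums_Re)
  moreover have "Re (w * (of_real y - of_real x) ^ n) = Re w * (y - x) ^ n" for w n
    by (simp flip: of_real_diff of_real_power)
  ultimately show "(\<lambda>n. Re ((deriv ^^ n) \<Psi> (of_real x) / fact n) * (y - x) ^ n) sums Re (\<Psi> (of_real y))"
    by (simp only:)
qed

lemma \<Psi>_periodic: "\<Psi> (of_real (u + ln (2 - a))) = \<Psi> (of_real u)"
proof -
  have "ln (2 - a) / \<beta> = ln 2"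
    using \<mu>_bounds \<beta>_bounds by (simp add: \<beta>_def log_def \<mu>_def)
  then have "complex_of_real (u + ln (2 - a)) / of_real \<beta> = of_real (u / \<beta>) + of_real (ln 2)"
    by (simp add: add_divide_distrib flip: of_real_divide of_real_add)
  then show ?thesis using per_periodic[of "of_real (u / \<beta>)"] by (simp add: \<Psi>_def)
qed

lemma tau_mult_\<Psi>:
  assumes "y = Ln (inverse z)" "0 < Re y"
  shows "Ln (tau a z) \<in> \<Psi>_strip" "tau a z * \<Psi> (Ln (tau a z)) = S y / of_real slope"
proof -
  have y0: "y \<noteq> 0" using assms(2) by auto
  note L = Ln_tau[OF assms]
  show "Ln (tau a z) \<in> \<Psi>_strip" using L \<beta>_bounds by (simp add: \<Psi>_strip_def abs_mult)
  have "\<Psi> (Ln (tau a z)) = per (Ln y)" using L(1) \<beta>_bounds by (simp add: \<Psi>_def)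
  then show "tau a z * \<Psi> (Ln (tau a z)) = S y / of_real slope"
    using S_eq_per[of "Ln y"] y0 by (simp add: tau_eq[OF assms(1) y0])
qed

lemma G_near_1:
  assumes "0 < e" "e \<le> r\<Phi>"
  obtains \<epsilon> where "0 < \<epsilon>" "\<epsilon> \<le> 1 / 2"
    "\<And>z. norm z < 1 \<Longrightarrow> norm (1 - z) < \<epsilon> \<Longrightarrow>
      z \<noteq> 0 \<and> 0 < Re (Ln (inverse z)) \<and> norm (S (Ln (inverse z)) / of_real slope) < e \<and>
      G z = \<Phi> (S (Ln (inverse z)) / of_real slope)"
proof -
  have sl: "0 < \<bar>slope\<bar>" using slope_nz by simp
  have "e * \<bar>slope\<bar> \<le> r\<Phi> * \<bar>slope\<bar>" using assms by (intro mult_right_mono) auto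
  also have "\<dots> \<le> R0" using sl by (simp add: r\<Phi>_def)
  finally have "e * \<bar>slope\<bar> \<le> R0" .
  moreover have "0 < e * \<bar>slope\<bar>" using assms sl by simp
  ultimately obtain \<eta> where \<eta>: "0 < \<eta>" "\<And>y. 0 \<le> Re y \<Longrightarrow> norm y < \<eta> \<Longrightarrow>
      E0 y - of_real \<rho> = poincare (S y) \<and> norm (S y) < e * \<bar>slope\<bar>"
    using E0_poincare_near_0 by metis
  obtain \<epsilon> where \<epsilon>: "0 < \<epsilon>" "\<epsilon> \<le> 1 / 2" "\<And>z :: complex. norm z < 1 \<Longrightarrow> norm (1 - z) < \<epsilon> \<Longrightarrow>
      z \<noteq> 0 \<and> 0 < Re (Ln (inverse z)) \<and> norm (Ln (inverse z)) < \<eta> \<and> exp (- Ln (inverse z)) = z"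
    using Ln_inverse_near_1[OF \<eta>(1)] by metis
  show ?thesis
  proof (rule that[OF \<epsilon>(1,2)])
    fix z :: complex assume z: "norm z < 1" "norm (1 - z) < \<epsilon>"
    note f = \<epsilon>(3)[OF z]
    have g: "E0 (Ln (inverse z)) - of_real \<rho> = poincare (S (Ln (inverse z)))"
      "norm (S (Ln (inverse z))) < e * \<bar>slope\<bar>"
      using \<eta>(2)[of "Ln (inverse z)"] f by auto
    have "norm (S (Ln (inverse z)) / of_real slope) < e"
      using g(2) sl by (simp add: norm_divide field_simps)
    then show "z \<noteq> 0 \<and> 0 < Re (Ln (inverse z)) \<and> norm (S (Ln (inverse z)) / of_real slope) < e \<and>
      G z = \<Phi> (S (Ln (inverse z)) / of_real slope)"
      using f z(1) g(1) G_eq_\<Phi> by blast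
  qed
qed

section \<open>Fourier series and the expansion in powers of t\<close>

definition "freq = 2 * pi / ln 2"

lemma freq_pos: "0 < freq"
  by (simp add: freq_def)

text \<open>In the variable \<open>exp (\<i> freq v)\<close> the Fourier series are Laurent series on an annulus. The strip
  of holomorphy has half width \<open>pi / 2 > 1\<close>, whence the decay rate \<open>exp (- freq)\<close>.\<close>

lemma per_power_fourier:
  obtains c B where "1 \<le> B" "\<And>k l. norm (c k l) \<le> B ^ k * exp (- freq) ^ nat \<bar>l\<bar>"
    "\<And>k v. \<bar>Im v\<bar> < 1 \<Longrightarrow> ((\<lambda>l. c k l * exp (\<i> * of_real freq * of_int l * v)) has_sum per v ^ k) UNIV"
proof -
  define W where "W v = exp (\<i> * of_real freq * v)" for v
  define V where "V w = - \<i> * w / of_real freq" for w :: complex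
  define g where "g w = per (V (Ln w))" for w
  have im: "Im (V w) = - Re w / freq" for w
    by (simp add: V_def Im_divide_of_real)
  have norm_W: "norm (W v) = exp (- freq * Im v)" for v by (simp add: W_def)
  have ln_bound: "\<bar>x / freq\<bar> < d" if "- (freq * d) < x" "x < freq * d" for x d
    using that freq_pos by (auto simp: abs_less_iff field_simps)
  \<comment> \<open>The logarithm recovers the exponent up to a multiple of
    \<open>2 * pi * \<i>\<close>, which \<open>V\<close> turns into a multiple of the period
    \<open>ln 2\<close>.\<close>
  have g_W: "g (W v) = per v" if "\<bar>Im v\<bar> < pi / 2" for v
  proof -
    obtain n :: int where "Ln (W v) = \<i> * of_real freq * v + of_int n * (2 * of_real pi) * \<i>"
    proof -
      have "exp (Ln (W v)) = exp (\<i> * of_real freq * v)" by (simp add: W_def)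
      then show ?thesis using that by (auto simp: exp_eq mult_ac)
    qed
    then have "V (Ln (W v)) = (\<i> * of_real freq * v + of_int n * (2 * of_real pi) * \<i>) * (- \<i>) / of_real freq"
      by (simp add: V_def)
    also have "\<dots> = v + of_int n * of_real (2 * pi / freq)"
      using freq_pos by (simp add: field_simps)
    also have "2 * pi / freq = ln 2" by (simp add: freq_def)
    finally show ?thesis using per_periodic_int[OF that] by (simp add: g_def)
  qed
  define R' where "R' = exp (freq * (pi / 2))"
  define R where "R = exp freq"
  have R: "1 < R" "R < R'"
    using freq_pos pi_gt3 by (auto simp: R_def R'_def)
  let ?A = "{w :: complex. inverse R' < norm w \<and> norm w < R'}"
  have A: "w \<noteq> 0" "\<bar>ln (norm w) / freq\<bar> < pi / 2" if "w \<in> ?A" for w :: complex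
  proof -
    have "0 < inverse R'" by (simp add: R'_def)
    then show "w \<noteq> 0" using that by auto
    then have "0 < norm w" "0 < R'" by (auto simp: R'_def)
    then have "ln (inverse R') < ln (norm w)" "ln (norm w) < ln R'"
      using that \<open>0 < inverse R'\<close> by (simp_all only: ln_less_cancel_iff mem_Collect_eq)
    then show "\<bar>ln (norm w) / freq\<bar> < pi / 2"
      by (intro ln_bound) (auto simp: R'_def ln_inverse)
  qed
  have openA: "open ?A" by (intro open_Collect_conj open_Collect_less continuous_intros)
  \<comment> \<open>A second branch, with its cut on the positive axis, represents the same
    function; together the two branches give holomorphy on the whole annulus.\<close>
  have g_shift: "g w = per (V (Ln (- w) + \<i> * of_real pi))" if "w \<in> ?A" for w
  proof -
    have "W (V (Ln (- w) + \<i> * of_real pi)) = exp (Ln (- w) + \<i> * of_real pi)"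
    proof -
      have "\<i> * of_real freq * V x = x" for x using freq_pos by (simp add: V_def)
      then show ?thesis by (simp only: W_def)
    qed
    also have "\<dots> = w" using A(1)[OF that] by (simp add: exp_add exp_pi_i')
    finally have "g w = g (W (V (Ln (- w) + \<i> * of_real pi)))" by simp
    also have "\<dots> = per (V (Ln (- w) + \<i> * of_real pi))"
      using A[OF that] by (intro g_W) (simp add: im)
    finally show ?thesis .
  qed
  have g_holo: "g holomorphic_on ?A"
  proof -
    have "V (Ln w) \<in> {v. \<bar>Im v\<bar> < pi / 2}" if "w \<in> ?A" for w
      using A[OF that] by (simp add: im)
    then have 1: "g holomorphic_on ?A - \<real>\<^sub>\<le>\<^sub>0"
      unfolding g_def
      by (intro holomorphic_on_compose_gen[OF _ per_holomorphic, unfolded o_def])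
         (use freq_pos in \<open>auto simp: V_def intro!: holomorphic_intros\<close>)
    have "V (Ln (- w) + \<i> * of_real pi) \<in> {v. \<bar>Im v\<bar> < pi / 2}" if "w \<in> ?A" for w
      using A[OF that] by (simp add: im)
    then have "(\<lambda>w. per (V (Ln (- w) + \<i> * of_real pi))) holomorphic_on ?A - \<real>\<^sub>\<ge>\<^sub>0"
      by (intro holomorphic_on_compose_gen[OF _ per_holomorphic, unfolded o_def])
         (use freq_pos in \<open>auto simp: V_def complex_nonpos_Reals_iff complex_nonneg_Reals_iff intro!: holomorphic_intros\<close>)
    then have 2: "g holomorphic_on ?A - \<real>\<^sub>\<ge>\<^sub>0"
      by (rule holomorphic_transform) (auto simp: g_shift)
    have "g holomorphic_on (?A - \<real>\<^sub>\<le>\<^sub>0) \<union> (?A - \<real>\<^sub>\<ge>\<^sub>0)"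
      by (intro holomorphic_on_Un 1 2 open_Diff openA closed_nonpos_Reals_complex closed_nonneg_Reals_complex)
    moreover have "?A \<subseteq> (?A - \<real>\<^sub>\<le>\<^sub>0) \<union> (?A - \<real>\<^sub>\<ge>\<^sub>0)"
      using A(1) by (auto simp: complex_nonpos_Reals_iff complex_nonneg_Reals_iff complex_eq_iff)
    ultimately show ?thesis by (rule holomorphic_on_subset)
  qed
  have "compact (sphere 0 R \<union> sphere (0 :: complex) (inverse R))" by (intro compact_Un compact_sphere)
  moreover have "sphere 0 R \<union> sphere (0 :: complex) (inverse R) \<subseteq> ?A"
  proof -
    have "inverse R < 1" "inverse R' < inverse R" using R by (auto intro: less_imp_inverse_less simp: inverse_less_1_iff)
    then have "inverse R' < R" "inverse R < R'" "inverse R' < inverse R" using R by linarith+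
    then show ?thesis using R by auto
  qed
  ultimately have "compact (g ` (sphere 0 R \<union> sphere 0 (inverse R)))"
    by (intro compact_continuous_image continuous_on_subset[OF holomorphic_on_imp_continuous_on[OF g_holo]])
  then obtain B0 where B0: "\<And>w. norm w = R \<or> norm w = inverse R \<Longrightarrow> norm (g w) \<le> B0"
    using compact_imp_bounded by (fastforce simp: bounded_iff)
  \<comment> \<open>One bound for all powers: the k-th power of \<open>g\<close> is at most
    \<open>B ^ k\<close> on both circles, so the coefficients grow only geometrically in
    \<open>k\<close>.\<close>
  define B where "B = max 1 B0"
  have "\<exists>c :: int \<Rightarrow> complex. (\<forall>l. norm (c l) \<le> B ^ k * inverse R ^ nat \<bar>l\<bar>) \<and>
      (\<forall>w. inverse R < norm w \<longrightarrow> norm w < R \<longrightarrow> ((\<lambda>l. c l * w powi l) has_sum g w ^ k) UNIV)" for k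
  proof -
    have bd: "norm (g w ^ k) \<le> B ^ k" if "norm w = R \<or> norm w = inverse R" for w
      using B0[OF that] by (auto simp: norm_power B_def intro!: power_mono)
    have hol: "(\<lambda>w. g w ^ k) holomorphic_on ?A" by (intro holomorphic_intros g_holo)
    show ?thesis by (rule laurent_annulus[OF hol R bd]) blast+
  qed
  then obtain c :: "nat \<Rightarrow> int \<Rightarrow> complex" where c: "\<And>k l. norm (c k l) \<le> B ^ k * inverse R ^ nat \<bar>l\<bar>"
      "\<And>k w. inverse R < norm w \<Longrightarrow> norm w < R \<Longrightarrow> ((\<lambda>l. c k l * w powi l) has_sum g w ^ k) UNIV"
    by metis
  show ?thesis
  proof (rule that[of B c])
    show "1 \<le> B" by (simp add: B_def)
    show "norm (c k l) \<le> B ^ k * exp (- freq) ^ nat \<bar>l\<bar>" for k l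
      using c(1)[of k l] by (simp add: R_def exp_minus)
    fix k v assume v: "\<bar>Im (v :: complex)\<bar> < 1"
    have "- freq < - freq * Im v" "- freq * Im v < freq"
      using v freq_pos mult_strict_left_mono[of "Im v" 1 freq] mult_strict_left_mono[of "- Im v" 1 freq] by auto
    then have "inverse R < norm (W v)" "norm (W v) < R"
      unfolding norm_W R_def exp_minus[symmetric] by simp_all
    moreover have "g (W v) = per v"
    proof (rule g_W)
      have "1 < pi / 2" using pi_gt3 by simp
      with v show "\<bar>Im v\<bar> < pi / 2" by (rule less_trans)
    qed
    moreover have "W v powi l = exp (\<i> * of_real freq * of_int l * v)" for l
    proof -
      have "\<i> * of_real freq * of_int l * v = of_int l * (\<i> * of_real freq * v)" by (simp only: mult_ac)
      then show ?thesis by (simp only: W_def exp_power_int)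
    qed
    ultimately show "((\<lambda>l. c k l * exp (\<i> * of_real freq * of_int l * v)) has_sum per v ^ k) UNIV"
      using c(2)[of "W v" k] by simp
  qed
qed

definition "rate k l = of_real (real k * \<beta>) + \<i> * of_real freq * of_int l"

lemma expansion_exponent_eq: "expansion_exponent a l k m = rate k l + of_nat m"
proof -
  have "ln (2 - a) \<noteq> 0" using \<mu>_bounds by (simp add: \<mu>_def)
  then have "log 2 (2 - a) / ln (2 - a) = 1 / ln 2" by (simp add: log_def)
  then show ?thesis by (simp add: expansion_exponent_def rate_def freq_def \<beta>_def mult_ac)
qed

lemma norm_rate_le: "norm (rate k l) \<le> real k + freq * nat \<bar>l\<bar>"
proof -
  have "norm (rate k l) \<le> norm (complex_of_real (real k * \<beta>)) + norm (\<i> * of_real freq * of_int l)"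
    unfolding rate_def by (rule norm_triangle_ineq)
  also have "\<dots> = real k * \<beta> + freq * \<bar>real_of_int l\<bar>"
    using freq_pos \<beta>_bounds by (simp add: norm_mult)
  also have "\<dots> \<le> real k * 1 + freq * nat \<bar>l\<bar>"
    using \<beta>_bounds freq_pos by (intro add_mono mult_left_mono) auto
  finally show ?thesis by simp
qed

text \<open>An imaginary exponent \<open>freq * l\<close> contributes
  \<open>exp (- freq * l * Arg t)\<close>. The cost in \<open>l\<close> is thus controlled by the
  opening angle of the sector, not by the size of \<open>t\<close>.\<close>

lemma norm_powr_rate:
  assumes "t \<noteq> 0" "\<bar>Arg t\<bar> \<le> \<delta>"
  shows "norm (t powr (rate k l + of_nat m)) \<le> (norm t powr \<beta>) ^ k * exp (freq * \<delta>) ^ nat \<bar>l\<bar> * norm t ^ m"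
proof -
  have Ln: "Re (Ln t) = ln (norm t)" "Im (Ln t) = Arg t" using assms by (simp_all add: Arg_def)
  have "Re ((rate k l + of_nat m) * Ln t) = real k * \<beta> * ln (norm t) + real m * ln (norm t) - freq * real_of_int l * Arg t"
    by (simp add: rate_def Ln algebra_simps)
  also have "\<dots> \<le> real k * (\<beta> * ln (norm t)) + real m * ln (norm t) + nat \<bar>l\<bar> * (freq * \<delta>)"
  proof -
    have "- (freq * real_of_int l * Arg t) \<le> freq * (\<bar>real_of_int l\<bar> * \<bar>Arg t\<bar>)"
      using freq_pos abs_ge_self[of "- (freq * real_of_int l * Arg t)"] by (simp add: abs_mult mult_ac)
    also have "\<dots> \<le> freq * (\<bar>real_of_int l\<bar> * \<delta>)"
      using freq_pos assms by (intro mult_left_mono) auto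
    finally show ?thesis by (simp add: mult_ac)
  qed
  finally have le: "exp (Re ((rate k l + of_nat m) * Ln t)) \<le> exp (real k * (\<beta> * ln (norm t)) + real m * ln (norm t) + nat \<bar>l\<bar> * (freq * \<delta>))"
    by (simp only: exp_le_cancel_iff)
  have "norm (t powr (rate k l + of_nat m)) = exp (Re ((rate k l + of_nat m) * Ln t))"
    using assms(1) unfolding powr_def by (simp only: norm_exp_eq_Re if_False)
  also have "\<dots> \<le> exp (real k * (\<beta> * ln (norm t)) + real m * ln (norm t) + nat \<bar>l\<bar> * (freq * \<delta>))"
    by (rule le)
  also have "\<dots> = exp (\<beta> * ln (norm t)) ^ k * exp (ln (norm t)) ^ m * exp (freq * \<delta>) ^ nat \<bar>l\<bar>"
    by (simp only: exp_add exp_of_nat_mult)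
  also have "\<dots> = (norm t powr \<beta>) ^ k * exp (freq * \<delta>) ^ nat \<bar>l\<bar> * norm t ^ m"
    using assms(1) by (simp add: powr_def mult_ac)
  finally show ?thesis .
qed

text \<open>Equivalent to \<open>(ln 2)\<^sup>2 \<le> pi\<close>.\<close>

lemma exp_freq_half: "exp (- (freq / 2)) \<le> 1 / 2"
proof -
  have "ln 2 < (1 :: real)" using ln_2_less_1 by simp
  moreover have "ln 2 * ln 2 \<le> 1 * (1 :: real)" using ln_2_less_1 by (intro mult_mono) auto
  ultimately have "ln 2 \<le> freq / 2" using pi_gt3 by (simp add: freq_def field_simps)
  then have "exp (- (freq / 2)) \<le> exp (- ln 2)" by simp
  then show ?thesis by (simp add: exp_minus)
qed

text \<open>Each coefficient is a product of three: the k-th Taylor coefficient of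
  \<open>\<Phi>\<close>, the l-th Fourier coefficient of \<open>per ^ k\<close>, and the m-th Taylor
  coefficient of \<open>exp (rate k l * \<theta> t)\<close>. The last one arises from writing ln y
  as \<open>Ln t + \<theta> t\<close>.\<close>

lemma G_expansion:
  "\<exists>C :: int \<Rightarrow> nat \<Rightarrow> nat \<Rightarrow> complex. \<exists>\<epsilon>>0. \<exists>\<delta>>0.
     (\<forall>z \<in> disc_sector \<epsilon> \<delta>.
        ((\<lambda>(l, k, m). C l k m * (1 - z) powr expansion_exponent a l k m)
           has_sum (G z - complex_of_real (a / (1 - a)))) UNIV) \<and>
     (\<exists>M q. 0 < q \<and> q < 1 \<and>
        (\<forall>z \<in> disc_sector \<epsilon> \<delta>. \<forall>l k m.
           norm (C l k m * (1 - z) powr expansion_exponent a l k m)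
             \<le> M * q ^ (nat \<bar>l\<bar> + k + m)))"
proof -
  obtain B c where B: "1 \<le> B" and c: "\<And>k l. norm (c k l) \<le> B ^ k * exp (- freq) ^ nat \<bar>l\<bar>"
      "\<And>k v. \<bar>Im v\<bar> < 1 \<Longrightarrow> ((\<lambda>l. c k l * exp (\<i> * of_real freq * of_int l * v)) has_sum per v ^ k) UNIV"
    by (rule per_power_fourier) (rule that)
  have quarter: "0 < (1 / 4 :: real)" "(1 / 4 :: real) \<le> 1" by simp_all
  obtain r \<theta> where r: "0 < r" and \<theta>: "\<theta> holomorphic_on ball 0 r" "\<And>t. norm t < r \<Longrightarrow> norm (\<theta> t) < 1 / 4"
      "\<And>t. norm t < r \<Longrightarrow> t \<noteq> 0 \<Longrightarrow> \<bar>Arg t\<bar> < 1 \<Longrightarrow> Ln (Ln (inverse (1 - t))) = Ln t + \<theta> t"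
    by (rule Ln_Ln_inverse_expansion[OF quarter]) (rule that)
  define s where "s = r / 2"
  have s: "0 < s" "s < r" using r by (auto simp: s_def)
  define b where "b \<gamma> m = (deriv ^^ m) (\<lambda>t. exp (\<gamma> * \<theta> t)) 0 / fact m" for \<gamma> m
  have b_holo: "(\<lambda>t. exp (\<gamma> * \<theta> t)) holomorphic_on ball 0 r" for \<gamma>
    by (intro holomorphic_intros \<theta>)
  have b_bound: "norm (b \<gamma> m) \<le> exp (norm \<gamma> / 4) / s ^ m" for \<gamma> m
    unfolding b_def
  proof (rule power_series_coeff_bound[OF b_holo s])
    fix t :: complex assume "norm t = s"
    then have "norm (\<gamma> * \<theta> t) \<le> norm \<gamma> * (1 / 4)"
      unfolding norm_mult using \<theta>(2)[of t] s by (intro mult_left_mono) auto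
    moreover have "Re (\<gamma> * \<theta> t) \<le> norm (\<gamma> * \<theta> t)" by (rule complex_Re_le_cmod)
    ultimately show "norm (exp (\<gamma> * \<theta> t)) \<le> exp (norm \<gamma> / 4)" unfolding norm_exp_eq_Re by simp
  qed
  \<comment> \<open>The constant term is dropped because the series represents \<open>G\<close>
    minus its limit \<open>\<Phi> 0\<close>.\<close>
  define \<phi> where "\<phi> k = (if k = 0 then 0 else (deriv ^^ k) \<Phi> 0 / fact k)" for k
  define \<sigma> where "\<sigma> = r\<Phi> / 2"
  have \<sigma>: "0 < \<sigma>" "\<sigma> < r\<Phi>" using r\<Phi>_pos by (auto simp: \<sigma>_def)
  have "compact (\<Phi> ` sphere 0 \<sigma>)"
    using \<sigma> by (intro compact_continuous_image continuous_on_subset[OF holomorphic_on_imp_continuous_on[OF \<Phi>_holomorphic]]) auto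
  then obtain M where M: "\<And>x. norm x = \<sigma> \<Longrightarrow> norm (\<Phi> x) \<le> M"
    using compact_imp_bounded by (fastforce simp: bounded_iff)
  have "norm (complex_of_real \<sigma>) = \<sigma>" using \<sigma> by simp
  then have M0: "0 \<le> M" using M norm_ge_zero order_trans by blast
  have \<phi>_bound: "norm (\<phi> k) \<le> M / \<sigma> ^ k" for k
    using power_series_coeff_bound[OF \<Phi>_holomorphic \<sigma> M, of k] M0 by (simp add: \<phi>_def)
  define C where "C l k m = \<phi> k * c k l * b (rate k l) m" for l k m
  obtain \<epsilon>0 where \<epsilon>0: "0 < \<epsilon>0" "\<epsilon>0 \<le> 1 / 2"
    "\<And>z. norm z < 1 \<Longrightarrow> norm (1 - z) < \<epsilon>0 \<Longrightarrow>
      z \<noteq> 0 \<and> 0 < Re (Ln (inverse z)) \<and> norm (S (Ln (inverse z)) / of_real slope) < r\<Phi> \<and>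
      G z = \<Phi> (S (Ln (inverse z)) / of_real slope)"
    by (rule G_near_1[OF r\<Phi>_pos order_refl]) (rule that)
  \<comment> \<open>For \<open>norm t powr \<beta> \<le> T\<close> the base of the k-th powers,
    \<open>B * exp (1 / 4) * norm t powr \<beta> / \<sigma>\<close>, is at most 1/2.\<close>
  define T where "T = \<sigma> / (2 * B * exp (1 / 4))"
  have T: "0 < T" using \<sigma> B by (simp add: T_def)
  define \<epsilon> where "\<epsilon> = min \<epsilon>0 (min (s / 2) (T powr (1 / \<beta>)))"
  have \<epsilon>: "0 < \<epsilon>" "\<epsilon> \<le> \<epsilon>0" "\<epsilon> \<le> s / 2" "\<epsilon> \<le> T powr (1 / \<beta>)"
    using \<epsilon>0 s T by (auto simp: \<epsilon>_def)
  define t where "t z = 1 - z" for z :: complex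
  have t: "t z \<noteq> 0" "norm (t z) < \<epsilon>" "\<bar>Arg (t z)\<bar> \<le> 1 / 4" "\<bar>Arg (t z)\<bar> < 1" "norm z < 1"
      if "z \<in> disc_sector \<epsilon> (1 / 4)" for z
    using that by (auto simp: disc_sector_def t_def)
  have bound: "norm (C l k m * t z powr expansion_exponent a l k m) \<le> M * (1 / 2) ^ (nat \<bar>l\<bar> + k + m)"
    if z: "z \<in> disc_sector \<epsilon> (1 / 4)" for z l k m
  proof -
    define L where "L = nat \<bar>l\<bar>"
    define \<tau> where "\<tau> = norm (t z) powr \<beta>"
    have "norm (b (rate k l) m) \<le> exp ((real k + freq * L) / 4) / s ^ m"
      using norm_rate_le[of k l] s unfolding L_def
      by (intro order_trans[OF b_bound] divide_right_mono) auto
    also have "(real k + freq * L) / 4 = real k * (1 / 4) + real L * (freq / 4)" by (simp add: field_simps)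
    also have "exp \<dots> = exp (1 / 4) ^ k * exp (freq / 4) ^ L" by (simp only: exp_add exp_of_nat_mult)
    finally have bb: "norm (b (rate k l) m) \<le> exp (1 / 4) ^ k * exp (freq / 4) ^ L / s ^ m" .
    have tt: "norm (t z powr expansion_exponent a l k m) \<le> \<tau> ^ k * exp (freq * (1 / 4)) ^ L * norm (t z) ^ m"
      unfolding expansion_exponent_eq L_def \<tau>_def by (rule norm_powr_rate) (use t[OF z] in auto)
    have "norm (C l k m * t z powr expansion_exponent a l k m)
        = norm (\<phi> k) * norm (c k l) * norm (b (rate k l) m) * norm (t z powr expansion_exponent a l k m)"
      by (simp add: C_def norm_mult)
    also have "\<dots> \<le> (M / \<sigma> ^ k) * (B ^ k * exp (- freq) ^ L) * (exp (1 / 4) ^ k * exp (freq / 4) ^ L / s ^ m)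
        * (\<tau> ^ k * exp (freq * (1 / 4)) ^ L * norm (t z) ^ m)"
      using \<phi>_bound[of k] c(1)[of k l] bb tt M0 \<sigma> B s unfolding L_def[symmetric]
      by (intro mult_mono mult_nonneg_nonneg divide_nonneg_nonneg zero_le_power norm_ge_zero) auto
    \<comment> \<open>In the powers with exponent \<open>L\<close> the Fourier decay
      \<open>exp (- freq)\<close> pays for two losses of \<open>exp (freq / 4)\<close>, one from the
      bound 1/4 on \<open>\<theta>\<close> and one from the opening angle 1/4. What remains is
      \<open>exp (- (freq / 2))\<close>.\<close>
    also have "\<dots> = M * (B * exp (1 / 4) * \<tau> / \<sigma>) ^ k * (exp (- freq) * exp (freq / 4) * exp (freq * (1 / 4))) ^ L * (norm (t z) / s) ^ m"
      by (simp add: power_mult_distrib power_divide mult_ac)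
    also have "\<dots> \<le> M * (1 / 2) ^ k * (1 / 2) ^ L * (1 / 2) ^ m"
    proof (intro mult_mono power_mono M0 order_refl mult_nonneg_nonneg zero_le_power)
      have "\<tau> \<le> (T powr (1 / \<beta>)) powr \<beta>"
        unfolding \<tau>_def using t(2)[OF z] \<epsilon>(4) \<beta>_bounds by (intro powr_mono2) auto
      also have "\<dots> = T" using T \<beta>_bounds by (simp add: powr_powr)
      finally have "B * exp (1 / 4) * \<tau> / \<sigma> \<le> B * exp (1 / 4) * T / \<sigma>"
        using B \<sigma> by (intro divide_right_mono mult_left_mono) auto
      also have "\<dots> = 1 / 2" using B \<sigma> by (simp add: T_def)
      finally show "B * exp (1 / 4) * \<tau> / \<sigma> \<le> 1 / 2" .
      have "exp (- freq) * exp (freq / 4) * exp (freq * (1 / 4)) = exp (- (freq / 2))"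
        by (simp flip: exp_add)
      then show "exp (- freq) * exp (freq / 4) * exp (freq * (1 / 4)) \<le> 1 / 2" using exp_freq_half by simp
      show "norm (t z) / s \<le> 1 / 2" using t(2)[OF z] \<epsilon>(3) s by (simp add: field_simps)
    qed (use B \<sigma> s in \<open>auto simp: \<tau>_def\<close>)
    also have "\<dots> = M * (1 / 2) ^ (nat \<bar>l\<bar> + k + m)" by (simp add: L_def power_add mult_ac)
    finally show ?thesis .
  qed
  have sum: "((\<lambda>(l, k, m). C l k m * t z powr expansion_exponent a l k m)
      has_sum (G z - complex_of_real (a / (1 - a)))) UNIV" if z: "z \<in> disc_sector \<epsilon> (1 / 4)" for z
  proof -
    note tz = t[OF z]
    define y where "y = Ln (inverse z)"
    define v where "v = Ln y"
    have f: "z \<noteq> 0" "0 < Re y" "norm (S y / of_real slope) < r\<Phi>" "G z = \<Phi> (S y / of_real slope)"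
      using \<epsilon>0(3)[of z] tz \<epsilon>(2) by (auto simp: y_def t_def)
    have y0: "y \<noteq> 0" using f(2) by auto
    have tr: "norm (t z) < r" using tz(2) \<epsilon>(3) s by linarith
    have v: "v = Ln (t z) + \<theta> (t z)"
      using \<theta>(3)[OF tr tz(1,4)] by (simp add: v_def y_def t_def del: Ln_inverse)
    have "\<bar>Im v\<bar> < 1"
    proof -
      have "\<bar>Im (\<theta> (t z))\<bar> < 1 / 4" using \<theta>(2)[OF tr] abs_Im_le_cmod[of "\<theta> (t z)"] by linarith
      moreover have "Im (Ln (t z)) = Arg (t z)" using tz(1) by (simp add: Arg_def)
      ultimately show ?thesis using tz(3) by (simp add: v)
    qed
    define u where "u = S y / of_real slope"
    have u: "u = exp (of_real \<beta> * v) * per v" using S_eq_per[of v] y0 by (simp add: u_def v_def)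
    define F where "F = (\<lambda>(k, l, m). C l k m * t z powr expansion_exponent a l k m)"
    have "(F has_sum (\<Phi> u - \<Phi> 0)) UNIV"
    proof (rule has_sum_triple[where f = "\<lambda>k l. \<phi> k * c k l * exp (rate k l * v)" and g = "\<lambda>k. \<phi> k * u ^ k"])
      have "(\<lambda>(k, l, m). M * (1 / 2) ^ (nat \<bar>l\<bar> + k + m)) summable_on UNIV"
        by (rule summable_on_geometric_triple)
      then have "(\<lambda>x. norm (F x)) summable_on UNIV"
        by (rule summable_on_comparison_test)
           (use bound[OF z] in \<open>auto simp: F_def\<close>)
      then show "F summable_on UNIV" by (rule abs_summable_summable)
      show "((\<lambda>m. F (k, l, m)) has_sum \<phi> k * c k l * exp (rate k l * v)) UNIV" for k l
      proof -
        have pw: "t z powr (rate k l + of_nat m) = exp (rate k l * Ln (t z)) * t z ^ m" for m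
          using tz(1) by (simp add: powr_def distrib_right exp_add exp_of_nat_mult)
        have "((\<lambda>m. b (rate k l) m * t z ^ m) has_sum exp (rate k l * \<theta> (t z))) UNIV"
          unfolding b_def by (rule holomorphic_power_series_has_sum[OF b_holo tr])
        then have "((\<lambda>m. \<phi> k * c k l * exp (rate k l * Ln (t z)) * (b (rate k l) m * t z ^ m)) has_sum
            \<phi> k * c k l * exp (rate k l * Ln (t z)) * exp (rate k l * \<theta> (t z))) UNIV"
          by (rule has_sum_cmult_right)
        then show ?thesis
          by (simp add: F_def C_def expansion_exponent_eq pw v distrib_left exp_add mult_ac)
      qed
      show "((\<lambda>l. \<phi> k * c k l * exp (rate k l * v)) has_sum \<phi> k * u ^ k) UNIV" for k
      proof -
        have e: "exp (rate k l * v) = exp (of_real \<beta> * v) ^ k * exp (\<i> * of_real freq * of_int l * v)" for l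
        proof -
          have "rate k l * v = of_nat k * (of_real \<beta> * v) + \<i> * of_real freq * of_int l * v"
            by (simp add: rate_def algebra_simps)
          then show ?thesis by (simp only: exp_add exp_of_nat_mult)
        qed
        have "((\<lambda>l. \<phi> k * exp (of_real \<beta> * v) ^ k * (c k l * exp (\<i> * of_real freq * of_int l * v))) has_sum
            \<phi> k * exp (of_real \<beta> * v) ^ k * per v ^ k) UNIV"
          by (intro has_sum_cmult_right c(2)) fact
        then show ?thesis unfolding e u power_mult_distrib by (simp add: mult_ac)
      qed
      have "((\<lambda>k. (deriv ^^ k) \<Phi> 0 / fact k * u ^ k) has_sum \<Phi> u) UNIV"
        by (rule holomorphic_power_series_has_sum[OF \<Phi>_holomorphic]) (use f in \<open>simp add: u_def\<close>)
      moreover have "((\<lambda>k. if k = 0 then - \<Phi> 0 else 0) has_sum - \<Phi> 0) (UNIV :: nat set)"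
        using has_sum_finite_neutralI[of "{0 :: nat}" UNIV "\<lambda>k. if k = 0 then - \<Phi> 0 else 0" "- \<Phi> 0"] by auto
      ultimately have "((\<lambda>k. (deriv ^^ k) \<Phi> 0 / fact k * u ^ k + (if k = 0 then - \<Phi> 0 else 0)) has_sum (\<Phi> u + - \<Phi> 0)) UNIV"
        by (rule has_sum_add)
      then have "((\<lambda>k. (deriv ^^ k) \<Phi> 0 / fact k * u ^ k + (if k = 0 then - \<Phi> 0 else 0)) has_sum (\<Phi> u - \<Phi> 0)) UNIV"
        by simp
      then show "((\<lambda>k. \<phi> k * u ^ k) has_sum (\<Phi> u - \<Phi> 0)) UNIV"
        by (rule back_subst[of "\<lambda>f. (f has_sum _) UNIV"]) (auto simp: \<phi>_def)
    qed
    \<comment> \<open>The iterated summation ran over \<open>m\<close>, then \<open>l\<close>, then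
      \<open>k\<close>; the required index order has \<open>l\<close> first.\<close>
    moreover have "bij_betw (\<lambda>(l, k, m). (k, l, m)) (UNIV :: (int \<times> nat \<times> nat) set) UNIV"
      by (rule bij_betwI[of _ _ _ "\<lambda>(k, l, m). (l, k, m)"]) auto
    ultimately have "((\<lambda>x. F (case x of (l, k, m) \<Rightarrow> (k, l, m))) has_sum (\<Phi> u - \<Phi> 0)) UNIV"
      by (subst has_sum_reindex_bij_betw)
    then show ?thesis
      by (simp add: F_def case_prod_unfold f(4) u_def \<Phi>_0)
  qed
  have "\<exists>M q. 0 < q \<and> q < 1 \<and> (\<forall>z \<in> disc_sector \<epsilon> (1 / 4). \<forall>l k m.
      norm (C l k m * (1 - z) powr expansion_exponent a l k m) \<le> M * q ^ (nat \<bar>l\<bar> + k + m))"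
    by (rule exI[of _ M], rule exI[of _ "1 / 2"]) (use bound in \<open>auto simp: t_def\<close>)
  moreover have "\<forall>z \<in> disc_sector \<epsilon> (1 / 4). ((\<lambda>(l, k, m). C l k m * (1 - z) powr expansion_exponent a l k m)
      has_sum (G z - complex_of_real (a / (1 - a)))) UNIV"
    using sum by (simp only: t_def) blast
  moreover have "0 < (1 / 4 :: real)" by simp
  ultimately show ?thesis using \<epsilon>(1) by blast
qed

end

theorem theorem1p10:
  fixes a :: real
  assumes "0 < a" and "a < 1/2"
  shows "\<exists>G :: complex \<Rightarrow> complex.
    \<comment> \<open>(i)\<close>
    G holomorphic_on ball 0 1 \<and> G 0 = 0 \<and> deriv G 0 = complex_of_real a \<and>
    (\<forall>z \<in> ball 0 1. (G z)\<^sup>2 = complex_of_real a * G (z\<^sup>2) * (1 + G z)) \<and>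
    inj_on G (ball 0 1) \<and>
    Some ` G ` ball 0 1 =
      sphere_neg_recip ` exterior (julia_set (logistic (complex_of_real a))) \<and>
    \<comment> \<open>(ii)\<close>
    hoelder_on (log 2 (2 - a)) (cball 0 1) G \<and>
    \<comment> \<open>(iii)\<close>
    barrier_of_singularities G (ball 0 1) \<and>
    (\<exists>(\<Phi> :: complex \<Rightarrow> complex) r (\<psi> :: real \<Rightarrow> real) N \<Psi>.
       r > 0 \<and> \<Phi> holomorphic_on ball 0 r \<and>
       \<Phi> 0 = complex_of_real (a / (1 - a)) \<and> deriv \<Phi> 0 = 1 \<and>
       real_analytic \<psi> \<and> (\<forall>u. \<psi> (u + ln (2 - a)) = \<psi> u) \<and>
       analytic_extension \<psi> N \<Psi> \<and>
       (\<exists>\<epsilon>>0. \<exists>\<delta>>0. \<forall>z \<in> disc_sector \<epsilon> \<delta>.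
          Ln (tau a z) \<in> N \<and> tau a z * \<Psi> (Ln (tau a z)) \<in> ball 0 r \<and>
          G z = \<Phi> (tau a z * \<Psi> (Ln (tau a z))))) \<and>
    (\<exists>C :: int \<Rightarrow> nat \<Rightarrow> nat \<Rightarrow> complex. \<exists>\<epsilon>>0. \<exists>\<delta>>0.
       (\<forall>z \<in> disc_sector \<epsilon> \<delta>.
          ((\<lambda>(l, k, m). C l k m * (1 - z) powr expansion_exponent a l k m)
             has_sum (G z - complex_of_real (a / (1 - a)))) UNIV) \<and>
       (\<exists>M q. 0 < q \<and> q < 1 \<and>
          (\<forall>z \<in> disc_sector \<epsilon> \<delta>. \<forall>l k m.
             norm (C l k m * (1 - z) powr expansion_exponent a l k m)
               \<le> M * q ^ (nat \<bar>l\<bar> + k + m))))"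
proof -
  interpret small_logistic a by standard (use assms in auto)
  obtain \<epsilon> where \<epsilon>: "0 < \<epsilon>" "\<And>z. norm z < 1 \<Longrightarrow> norm (1 - z) < \<epsilon> \<Longrightarrow>
      z \<noteq> 0 \<and> 0 < Re (Ln (inverse z)) \<and> norm (S (Ln (inverse z)) / of_real slope) < r\<Phi> \<and>
      G z = \<Phi> (S (Ln (inverse z)) / of_real slope)"
    using G_near_1[OF r\<Phi>_pos order_refl] by metis
  have near: "Ln (tau a z) \<in> \<Psi>_strip \<and> tau a z * \<Psi> (Ln (tau a z)) \<in> ball 0 r\<Phi> \<and>
      G z = \<Phi> (tau a z * \<Psi> (Ln (tau a z)))" if "z \<in> disc_sector \<epsilon> 1" for z
  proof -
    have z: "norm z < 1" "norm (1 - z) < \<epsilon>" using that by (auto simp: disc_sector_def)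
    note f = \<epsilon>(2)[OF z]
    then have "0 < Re (Ln (inverse z))" by blast
    note g = tau_mult_\<Psi>[OF refl this]
    show ?thesis unfolding g(2) mem_ball_0 using f g(1) by blast
  qed
  have iii: "\<exists>(\<Phi> :: complex \<Rightarrow> complex) r (\<psi> :: real \<Rightarrow> real) N \<Psi>.
       r > 0 \<and> \<Phi> holomorphic_on ball 0 r \<and>
       \<Phi> 0 = complex_of_real (a / (1 - a)) \<and> deriv \<Phi> 0 = 1 \<and>
       real_analytic \<psi> \<and> (\<forall>u. \<psi> (u + ln (2 - a)) = \<psi> u) \<and>
       analytic_extension \<psi> N \<Psi> \<and>
       (\<exists>\<epsilon>>0. \<exists>\<delta>>0. \<forall>z \<in> disc_sector \<epsilon> \<delta>.
          Ln (tau a z) \<in> N \<and> tau a z * \<Psi> (Ln (tau a z)) \<in> ball 0 r \<and>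
          G z = \<Phi> (tau a z * \<Psi> (Ln (tau a z))))"
  \<comment> \<open>\<open>\<Psi>\<close> is real on the real axis, so taking the real part there
    only changes the type.\<close>
  proof (rule exI[of _ \<Phi>], rule exI[of _ r\<Phi>], rule exI[of _ "\<lambda>x. Re (\<Psi> (of_real x))"],
      rule exI[of _ \<Psi>_strip], rule exI[of _ \<Psi>], intro conjI)
    show "\<exists>\<epsilon>>0. \<exists>\<delta>>0. \<forall>z \<in> disc_sector \<epsilon> \<delta>.
          Ln (tau a z) \<in> \<Psi>_strip \<and> tau a z * \<Psi> (Ln (tau a z)) \<in> ball 0 r\<Phi> \<and>
          G z = \<Phi> (tau a z * \<Psi> (Ln (tau a z)))"
      using near \<epsilon>(1) zero_less_one by blast
    show "\<forall>u. Re (\<Psi> (of_real (u + ln (2 - a)))) = Re (\<Psi> (of_real u))"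
      by (simp only: \<Psi>_periodic simp_thms)
  qed (rule r\<Phi>_pos \<Phi>_holomorphic \<Phi>_0 deriv_\<Phi>_0 \<Psi>_real_analytic \<Psi>_analytic_extension)+
  show ?thesis
  proof (rule exI[of _ G], intro conjI ballI)
    show "(G z)\<^sup>2 = complex_of_real a * G (z\<^sup>2) * (1 + G z)" if "z \<in> ball 0 1" for z
      using that by (intro G_functional_equation) simp
    show "hoelder_on (log 2 (2 - a)) (cball 0 1) G" using G_hoelder by (simp only: \<beta>_def)
  qed (fact G_holomorphic G_0 deriv_G_0 inj_on_G G_image G_barrier iii G_expansion)+
qed

end
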